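(* Let $k$ be a field. Let $R=k[\![H]\!]$ be the (completed) numerical semigroup ring, where either (i) $H=\langle a,b\rangle$ with integers $a>b>0$ and $\gcd(a,b)=1$, or (ii) $H=\langle a,a+1,\dots,a+r\rangle$ with integers $a\ge2$, $r\ge1$, and $k$ is infinite. Then the following two statements hold. (1) Every $R$-module of finite length can be built out of $R/\mathfrak{c}$ by taking direct summands and extensions, where $\mathfrak{c}$ is the conductor of $R$. (2) The IKE-closed subcategories of $\mathrm{mod}\,R$ are the zero subcategory, the subcategory of modules of finite length, the subcategory of torsionfree modules, and $\mathrm{mod}\,R$ itself.
   Context: $\mathrm{mod}\,R$ is the category of finitely generated $R$-modules. Subcategories are strictly full (full and closed under isomorphism) and nonempty. $\langle a_1,\dots,a_s\rangle$ is the additive subsemigroup of $\mathbb{N}=\{0,1,2,\dots\}$ of all $\mathbb{N}$-linear combinations of $a_1,\dots,a_s$ (including $0$). For a numerical semigroup $H$ (a subsemigroup of $\mathbb{N}$ containing $0$ with finite complement), $k[\![H]\!]$ is the completion of $k[t^h\mid h\in H]\subseteq k[t]$ at the ideal generated by the $t^h$ with $0\neq h\in H$; equivalently the ring of power series in $k[\![t]\!]$ supported on exponents in $H$. Its integral closure is $S=k[\![t]\!]$, and its conductor is $\mathfrak{c}=R:_QS=\{x\in Q\mid xS\subseteq R\}$, where $Q$ is the fraction field of $R$. A module $N$ "can be built out of $M$ by taking direct summands and extensions" if $N$ lies in the smallest strictly full subcategory of $\mathrm{mod}\,R$ containing $M$ and closed under direct summands and extensions. A subcategory $\mathcal{X}$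 of $\mathrm{mod}\,R$ is IKE-closed if it is closed under images and kernels (the image and the kernel of every homomorphism between modules in $\mathcal{X}$ lie in $\mathcal{X}$) and under extensions (if $0\to L\to M\to N\to0$ is exact with $L,N\in\mathcal{X}$, then $M\in\mathcal{X}$).
   Formalization: Statement (1) is claimed only when H is not all of ℕ (i.e. b ≥ 2 in case (i)); for b = 1, R = k[[t]] and R/c = 0, so (1) fails there; (2) is unchanged, and mod R is taken on a set large enough to contain a copy of every finitely generated R-module. *)

theory Defs
  imports
    "HOL-Computational_Algebra.Formal_Laurent_Series"
    "HOL-Algebra.QuotRing"
    "HOL-Algebra.Module"
begin

section \<open>Numerical semigroup rings\<close>

text \<open>The semigroup generated by a finite set \<open>A\<close>; not meant for infinite \<open>A\<close>.\<close>

definition sg_gen :: "nat set \<Rightarrow> nat set" where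
  "sg_gen A = {\<Sum>a\<in>A. c a * a | c. True}"

text \<open>The ring \<open>k[[H]]\<close>, realised inside \<open>S = k[[t]]\<close> as the power series supported on \<open>H\<close>.\<close>

definition sg_ring :: "nat set \<Rightarrow> 'k::field fps ring" where
  "sg_ring H = \<lparr>carrier = {f. \<forall>n. n \<notin> H \<longrightarrow> fps_nth f n = 0},
     mult = (*), one = 1, zero = 0, add = (+)\<rparr>"

text \<open>The fraction field \<open>Q\<close> of \<open>R = k[[H]]\<close>, realised inside \<open>k((t))\<close>.\<close>

definition sg_frac :: "nat set \<Rightarrow> 'k::field fls set" where
  "sg_frac H = {fps_to_fls f / fps_to_fls g | f g.
     f \<in> carrier (sg_ring H) \<and> g \<in> carrier (sg_ring H) \<and> g \<noteq> 0}"

text \<open>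
  The conductor \<open>R :\<^sub>Q S\<close> with \<open>S = k[[t]]\<close>. Since \<open>1 \<in> S\<close>, it is contained in \<open>R\<close>, so nothing is
  lost by pulling it back along \<open>k[[t]] \<subseteq> k((t))\<close>; this makes it an ideal of \<open>sg_ring H\<close>.
  If \<open>H\<close> is all of \<open>\<nat>\<close>, then \<open>R = S\<close>, the conductor is \<open>R\<close>, and \<open>R/\<cc>\<close> is the zero module,
  from which only zero modules can be built.
\<close>

definition conductor :: "nat set \<Rightarrow> 'k::field fps set" where
  "conductor H = fps_to_fls -`
     {x \<in> sg_frac H. \<forall>s. x * fps_to_fls s \<in> fps_to_fls ` carrier (sg_ring H)}"


section \<open>Modules\<close>

text \<open>
  The fields \<open>mult\<close> and \<open>one\<close> of a \<open>module\<close> record, and the values of the operations outside the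
  carrier, are irrelevant; all notions below are invariant under \<open>mod_iso\<close>.
\<close>

definition mod_hom :: "('r, 'x) ring_scheme \<Rightarrow> ('r, 'm) module \<Rightarrow> ('r, 'n) module \<Rightarrow> ('m \<Rightarrow> 'n) set" where
  "mod_hom R M N = {f \<in> carrier M \<rightarrow> carrier N.
     (\<forall>x\<in>carrier M. \<forall>y\<in>carrier M. f (x \<oplus>\<^bsub>M\<^esub> y) = f x \<oplus>\<^bsub>N\<^esub> f y) \<and>
     (\<forall>a\<in>carrier R. \<forall>x\<in>carrier M. f (a \<odot>\<^bsub>M\<^esub> x) = a \<odot>\<^bsub>N\<^esub> f x)}"

definition mod_iso :: "('r, 'x) ring_scheme \<Rightarrow> ('r, 'm) module \<Rightarrow> ('r, 'n) module \<Rightarrow> bool" where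
  "mod_iso R M N \<longleftrightarrow> (\<exists>f \<in> mod_hom R M N. bij_betw f (carrier M) (carrier N))"

definition mod_image :: "('r, 'm) module \<Rightarrow> ('r, 'n) module \<Rightarrow> ('m \<Rightarrow> 'n) \<Rightarrow> ('r, 'n) module" where
  "mod_image M N f = N\<lparr>carrier := f ` carrier M\<rparr>"

definition mod_kernel :: "('r, 'm) module \<Rightarrow> ('r, 'n) module \<Rightarrow> ('m \<Rightarrow> 'n) \<Rightarrow> ('r, 'm) module" where
  "mod_kernel M N f = M\<lparr>carrier := {x \<in> carrier M. f x = \<zero>\<^bsub>N\<^esub>}\<rparr>"

definition short_exact ::
  "('r, 'x) ring_scheme \<Rightarrow> ('r, 'l) module \<Rightarrow> ('l \<Rightarrow> 'm) \<Rightarrow> ('r, 'm) module \<Rightarrow> ('m \<Rightarrow> 'n) \<Rightarrow> ('r, 'n) module \<Rightarrow> bool" where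
  "short_exact R L f M g N \<longleftrightarrow>
     f \<in> mod_hom R L M \<and> g \<in> mod_hom R M N \<and>
     inj_on f (carrier L) \<and>
     f ` carrier L = {x \<in> carrier M. g x = \<zero>\<^bsub>N\<^esub>} \<and>
     g ` carrier M = carrier N"

definition mod_sum :: "('r, 'm) module \<Rightarrow> ('r, 'n) module \<Rightarrow> ('r, 'm \<times> 'n) module" where
  "mod_sum M N = \<lparr>carrier = carrier M \<times> carrier N, mult = undefined, one = undefined,
     zero = (\<zero>\<^bsub>M\<^esub>, \<zero>\<^bsub>N\<^esub>),
     add = (\<lambda>(x, y) (x', y'). (x \<oplus>\<^bsub>M\<^esub> x', y \<oplus>\<^bsub>N\<^esub> y')),
     smult = (\<lambda>a (x, y). (a \<odot>\<^bsub>M\<^esub> x, a \<odot>\<^bsub>N\<^esub> y))\<rparr>"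

text \<open>\<open>R/I\<close> as an \<open>R\<close>-module: a scalar acts through its class in the ring \<open>R/I\<close>.\<close>

definition quot_mod :: "'r ring \<Rightarrow> 'r set \<Rightarrow> ('r, 'r set) module" where
  "quot_mod R I = ring.extend (R Quot I)
     \<lparr>smult = (\<lambda>a X. (I +>\<^bsub>R\<^esub> a) \<otimes>\<^bsub>R Quot I\<^esub> X)\<rparr>"

definition fin_gen :: "('r, 'x) ring_scheme \<Rightarrow> ('r, 'm) module \<Rightarrow> bool" where
  "fin_gen R M \<longleftrightarrow> (\<exists>A. finite A \<and> A \<subseteq> carrier M \<and>
     (\<forall>x\<in>carrier M. \<exists>c \<in> A \<rightarrow> carrier R. x = (\<Oplus>\<^bsub>M\<^esub>a\<in>A. c a \<odot>\<^bsub>M\<^esub> a)))"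

text \<open>Finite length means that there is a composition series.\<close>

definition finite_length :: "('r, 'x) ring_scheme \<Rightarrow> ('r, 'm) module \<Rightarrow> bool" where
  "finite_length R M \<longleftrightarrow> (\<exists>(n::nat) C. C 0 = {\<zero>\<^bsub>M\<^esub>} \<and> C n = carrier M \<and>
     (\<forall>i\<le>n. submodule (C i) R M) \<and>
     (\<forall>i<n. C i \<subset> C (Suc i) \<and> (\<nexists>N. submodule N R M \<and> C i \<subset> N \<and> N \<subset> C (Suc i))))"

text \<open>Only used over domains, where the nonzerodivisors are the nonzero elements.\<close>

definition torsionfree :: "('r, 'x) ring_scheme \<Rightarrow> ('r, 'm) module \<Rightarrow> bool" where
  "torsionfree R M \<longleftrightarrow> (\<forall>a\<in>carrier R. \<forall>x\<in>carrier M.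
     a \<odot>\<^bsub>M\<^esub> x = \<zero>\<^bsub>M\<^esub> \<longrightarrow> a = \<zero>\<^bsub>R\<^esub> \<or> x = \<zero>\<^bsub>M\<^esub>)"


section \<open>Subcategories of the category of finitely generated modules\<close>

text \<open>
  \<open>mod_cat R\<close> is the category of finitely generated \<open>R\<close>-modules whose underlying set lies in the
  type \<open>'m\<close>. For an infinite ring \<open>R\<close> every finitely generated \<open>R\<close>-module has at most \<open>|R|\<close> elements.
  So as soon as \<open>R\<close> injects into \<open>'m\<close>, this category contains a copy of every finitely generated
  \<open>R\<close>-module and is equivalent to the category of all of them; isomorphism-closed classes of
  modules then correspond.
  A strictly full subcategory is given by its set of objects.
\<close>

definition mod_cat :: "('r, 'x) ring_scheme \<Rightarrow> ('r, 'm) module set" where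
  "mod_cat R = {M. module R M \<and> fin_gen R M}"

definition zero_cat :: "('r, 'x) ring_scheme \<Rightarrow> ('r, 'm) module set" where
  "zero_cat R = {M \<in> mod_cat R. carrier M = {\<zero>\<^bsub>M\<^esub>}}"

definition fl_cat :: "('r, 'x) ring_scheme \<Rightarrow> ('r, 'm) module set" where
  "fl_cat R = {M \<in> mod_cat R. finite_length R M}"

definition tf_cat :: "('r, 'x) ring_scheme \<Rightarrow> ('r, 'm) module set" where
  "tf_cat R = {M \<in> mod_cat R. torsionfree R M}"

definition subcategory :: "('r, 'x) ring_scheme \<Rightarrow> ('r, 'm) module set \<Rightarrow> bool" where
  "subcategory R X \<longleftrightarrow> X \<noteq> {} \<and> X \<subseteq> mod_cat R \<and>
     (\<forall>M\<in>X. \<forall>N\<in>mod_cat R. mod_iso R M N \<longrightarrow> N \<in> X)"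

definition closed_images :: "('r, 'x) ring_scheme \<Rightarrow> ('r, 'm) module set \<Rightarrow> bool" where
  "closed_images R X \<longleftrightarrow> (\<forall>M\<in>X. \<forall>N\<in>X. \<forall>f\<in>mod_hom R M N. mod_image M N f \<in> X)"

definition closed_kernels :: "('r, 'x) ring_scheme \<Rightarrow> ('r, 'm) module set \<Rightarrow> bool" where
  "closed_kernels R X \<longleftrightarrow> (\<forall>M\<in>X. \<forall>N\<in>X. \<forall>f\<in>mod_hom R M N. mod_kernel M N f \<in> X)"

definition closed_extensions :: "('r, 'x) ring_scheme \<Rightarrow> ('r, 'm) module set \<Rightarrow> bool" where
  "closed_extensions R X \<longleftrightarrow>
     (\<forall>L\<in>X. \<forall>N\<in>X. \<forall>M\<in>mod_cat R. \<forall>f g. short_exact R L f M g N \<longrightarrow> M \<in> X)"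

definition closed_summands :: "('r, 'x) ring_scheme \<Rightarrow> ('r, 'm) module set \<Rightarrow> bool" where
  "closed_summands R X \<longleftrightarrow>
     (\<forall>M\<in>X. \<forall>A\<in>mod_cat R. \<forall>B\<in>mod_cat R :: ('r, 'm) module set.
       mod_iso R M (mod_sum A B) \<longrightarrow> A \<in> X)"

definition IKE_closed :: "('r, 'x) ring_scheme \<Rightarrow> ('r, 'm) module set \<Rightarrow> bool" where
  "IKE_closed R X \<longleftrightarrow>
     subcategory R X \<and> closed_images R X \<and> closed_kernels R X \<and> closed_extensions R X"

text \<open>
  The modules that can be built out of \<open>M\<close> by taking direct summands and extensions. The carrier
  type of \<open>M\<close> may differ from that of the ambient category, so containing \<open>M\<close> is expressed as
  containing all modules of the ambient category that are isomorphic to \<open>M\<close>.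
\<close>

definition built_from :: "('r, 'x) ring_scheme \<Rightarrow> ('r, 'n) module \<Rightarrow> ('r, 'm) module set" where
  "built_from R M = \<Inter>{X. subcategory R X \<and> {N \<in> mod_cat R. mod_iso R M N} \<subseteq> X \<and>
     closed_summands R X \<and> closed_extensions R X}"

end

theory Submission
  imports Defs
begin

text \<open>
  Let \<open>F\<^sub>n\<close> be the ideal of series of order at least \<open>n\<close>, let \<open>x = t\<^sup>e\<close> with \<open>e\<close> the multiplicity of \<open>H\<close>,
  and for \<open>n \<in> H\<close> put \<open>J = F\<^sub>n\<close> and \<open>I = {f \<in> F\<^sub>n\<^sub>+\<^sub>1. the coefficient of t\<^sup>n\<^sup>+\<^sup>e in f is 0}\<close>. Then
  \<open>(I : x) \<inter> J = F\<^sub>n\<^sub>+\<^sub>1 = I + xJ\<close>, so there are exact sequences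
  \<open>0 \<rightarrow> R/F\<^sub>n\<^sub>+\<^sub>1 \<rightarrow> R/J \<oplus> R/I \<rightarrow> R/F\<^sub>n\<^sub>+\<^sub>1 \<rightarrow> 0\<close> and \<open>0 \<rightarrow> F\<^sub>n\<^sub>+\<^sub>1 \<rightarrow> J \<oplus> I \<rightarrow> F\<^sub>n\<^sub>+\<^sub>1 \<rightarrow> 0\<close>.
  By the first, \<open>R/F\<^sub>n\<close> can be built out of \<open>R/F\<^sub>n\<^sub>+\<^sub>1\<close>; starting from the conductor \<open>F\<^sub>c\<close> one reaches
  \<open>F\<^sub>1\<close>, the maximal ideal, hence the residue field and all modules of finite length.

  Let \<open>X\<close> be IKE-closed. If some module of \<open>X\<close> has torsion, its socle is a kernel of a map inside \<open>X\<close>,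
  so the residue field and all modules of finite length lie in \<open>X\<close>. If some module of \<open>X\<close> is not
  torsion, a multiple of it is nonzero and torsionfree, and with a nonzero functional on it one finds
  in \<open>X\<close> an ideal \<open>J\<close> with \<open>t\<^sup>c \<in> J \<subseteq> F\<^sub>c\<close>. The sum of the ideals \<open>t\<^sup>c\<^sup>+\<^sup>iJ\<close>, \<open>i \<le> c\<close>, is \<open>F\<^sub>2\<^sub>c\<close>, so by the
  second sequence \<open>X\<close> contains \<open>F\<^sub>0 = R\<close>, and then every torsionfree module.
\<close>

section \<open>Modules, spans and homomorphisms\<close>

text \<open>Both sequences follow one pattern. For ideals \<open>I\<close>, \<open>J\<close> and an
  element \<open>x\<close>, the map \<open>r \<mapsto> (- r, x r)\<close> to
  \<open>R/J \<oplus> R/I\<close> has kernel \<open>(I : x) \<inter> J\<close>, and its image is the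
  kernel of the map \<open>(u, v) \<mapsto> v + x u\<close> onto \<open>R/(I + x J)\<close>. Once
  the two ideals agree, \<open>R/J\<close> is a direct summand of a self-extension. The coefficient
  dropped in \<open>I\<close> sits at \<open>n + e\<close> because multiplication by
  \<open>t^e\<close> moves coefficient \<open>n\<close> there, while the maximal ideal, whose
  elements have order at least \<open>e\<close>, cannot reach it from \<open>filt (Suc n)\<close>.
  At a gap \<open>n\<close> of \<open>H\<close> the filtration does not jump.

  This explains the endomorphisms whose images are copies of the residue field and of
  \<open>J\<close>, and the factors \<open>t^(c+i)\<close>, which lie in \<open>R\<close> and so
  keep the summands inside \<open>J\<close>.

  A category fixes one carrier type, whereas direct sums live on pairs and quotients on cosets;
  modules are therefore transported along injections.\<close>

lemma submoduleI':
  assumes "module R M" "N \<subseteq> carrier M" "\<zero>\<^bsub>M\<^esub> \<in> N"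
    and add: "\<And>x y. x \<in> N \<Longrightarrow> y \<in> N \<Longrightarrow> x \<oplus>\<^bsub>M\<^esub> y \<in> N"
    and smult: "\<And>r x. r \<in> carrier R \<Longrightarrow> x \<in> N \<Longrightarrow> r \<odot>\<^bsub>M\<^esub> x \<in> N"
  shows "submodule N R M"
proof -
  interpret module R M by fact
  have "\<ominus>\<^bsub>M\<^esub> x \<in> N" if "x \<in> N" for x
    using smult[of "\<ominus>\<^bsub>R\<^esub> \<one>\<^bsub>R\<^esub>" x] that assms(2) smult_l_minus[of "\<one>\<^bsub>R\<^esub>" x] by auto
  then show ?thesis
    by (intro submoduleI) (use assms in auto)
qed

lemma submoduleD:
  assumes "submodule N R M"
  shows "N \<subseteq> carrier M" "\<zero>\<^bsub>M\<^esub> \<in> N"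
    "\<And>x y. x \<in> N \<Longrightarrow> y \<in> N \<Longrightarrow> x \<oplus>\<^bsub>M\<^esub> y \<in> N"
    "\<And>r x. r \<in> carrier R \<Longrightarrow> x \<in> N \<Longrightarrow> r \<odot>\<^bsub>M\<^esub> x \<in> N"
proof -
  interpret submodule N R M by fact
  show "N \<subseteq> carrier M" "\<zero>\<^bsub>M\<^esub> \<in> N"
    "\<And>x y. x \<in> N \<Longrightarrow> y \<in> N \<Longrightarrow> x \<oplus>\<^bsub>M\<^esub> y \<in> N"
    "\<And>r x. r \<in> carrier R \<Longrightarrow> x \<in> N \<Longrightarrow> r \<odot>\<^bsub>M\<^esub> x \<in> N"
    using subset one_closed m_closed smult_closed by auto
qed

lemma submodule_iff:
  assumes "module R M"
  shows "submodule N R M \<longleftrightarrow> N \<subseteq> carrier M \<and> \<zero>\<^bsub>M\<^esub> \<in> N \<and>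
    (\<forall>x\<in>N. \<forall>y\<in>N. x \<oplus>\<^bsub>M\<^esub> y \<in> N) \<and> (\<forall>r\<in>carrier R. \<forall>x\<in>N. r \<odot>\<^bsub>M\<^esub> x \<in> N)"
  using submoduleI'[OF assms] submoduleD by (smt (verit))

lemma module_sub:
  assumes "module R M" "submodule K R M"
  shows "module R (M\<lparr>carrier := K\<rparr>)"
  using submodule.submodule_is_module[OF assms(2,1)] .

lemma submodule_sub_iff:
  assumes "module R M" "submodule K R M"
  shows "submodule N R (M\<lparr>carrier := K\<rparr>) \<longleftrightarrow> submodule N R M \<and> N \<subseteq> K"
  using submoduleD(1)[OF assms(2)]
  by (auto simp: submodule_iff[OF assms(1)] submodule_iff[OF module_sub[OF assms]])

lemma submodule_carrier: "module R M \<Longrightarrow> submodule (carrier M) R M"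
  by (rule module.carrier_is_submodule)

lemma submodule_zero: "module R M \<Longrightarrow> submodule {\<zero>\<^bsub>M\<^esub>} R M"
proof -
  assume "module R M"
  then interpret module R M .
  show ?thesis by (rule submoduleI') (auto simp: \<open>module R M\<close>)
qed

lemma submodule_Int:
  "module R M \<Longrightarrow> submodule K R M \<Longrightarrow> submodule L R M \<Longrightarrow> submodule (K \<inter> L) R M"
  by (auto simp: submodule_iff)

section \<open>Spans and finite generation\<close>

definition mod_span :: "('r, 'x) ring_scheme \<Rightarrow> ('r, 'm) module \<Rightarrow> 'm set \<Rightarrow> 'm set" where
  "mod_span R M A = \<Inter>{N. submodule N R M \<and> A \<subseteq> N}"

lemma submodule_span:
  assumes "module R M" "A \<subseteq> carrier M"
  shows "submodule (mod_span R M A) R M"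
proof -
  note c = submodule_carrier[OF assms(1)]
  show ?thesis
  proof (rule submoduleI'[OF assms(1)])
    show "mod_span R M A \<subseteq> carrier M" using c assms(2) by (auto simp: mod_span_def)
    show "\<zero>\<^bsub>M\<^esub> \<in> mod_span R M A" by (auto simp: mod_span_def dest: submoduleD(2))
  next
    fix x y assume "x \<in> mod_span R M A" "y \<in> mod_span R M A"
    then show "x \<oplus>\<^bsub>M\<^esub> y \<in> mod_span R M A" by (auto simp: mod_span_def intro: submoduleD(3)[of _ R])
  next
    fix r x assume "r \<in> carrier R" "x \<in> mod_span R M A"
    then show "r \<odot>\<^bsub>M\<^esub> x \<in> mod_span R M A" by (auto simp: mod_span_def intro: submoduleD(4)[of _ R])
  qed
qed

lemma span_superset: "A \<subseteq> mod_span R M A"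
  by (auto simp: mod_span_def)

lemma span_minimal: "submodule N R M \<Longrightarrow> A \<subseteq> N \<Longrightarrow> mod_span R M A \<subseteq> N"
  by (auto simp: mod_span_def)

lemma span_mono: "A \<subseteq> B \<Longrightarrow> mod_span R M A \<subseteq> mod_span R M B"
  by (auto simp: mod_span_def)

lemma span_closed: "module R M \<Longrightarrow> A \<subseteq> carrier M \<Longrightarrow> mod_span R M A \<subseteq> carrier M"
  by (intro span_minimal submodule_carrier)

lemma span_sub:
  assumes "module R M" "submodule K R M" "A \<subseteq> K"
  shows "mod_span R (M\<lparr>carrier := K\<rparr>) A = mod_span R M A"
proof -
  have "A \<subseteq> carrier M" using assms(3) submoduleD(1)[OF assms(2)] by auto
  have le: "mod_span R M A \<subseteq> mod_span R (M\<lparr>carrier := K\<rparr>) A"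
    by (auto simp: mod_span_def submodule_sub_iff[OF assms(1,2)])
  have "submodule (mod_span R M A) R (M\<lparr>carrier := K\<rparr>)"
    using submodule_span[OF assms(1) \<open>A \<subseteq> carrier M\<close>] span_minimal[OF assms(2,3)]
    by (simp add: submodule_sub_iff[OF assms(1,2)])
  from span_minimal[OF this span_superset] le show ?thesis by (rule equalityI)
qed

lemma span_empty: "module R M \<Longrightarrow> mod_span R M {} = {\<zero>\<^bsub>M\<^esub>}"
  using span_minimal[OF submodule_zero] submoduleD(2)[OF submodule_span[of R M "{}"]] by fastforce

lemma submodule_adjoin:
  assumes "module R M" "submodule K R M" "a \<in> carrier M"
  shows "submodule {x \<oplus>\<^bsub>M\<^esub> r \<odot>\<^bsub>M\<^esub> a | x r. x \<in> K \<and> r \<in> carrier R} R M"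
    (is "submodule ?S R M")
proof -
  interpret module R M by fact
  note K = submoduleD[OF assms(2)]
  show ?thesis
  proof (rule submoduleI'[OF assms(1)])
    show "?S \<subseteq> carrier M" using K(1) assms(3) by auto
    have "\<zero>\<^bsub>M\<^esub> = \<zero>\<^bsub>M\<^esub> \<oplus>\<^bsub>M\<^esub> \<zero>\<^bsub>R\<^esub> \<odot>\<^bsub>M\<^esub> a" using assms(3) by simp
    then show "\<zero>\<^bsub>M\<^esub> \<in> ?S" using K(2) by blast
    show "x \<oplus>\<^bsub>M\<^esub> y \<in> ?S" if xy: "x \<in> ?S" "y \<in> ?S" for x y
    proof -
      obtain u r v s where *: "x = u \<oplus>\<^bsub>M\<^esub> r \<odot>\<^bsub>M\<^esub> a" "u \<in> K" "r \<in> carrier R"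
        "y = v \<oplus>\<^bsub>M\<^esub> s \<odot>\<^bsub>M\<^esub> a" "v \<in> K" "s \<in> carrier R"
        using xy by blast
      then have "x \<oplus>\<^bsub>M\<^esub> y = (u \<oplus>\<^bsub>M\<^esub> v) \<oplus>\<^bsub>M\<^esub> (r \<oplus>\<^bsub>R\<^esub> s) \<odot>\<^bsub>M\<^esub> a"
        using K(1) assms(3) by (simp add: smult_l_distr M.a_ac subset_eq)
      then show ?thesis using * K(3) R.a_closed by blast
    qed
    show "t \<odot>\<^bsub>M\<^esub> x \<in> ?S" if tx: "t \<in> carrier R" "x \<in> ?S" for t x
    proof -
      obtain u r where *: "x = u \<oplus>\<^bsub>M\<^esub> r \<odot>\<^bsub>M\<^esub> a" "u \<in> K" "r \<in> carrier R"
        using tx(2) by blast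
      then have "t \<odot>\<^bsub>M\<^esub> x = t \<odot>\<^bsub>M\<^esub> u \<oplus>\<^bsub>M\<^esub> (t \<otimes>\<^bsub>R\<^esub> r) \<odot>\<^bsub>M\<^esub> a"
        using K(1) assms(3) tx(1) by (simp add: smult_r_distr smult_assoc1 subset_eq)
      then show ?thesis using * K(4) tx(1) R.m_closed by blast
    qed
  qed
qed

lemma adjoin_superset:
  assumes "module R M" "submodule K R M" "a \<in> carrier M"
  shows "insert a K \<subseteq> {x \<oplus>\<^bsub>M\<^esub> r \<odot>\<^bsub>M\<^esub> a | x r. x \<in> K \<and> r \<in> carrier R}" (is "_ \<subseteq> ?S")
proof -
  interpret module R M by fact
  have "x \<in> ?S" if x: "x \<in> K" for x
  proof -
    have "x = x \<oplus>\<^bsub>M\<^esub> \<zero>\<^bsub>R\<^esub> \<odot>\<^bsub>M\<^esub> a" using assms(3) x submoduleD(1)[OF assms(2)] by auto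
    then show ?thesis using x by blast
  qed
  moreover have "a \<in> ?S"
  proof -
    have "a = \<zero>\<^bsub>M\<^esub> \<oplus>\<^bsub>M\<^esub> \<one>\<^bsub>R\<^esub> \<odot>\<^bsub>M\<^esub> a" using assms(3) by auto
    then show ?thesis using submoduleD(2)[OF assms(2)] by blast
  qed
  ultimately show ?thesis by blast
qed

lemma span_insert:
  assumes "module R M" "A \<subseteq> carrier M" "a \<in> carrier M"
  shows "mod_span R M (insert a A) =
    {x \<oplus>\<^bsub>M\<^esub> r \<odot>\<^bsub>M\<^esub> a | x r. x \<in> mod_span R M A \<and> r \<in> carrier R}" (is "_ = ?S")
proof
  interpret module R M by fact
  note sp = submodule_span[OF assms(1,2)]
  from adjoin_superset[OF assms(1) sp assms(3)] show "mod_span R M (insert a A) \<subseteq> ?S"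
    using submodule_adjoin[OF assms(1) sp assms(3)] span_superset[of A R M]
    by (intro span_minimal) auto
  have "insert a A \<subseteq> carrier M" using assms by auto
  note si = submodule_span[OF assms(1) this]
  have "mod_span R M A \<subseteq> mod_span R M (insert a A)" by (rule span_mono) auto
  moreover have "a \<in> mod_span R M (insert a A)" using span_superset[of "insert a A" R M] by auto
  ultimately show "?S \<subseteq> mod_span R M (insert a A)"
    by (auto intro!: submoduleD(3,4)[OF si])
qed

lemma span_finite:
  assumes "module R M" "finite A" "A \<subseteq> carrier M"
  shows "mod_span R M A = {\<Oplus>\<^bsub>M\<^esub>a\<in>A. c a \<odot>\<^bsub>M\<^esub> a | c. c \<in> A \<rightarrow> carrier R}"
  using assms(2,3)
proof (induction A)
  case empty
  then show ?case by (simp add: span_empty[OF assms(1)] assms(1)[THEN module.axioms(2)]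
        abelian_group.axioms(1) abelian_monoid.finsum_empty)
next
  case (insert a A)
  interpret module R M by fact
  have a: "a \<in> carrier M" and A: "A \<subseteq> carrier M" using insert by auto
  have eq: "(\<Oplus>\<^bsub>M\<^esub>b\<in>insert a A. c b \<odot>\<^bsub>M\<^esub> b) = (\<Oplus>\<^bsub>M\<^esub>b\<in>A. c b \<odot>\<^bsub>M\<^esub> b) \<oplus>\<^bsub>M\<^esub> c a \<odot>\<^bsub>M\<^esub> a"
    if "c \<in> insert a A \<rightarrow> carrier R" for c
  proof -
    have "(\<lambda>b. c b \<odot>\<^bsub>M\<^esub> b) \<in> A \<rightarrow> carrier M" "c a \<odot>\<^bsub>M\<^esub> a \<in> carrier M"
      using that A a by auto
    then show ?thesis using insert(1,2) by (simp add: M.a_comm)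
  qed
  have cong: "(\<Oplus>\<^bsub>M\<^esub>b\<in>A. (c(a := r)) b \<odot>\<^bsub>M\<^esub> b) = (\<Oplus>\<^bsub>M\<^esub>b\<in>A. c b \<odot>\<^bsub>M\<^esub> b)"
    if "c \<in> A \<rightarrow> carrier R" for c r
    using that A insert(2) by (intro M.finsum_cong') auto
  show ?case
    unfolding span_insert[OF assms(1) A a] insert.IH[OF A]
  proof (intro equalityI subsetI; clarify)
    fix c r assume c: "c \<in> A \<rightarrow> carrier R" and r: "r \<in> carrier R"
    have c': "c(a := r) \<in> insert a A \<rightarrow> carrier R" using c r by auto
    have "(\<Oplus>\<^bsub>M\<^esub>b\<in>A. c b \<odot>\<^bsub>M\<^esub> b) \<oplus>\<^bsub>M\<^esub> r \<odot>\<^bsub>M\<^esub> a = (\<Oplus>\<^bsub>M\<^esub>b\<in>insert a A. (c(a := r)) b \<odot>\<^bsub>M\<^esub> b)"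
      unfolding eq[OF c'] cong[OF c] by simp
    then show "\<exists>c'. (\<Oplus>\<^bsub>M\<^esub>b\<in>A. c b \<odot>\<^bsub>M\<^esub> b) \<oplus>\<^bsub>M\<^esub> r \<odot>\<^bsub>M\<^esub> a = (\<Oplus>\<^bsub>M\<^esub>b\<in>insert a A. c' b \<odot>\<^bsub>M\<^esub> b) \<and>
        c' \<in> insert a A \<rightarrow> carrier R"
      using c' by blast
  next
    fix c assume c: "c \<in> insert a A \<rightarrow> carrier R"
    then have "c \<in> A \<rightarrow> carrier R" "c a \<in> carrier R" by auto
    with eq[OF c] show "\<exists>x r. (\<Oplus>\<^bsub>M\<^esub>b\<in>insert a A. c b \<odot>\<^bsub>M\<^esub> b) = x \<oplus>\<^bsub>M\<^esub> r \<odot>\<^bsub>M\<^esub> a \<and>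
        x \<in> {\<Oplus>\<^bsub>M\<^esub>a\<in>A. c a \<odot>\<^bsub>M\<^esub> a |c. c \<in> A \<rightarrow> carrier R} \<and> r \<in> carrier R"
      by blast
  qed
qed

text \<open>Replaces explicit linear combinations by a span defined as an intersection, so that
  finite generation can be handled by minimality arguments.\<close>

lemma fin_gen_iff_span:
  assumes "module R M"
  shows "fin_gen R M \<longleftrightarrow> (\<exists>A. finite A \<and> A \<subseteq> carrier M \<and> mod_span R M A = carrier M)"
proof -
  have "(\<forall>x\<in>carrier M. \<exists>c \<in> A \<rightarrow> carrier R. x = (\<Oplus>\<^bsub>M\<^esub>a\<in>A. c a \<odot>\<^bsub>M\<^esub> a)) \<longleftrightarrow>
      mod_span R M A = carrier M" if "finite A" "A \<subseteq> carrier M" for A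
  proof -
    have "x \<in> mod_span R M A \<longleftrightarrow> (\<exists>c \<in> A \<rightarrow> carrier R. x = (\<Oplus>\<^bsub>M\<^esub>a\<in>A. c a \<odot>\<^bsub>M\<^esub> a))" for x
      unfolding span_finite[OF assms that] mem_Collect_eq Bex_def by (simp only: conj_commute)
    then show ?thesis using span_closed[OF assms that(2)] by (simp only: subset_eq set_eq_iff) metis
  qed
  then show ?thesis unfolding fin_gen_def by (simp cong: conj_cong)
qed

section \<open>Homomorphisms, images and kernels\<close>

lemma mod_homD:
  assumes "f \<in> mod_hom R M N"
  shows "\<And>x. x \<in> carrier M \<Longrightarrow> f x \<in> carrier N"
    "\<And>x y. x \<in> carrier M \<Longrightarrow> y \<in> carrier M \<Longrightarrow> f (x \<oplus>\<^bsub>M\<^esub> y) = f x \<oplus>\<^bsub>N\<^esub> f y"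
    "\<And>r x. r \<in> carrier R \<Longrightarrow> x \<in> carrier M \<Longrightarrow> f (r \<odot>\<^bsub>M\<^esub> x) = r \<odot>\<^bsub>N\<^esub> f x"
  using assms by (auto simp: mod_hom_def)

lemma mod_homI:
  assumes "\<And>x. x \<in> carrier M \<Longrightarrow> f x \<in> carrier N"
    "\<And>x y. x \<in> carrier M \<Longrightarrow> y \<in> carrier M \<Longrightarrow> f (x \<oplus>\<^bsub>M\<^esub> y) = f x \<oplus>\<^bsub>N\<^esub> f y"
    "\<And>r x. r \<in> carrier R \<Longrightarrow> x \<in> carrier M \<Longrightarrow> f (r \<odot>\<^bsub>M\<^esub> x) = r \<odot>\<^bsub>N\<^esub> f x"
  shows "f \<in> mod_hom R M N"
  using assms by (auto simp: mod_hom_def)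

lemma mod_hom_zero:
  assumes "module R M" "module R N" "f \<in> mod_hom R M N"
  shows "f \<zero>\<^bsub>M\<^esub> = \<zero>\<^bsub>N\<^esub>"
proof -
  interpret M: module R M by fact
  interpret N: module R N by fact
  have "f \<zero>\<^bsub>M\<^esub> = f (\<zero>\<^bsub>R\<^esub> \<odot>\<^bsub>M\<^esub> \<zero>\<^bsub>M\<^esub>)" by simp
  also have "\<dots> = \<zero>\<^bsub>R\<^esub> \<odot>\<^bsub>N\<^esub> f \<zero>\<^bsub>M\<^esub>" by (intro mod_homD(3)[OF assms(3)]) auto
  also have "\<dots> = \<zero>\<^bsub>N\<^esub>" using mod_homD(1)[OF assms(3)] by simp
  finally show ?thesis .
qed

lemma mod_hom_comp:
  "f \<in> mod_hom R L M \<Longrightarrow> g \<in> mod_hom R M N \<Longrightarrow> g \<circ> f \<in> mod_hom R L N"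
  by (auto simp: mod_hom_def Pi_def)

lemma mod_hom_diff:
  assumes "module R M" "module R N" "f \<in> mod_hom R M N" "x \<in> carrier M" "y \<in> carrier M"
  shows "f (x \<ominus>\<^bsub>M\<^esub> y) = f x \<ominus>\<^bsub>N\<^esub> f y"
proof -
  interpret M: module R M by fact
  interpret N: module R N by fact
  note f = mod_homD[OF assms(3)]
  have "f (\<ominus>\<^bsub>M\<^esub> y) = f ((\<ominus>\<^bsub>R\<^esub> \<one>\<^bsub>R\<^esub>) \<odot>\<^bsub>M\<^esub> y)"
    using assms by (simp add: M.smult_l_minus)
  also have "\<dots> = \<ominus>\<^bsub>N\<^esub> f y"
    using assms f(1,3) by (simp add: N.smult_l_minus)
  finally show ?thesis using assms f by (simp add: a_minus_def)
qed

lemma mod_hom_inj_iff: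
  assumes "module R M" "module R N" "f \<in> mod_hom R M N"
  shows "inj_on f (carrier M) \<longleftrightarrow> (\<forall>x\<in>carrier M. f x = \<zero>\<^bsub>N\<^esub> \<longrightarrow> x = \<zero>\<^bsub>M\<^esub>)"
proof
  interpret M: module R M by fact
  interpret N: module R N by fact
  show "inj_on f (carrier M) \<Longrightarrow> \<forall>x\<in>carrier M. f x = \<zero>\<^bsub>N\<^esub> \<longrightarrow> x = \<zero>\<^bsub>M\<^esub>"
    using mod_hom_zero[OF assms] M.M.zero_closed by (metis inj_onD)
  assume *: "\<forall>x\<in>carrier M. f x = \<zero>\<^bsub>N\<^esub> \<longrightarrow> x = \<zero>\<^bsub>M\<^esub>"
  show "inj_on f (carrier M)"
  proof (rule inj_onI)
    fix x y assume xy: "x \<in> carrier M" "y \<in> carrier M" "f x = f y"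
    then have "f (x \<ominus>\<^bsub>M\<^esub> y) = \<zero>\<^bsub>N\<^esub>"
      using mod_homD(1)[OF assms(3)] xy
      by (subst mod_hom_diff[OF assms xy(1,2)]) (simp add: a_minus_def N.M.r_neg)
    then show "x = y" using * xy(1,2) M.M.minus_equality[of x "\<ominus>\<^bsub>M\<^esub> y"] by (simp add: a_minus_def)
  qed
qed

lemma submodule_image:
  assumes "module R M" "module R N" "f \<in> mod_hom R M N" "submodule K R M"
  shows "submodule (f ` K) R N"
proof -
  note f = mod_homD[OF assms(3)] and K = submoduleD[OF assms(4)]
  show ?thesis
  proof (rule submoduleI'[OF assms(2)])
    show "f ` K \<subseteq> carrier N" using f(1) K(1) by auto
    show "\<zero>\<^bsub>N\<^esub> \<in> f ` K" using mod_hom_zero[OF assms(1-3)] K(2) by (metis imageI)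
    show "x \<oplus>\<^bsub>N\<^esub> y \<in> f ` K" if "x \<in> f ` K" "y \<in> f ` K" for x y
      using that f(2) K(1,3) by (smt (verit) image_iff subsetD)
    show "r \<odot>\<^bsub>N\<^esub> x \<in> f ` K" if "r \<in> carrier R" "x \<in> f ` K" for r x
      using that f(3) K(1,4) by (smt (verit) image_iff subsetD)
  qed
qed

lemma submodule_vimage:
  assumes "module R M" "module R N" "f \<in> mod_hom R M N" "submodule K R N"
  shows "submodule {x \<in> carrier M. f x \<in> K} R M"
proof -
  interpret module R M by fact
  note f = mod_homD[OF assms(3)] and K = submoduleD[OF assms(4)]
  show ?thesis
    by (rule submoduleI'[OF assms(1)]) (use f K mod_hom_zero[OF assms(1-3)] in auto)
qed

lemma submodule_kernel:
  assumes "module R M" "module R N" "f \<in> mod_hom R M N"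
  shows "submodule {x \<in> carrier M. f x = \<zero>\<^bsub>N\<^esub>} R M"
  using submodule_vimage[OF assms submodule_zero[OF assms(2)]] by simp

lemma module_image:
  "module R M \<Longrightarrow> module R N \<Longrightarrow> f \<in> mod_hom R M N \<Longrightarrow> module R (mod_image M N f)"
  unfolding mod_image_def by (intro module_sub submodule_image[of R M] submodule_carrier)

lemma span_image:
  assumes "module R M" "module R N" "f \<in> mod_hom R M N" "A \<subseteq> carrier M"
  shows "mod_span R N (f ` A) = f ` mod_span R M A"
proof
  have fA: "f ` A \<subseteq> carrier N" using assms mod_homD(1) by fastforce
  show "mod_span R N (f ` A) \<subseteq> f ` mod_span R M A"
    using span_superset[of A R M]
    by (intro span_minimal submodule_image[OF assms(1-3)] submodule_span assms image_mono)
  have "mod_span R M A \<subseteq> {x \<in> carrier M. f x \<in> mod_span R N (f ` A)}"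
    using span_superset[of "f ` A" R N] assms(4)
    by (intro span_minimal submodule_vimage[OF assms(1-3)] submodule_span assms fA) auto
  then show "f ` mod_span R M A \<subseteq> mod_span R N (f ` A)" by auto
qed

lemma fin_gen_surj:
  assumes "module R M" "module R N" "f \<in> mod_hom R M N" "f ` carrier M = carrier N" "fin_gen R M"
  shows "fin_gen R N"
proof -
  obtain A where A: "finite A" "A \<subseteq> carrier M" "mod_span R M A = carrier M"
    using assms(5) fin_gen_iff_span[OF assms(1)] by auto
  then show ?thesis
    unfolding fin_gen_iff_span[OF assms(2)] using span_image[OF assms(1-3) A(2)] assms(4) mod_homD(1)[OF assms(3)]
    by (intro exI[of _ "f ` A"]) auto
qed

lemma mod_hom_to_image: "f \<in> mod_hom R M N \<Longrightarrow> f \<in> mod_hom R M (mod_image M N f)"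
  by (auto simp: mod_hom_def mod_image_def)

lemma fin_gen_image:
  assumes "module R M" "module R N" "f \<in> mod_hom R M N" "fin_gen R M"
  shows "fin_gen R (mod_image M N f)"
  by (rule fin_gen_surj[OF assms(1) module_image[OF assms(1-3)] mod_hom_to_image[OF assms(3)] _ assms(4)])
     (simp add: mod_image_def)

section \<open>Isomorphisms and transport of structure\<close>

lemma mod_iso_trans: "mod_iso R L M \<Longrightarrow> mod_iso R M N \<Longrightarrow> mod_iso R L N"
  unfolding mod_iso_def using mod_hom_comp bij_betw_trans by blast

lemma mod_hom_inverse:
  assumes "module R M" and f: "f \<in> mod_hom R M N" and b: "bij_betw f (carrier M) (carrier N)"
  shows "inv_into (carrier M) f \<in> mod_hom R N M"
proof -
  interpret module R M by fact
  let ?g = "inv_into (carrier M) f"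
  have g: "?g y \<in> carrier M" "f (?g y) = y" if "y \<in> carrier N" for y
    using b that by (auto simp: bij_betw_def inv_into_into f_inv_into_f)
  have gf: "?g (f x) = x" if "x \<in> carrier M" for x
    using b that by (auto simp: bij_betw_def)
  note f' = mod_homD[OF f]
  show ?thesis
  proof (rule mod_homI)
    fix x y assume "x \<in> carrier N" "y \<in> carrier N"
    then show "?g (x \<oplus>\<^bsub>N\<^esub> y) = ?g x \<oplus>\<^bsub>M\<^esub> ?g y"
      using f'(2)[of "?g x" "?g y"] g gf[of "?g x \<oplus>\<^bsub>M\<^esub> ?g y"] by simp
  next
    fix r x assume "r \<in> carrier R" "x \<in> carrier N"
    then show "?g (r \<odot>\<^bsub>N\<^esub> x) = r \<odot>\<^bsub>M\<^esub> ?g x"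
      using f'(3)[of r "?g x"] g gf[of "r \<odot>\<^bsub>M\<^esub> ?g x"] by simp
  qed (use g in auto)
qed

lemma mod_iso_sym: "module R M \<Longrightarrow> mod_iso R M N \<Longrightarrow> mod_iso R N M"
  unfolding mod_iso_def using mod_hom_inverse bij_betw_inv_into by blast

lemma module_of_bij:
  assumes "module R M" and b: "bij_betw f (carrier M) (carrier N)"
    and z: "f \<zero>\<^bsub>M\<^esub> = \<zero>\<^bsub>N\<^esub>"
    and add: "\<And>x y. x \<in> carrier M \<Longrightarrow> y \<in> carrier M \<Longrightarrow> f x \<oplus>\<^bsub>N\<^esub> f y = f (x \<oplus>\<^bsub>M\<^esub> y)"
    and sm: "\<And>r x. r \<in> carrier R \<Longrightarrow> x \<in> carrier M \<Longrightarrow> r \<odot>\<^bsub>N\<^esub> f x = f (r \<odot>\<^bsub>M\<^esub> x)"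
  shows "module R N"
proof -
  interpret module R M by fact
  have c: "carrier N = f ` carrier M" using b by (auto simp: bij_betw_def)
  note [simp] = add sm z[symmetric]
  show ?thesis
  proof (intro moduleI abelian_groupI)
    fix x assume "x \<in> carrier N"
    then obtain u where "u \<in> carrier M" "x = f u" unfolding c by auto
    then show "\<exists>y\<in>carrier N. y \<oplus>\<^bsub>N\<^esub> x = \<zero>\<^bsub>N\<^esub>"
      unfolding c by (intro bexI[of _ "f (\<ominus>\<^bsub>M\<^esub> u)"]) (auto simp: M.l_neg)
  qed (auto simp: c R.is_cring M.a_ac smult_l_distr smult_r_distr smult_assoc1)
qed

text \<open>Moves a module to another carrier type along an injection, so that modules on power
  series can be compared with objects on \<open>'m\<close>.\<close>

definition mod_transport :: "('a \<Rightarrow> 'b) \<Rightarrow> ('r, 'a) module \<Rightarrow> ('r, 'b) module" where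
  "mod_transport f M = (let g = inv_into (carrier M) f in
    \<lparr>carrier = f ` carrier M, mult = undefined, one = undefined, zero = f \<zero>\<^bsub>M\<^esub>,
     add = (\<lambda>x y. f (g x \<oplus>\<^bsub>M\<^esub> g y)), smult = (\<lambda>r x. f (r \<odot>\<^bsub>M\<^esub> g x))\<rparr>)"

lemma mod_transport:
  assumes "module R M" "inj_on f (carrier M)"
  shows "module R (mod_transport f M)" "f \<in> mod_hom R M (mod_transport f M)"
    "carrier (mod_transport f M) = f ` carrier M" "mod_iso R M (mod_transport f M)"
proof -
  have b: "bij_betw f (carrier M) (carrier (mod_transport f M))"
    using assms(2) by (simp add: mod_transport_def Let_def bij_betw_def)
  show "module R (mod_transport f M)"
    by (rule module_of_bij[OF assms(1) b]) (use assms(2) in \<open>auto simp: mod_transport_def Let_def\<close>)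
  show h: "f \<in> mod_hom R M (mod_transport f M)"
    using assms(2) by (intro mod_homI) (auto simp: mod_transport_def Let_def)
  show "carrier (mod_transport f M) = f ` carrier M"
    by (simp add: mod_transport_def Let_def)
  show "mod_iso R M (mod_transport f M)"
    using h b by (auto simp: mod_iso_def)
qed

text \<open>A choice of preimages embeds the quotient \<open>N\<close> into the carrier of
  \<open>M\<close>, so a quotient never forces a new carrier type. The last conclusion keeps track
  of the kernel.\<close>

lemma quotient_transport:
  fixes M :: "('r, 'm) module" and N :: "('r, 'n) module"
  assumes "module R M" "module R N" "f \<in> mod_hom R M N" "f ` carrier M = carrier N"
  obtains N' :: "('r, 'm) module" and g where "module R N'" "mod_iso R N N'" "g \<in> mod_hom R M N'"
    "g ` carrier M = carrier N'" "\<And>x. x \<in> carrier M \<Longrightarrow> g x = \<zero>\<^bsub>N'\<^esub> \<longleftrightarrow> f x = \<zero>\<^bsub>N\<^esub>"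
proof -
  interpret N: module R N by fact
  let ?s = "inv_into (carrier M) f"
  have inj: "inj_on ?s (carrier N)" using assms(4) by (metis inj_on_inv_into subset_refl)
  note t = mod_transport[OF assms(2) inj]
  show ?thesis
  proof
    show "?s \<circ> f \<in> mod_hom R M (mod_transport ?s N)"
      using mod_hom_comp assms(3) t(2) by blast
    show "(?s \<circ> f) ` carrier M = carrier (mod_transport ?s N)"
      unfolding t(3) assms(4)[symmetric] by (simp add: image_image)
    fix x assume "x \<in> carrier M"
    then have "f x \<in> carrier N" using assms(4) by blast
    then show "(?s \<circ> f) x = \<zero>\<^bsub>mod_transport ?s N\<^esub> \<longleftrightarrow> f x = \<zero>\<^bsub>N\<^esub>"
      using mod_hom_zero[OF assms(2) t(1,2)] inj_onD[OF inj] N.M.zero_closed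
      by (metis comp_apply)
  qed (rule t)+
qed

section \<open>Direct sums\<close>

lemma module_mod_sum:
  assumes "module R M" "module R N"
  shows "module R (mod_sum M N)"
proof -
  interpret M: module R M by fact
  interpret N: module R N by fact
  show ?thesis
  proof (intro moduleI abelian_groupI)
    fix x assume "x \<in> carrier (mod_sum M N)"
    then show "\<exists>y\<in>carrier (mod_sum M N). y \<oplus>\<^bsub>mod_sum M N\<^esub> x = \<zero>\<^bsub>mod_sum M N\<^esub>"
      by (intro bexI[of _ "(\<ominus>\<^bsub>M\<^esub> fst x, \<ominus>\<^bsub>N\<^esub> snd x)"])
         (auto simp: mod_sum_def M.M.l_neg N.M.l_neg)
  qed (auto simp: mod_sum_def M.R.is_cring M.M.a_ac N.M.a_ac M.smult_l_distr M.smult_r_distr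
      M.smult_assoc1 N.smult_l_distr N.smult_r_distr N.smult_assoc1)
qed

lemma fin_gen_mod_sum:
  fixes M :: "('r, 'm) module" and N :: "('r, 'n) module"
  assumes "module R M" "module R N" "fin_gen R M" "fin_gen R N"
  shows "fin_gen R (mod_sum M N)"
proof -
  interpret M: module R M by fact
  interpret N: module R N by fact
  note S = module_mod_sum[OF assms(1,2)]
  obtain A where A: "finite A" "A \<subseteq> carrier M" "mod_span R M A = carrier M"
    using assms(3) fin_gen_iff_span[OF assms(1)] by auto
  obtain B where B: "finite B" "B \<subseteq> carrier N" "mod_span R N B = carrier N"
    using assms(4) fin_gen_iff_span[OF assms(2)] by auto
  define i :: "'m \<Rightarrow> 'm \<times> 'n" where "i = (\<lambda>x. (x, \<zero>\<^bsub>N\<^esub>))"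
  define j :: "'n \<Rightarrow> 'm \<times> 'n" where "j = (\<lambda>y. (\<zero>\<^bsub>M\<^esub>, y))"
  have i: "i \<in> mod_hom R M (mod_sum M N)" and j: "j \<in> mod_hom R N (mod_sum M N)"
    by (auto simp: mod_hom_def mod_sum_def i_def j_def)
  let ?C = "i ` A \<union> j ` B"
  have C: "?C \<subseteq> carrier (mod_sum M N)"
    using A(2) B(2) mod_homD(1)[OF i] mod_homD(1)[OF j] by auto
  note sp = submodule_span[OF S C]
  have "(x, y) \<in> mod_span R (mod_sum M N) ?C" if "x \<in> carrier M" "y \<in> carrier N" for x y
  proof -
    have "i x \<in> mod_span R (mod_sum M N) (i ` A)"
      using span_image[OF assms(1) S i A(2)] A(3) that by auto
    moreover have "j y \<in> mod_span R (mod_sum M N) (j ` B)"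
      using span_image[OF assms(2) S j B(2)] B(3) that by auto
    ultimately have "i x \<oplus>\<^bsub>mod_sum M N\<^esub> j y \<in> mod_span R (mod_sum M N) ?C"
      using span_mono[of "i ` A" ?C R "mod_sum M N"] span_mono[of "j ` B" ?C R "mod_sum M N"]
      by (intro submoduleD(3)[OF sp]) auto
    then show ?thesis using that by (simp add: i_def j_def mod_sum_def)
  qed
  then have "mod_span R (mod_sum M N) ?C = carrier (mod_sum M N)"
    using span_closed[OF S C] by (auto simp: mod_sum_def)
  then show ?thesis unfolding fin_gen_iff_span[OF S] using A(1) B(1) C by (intro exI[of _ ?C]) simp
qed

lemma mod_sum_cong:
  assumes "mod_iso R M M'" "mod_iso R N N'"
  shows "mod_iso R (mod_sum M N) (mod_sum M' N')"
proof -
  obtain f g where f: "f \<in> mod_hom R M M'" "bij_betw f (carrier M) (carrier M')"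
    and g: "g \<in> mod_hom R N N'" "bij_betw g (carrier N) (carrier N')"
    using assms by (auto simp: mod_iso_def)
  have "map_prod f g \<in> mod_hom R (mod_sum M N) (mod_sum M' N')"
    using f(1) g(1) by (auto simp: mod_hom_def mod_sum_def)
  moreover have "bij_betw (map_prod f g) (carrier (mod_sum M N)) (carrier (mod_sum M' N'))"
    using bij_betw_map_prod[OF f(2) g(2)] by (simp add: mod_sum_def)
  ultimately show ?thesis by (auto simp: mod_iso_def)
qed

section \<open>Induced maps and isomorphic short exact sequences\<close>

lemma factor_through:
  assumes "module R P" "module R M" "module R N" "p \<in> mod_hom R P M" "p ` carrier P = carrier M"
    and h: "h \<in> mod_hom R P N" and ker: "\<And>x. x \<in> carrier P \<Longrightarrow> p x = \<zero>\<^bsub>M\<^esub> \<Longrightarrow> h x = \<zero>\<^bsub>N\<^esub>"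
  obtains k where "k \<in> mod_hom R M N" "\<And>x. x \<in> carrier P \<Longrightarrow> k (p x) = h x"
proof -
  interpret P: module R P by fact
  interpret M: module R M by fact
  interpret N: module R N by fact
  note pD = mod_homD[OF assms(4)] and hD = mod_homD[OF h]
  define k where "k = h \<circ> inv_into (carrier P) p"
  have k: "k (p x) = h x" if x: "x \<in> carrier P" for x
  proof -
    let ?y = "inv_into (carrier P) p (p x)"
    have y: "?y \<in> carrier P" "p ?y = p x"
      using x by (auto intro: inv_into_into f_inv_into_f)
    have "p (?y \<ominus>\<^bsub>P\<^esub> x) = \<zero>\<^bsub>M\<^esub>"
      by (subst mod_hom_diff[OF assms(1,2,4) y(1) x]) (use y pD(1)[OF x] in \<open>simp add: a_minus_def M.M.r_neg\<close>)
    then have "h ?y \<ominus>\<^bsub>N\<^esub> h x = \<zero>\<^bsub>N\<^esub>"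
      using ker[of "?y \<ominus>\<^bsub>P\<^esub> x"] y(1) x mod_hom_diff[OF assms(1,3) h y(1) x] by simp
    then have "h ?y = h x"
      using hD(1)[OF y(1)] hD(1)[OF x] N.M.minus_equality[of "h ?y" "\<ominus>\<^bsub>N\<^esub> h x"]
      by (simp add: a_minus_def)
    then show ?thesis by (simp add: k_def)
  qed
  have "k \<in> mod_hom R M N"
  proof (rule mod_homI)
    fix x assume "x \<in> carrier M"
    then obtain u where "u \<in> carrier P" "x = p u" using assms(5) by auto
    then show "k x \<in> carrier N" using k hD(1) by simp
  next
    fix x y assume "x \<in> carrier M" "y \<in> carrier M"
    then obtain u v where uv: "u \<in> carrier P" "x = p u" "v \<in> carrier P" "y = p v"
      using assms(5) by (metis imageE)
    then have "k (p (u \<oplus>\<^bsub>P\<^esub> v)) = k x \<oplus>\<^bsub>N\<^esub> k y" using k hD(2) by simp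
    then show "k (x \<oplus>\<^bsub>M\<^esub> y) = k x \<oplus>\<^bsub>N\<^esub> k y" using pD(2) uv by simp
  next
    fix r x assume r: "r \<in> carrier R" and "x \<in> carrier M"
    then obtain u where u: "u \<in> carrier P" "x = p u" using assms(5) by auto
    then have "k (p (r \<odot>\<^bsub>P\<^esub> u)) = r \<odot>\<^bsub>N\<^esub> k x" using k hD(3) r by simp
    then show "k (r \<odot>\<^bsub>M\<^esub> x) = r \<odot>\<^bsub>N\<^esub> k x" using pD(3) u r by simp
  qed
  then show ?thesis using that k by blast
qed

text \<open>The first isomorphism theorem in a form without cosets: both modules are presented as
  quotients of \<open>P\<close>, and it is enough to compare kernels.\<close>

lemma mod_iso_of_kernel:
  assumes "module R P" "module R M" "module R N" "p \<in> mod_hom R P M" "p ` carrier P = carrier M"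
    and h: "h \<in> mod_hom R P N" "h ` carrier P = carrier N"
    and ker: "\<And>x. x \<in> carrier P \<Longrightarrow> p x = \<zero>\<^bsub>M\<^esub> \<longleftrightarrow> h x = \<zero>\<^bsub>N\<^esub>"
  shows "mod_iso R M N"
proof -
  obtain k where k: "k \<in> mod_hom R M N" "\<And>x. x \<in> carrier P \<Longrightarrow> k (p x) = h x"
    using factor_through[OF assms(1-5) h(1)] ker by metis
  have "\<forall>x\<in>carrier M. k x = \<zero>\<^bsub>N\<^esub> \<longrightarrow> x = \<zero>\<^bsub>M\<^esub>"
    using assms(5)[symmetric] k(2) ker by auto
  then have "inj_on k (carrier M)" using mod_hom_inj_iff[OF assms(2,3) k(1)] by simp
  moreover have "k ` carrier M = carrier N"
    unfolding assms(5)[symmetric] h(2)[symmetric] image_image using k(2) by simp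
  ultimately show ?thesis using k(1) by (auto simp: mod_iso_def bij_betw_def)
qed

text \<open>Closure under extensions speaks of modules on one carrier type. Composing the maps with
  isomorphisms lets a sequence on other types serve as a witness.\<close>

lemma short_exact_iso:
  assumes L: "module R L'" "mod_iso R L' L" and N: "module R N'" "mod_iso R N' N"
    and E: "module R E'" "mod_iso R E' E" and M: "module R L" "module R N" "module R E"
    and ex: "short_exact R L f E g N"
  obtains f' g' where "short_exact R L' f' E' g' N'"
proof -
  obtain l where l: "l \<in> mod_hom R L' L" "bij_betw l (carrier L') (carrier L)"
    using L(2) by (auto simp: mod_iso_def)
  obtain n where n: "n \<in> mod_hom R N N'" "bij_betw n (carrier N) (carrier N')"
    using mod_iso_sym[OF N] by (auto simp: mod_iso_def)
  obtain u where u: "u \<in> mod_hom R E' E" "bij_betw u (carrier E') (carrier E)"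
    using E(2) by (auto simp: mod_iso_def)
  obtain v where v: "v \<in> mod_hom R E E'" "bij_betw v (carrier E) (carrier E')"
    "\<And>x. x \<in> carrier E \<Longrightarrow> u (v x) = x" "\<And>x. x \<in> carrier E' \<Longrightarrow> v (u x) = x"
  proof -
    have "inv_into (carrier E') u \<in> mod_hom R E E'" by (rule mod_hom_inverse[OF E(1) u])
    then show thesis
      by (rule that) (use u(2) in \<open>auto simp: bij_betw_inv_into bij_betw_inv_into_right bij_betw_inv_into_left\<close>)
  qed
  note exD = ex[unfolded short_exact_def]
  have f: "f \<in> mod_hom R L E" and g: "g \<in> mod_hom R E N" using exD by auto
  have f': "v \<circ> (f \<circ> l) \<in> mod_hom R L' E'" using mod_hom_comp l(1) f v(1) by metis
  have g': "n \<circ> (g \<circ> u) \<in> mod_hom R E' N'" using mod_hom_comp u(1) g n(1) by metis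
  have "short_exact R L' (v \<circ> (f \<circ> l)) E' (n \<circ> (g \<circ> u)) N'"
    unfolding short_exact_def
  proof (intro conjI f' g')
    have "inj_on l (carrier L')" "l ` carrier L' = carrier L" using l(2) by (auto simp: bij_betw_def)
    moreover have "inj_on f (carrier L)" "f ` carrier L \<subseteq> carrier E" using exD by auto
    moreover have "inj_on v (carrier E)" using v(2) by (auto simp: bij_betw_def)
    ultimately show "inj_on (v \<circ> (f \<circ> l)) (carrier L')"
      by (intro comp_inj_on) (auto simp: image_comp[symmetric] intro: inj_on_subset)
    have n0: "n y = \<zero>\<^bsub>N'\<^esub> \<longleftrightarrow> y = \<zero>\<^bsub>N\<^esub>" if "y \<in> carrier N" for y
      using mod_hom_inj_iff[OF M(2) N(1) n(1)] n(2) mod_hom_zero[OF M(2) N(1) n(1)] that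
      by (auto simp: bij_betw_def)
    have "(v \<circ> (f \<circ> l)) ` carrier L' = v ` (f ` (l ` carrier L'))" by (simp add: image_comp)
    also have "l ` carrier L' = carrier L" using l(2) by (auto simp: bij_betw_def)
    also have "f ` carrier L = {x \<in> carrier E. g x = \<zero>\<^bsub>N\<^esub>}" using exD by simp
    also have "v ` \<dots> = {x \<in> carrier E'. (n \<circ> (g \<circ> u)) x = \<zero>\<^bsub>N'\<^esub>}"
    proof (intro equalityI subsetI)
      fix y assume "y \<in> v ` {x \<in> carrier E. g x = \<zero>\<^bsub>N\<^esub>}"
      then obtain x where "x \<in> carrier E" "g x = \<zero>\<^bsub>N\<^esub>" "y = v x" by auto
      then show "y \<in> {x \<in> carrier E'. (n \<circ> (g \<circ> u)) x = \<zero>\<^bsub>N'\<^esub>}"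
        using v mod_homD(1)[OF v(1)] mod_hom_zero[OF M(2) N(1) n(1)] by simp
    next
      fix y assume y: "y \<in> {x \<in> carrier E'. (n \<circ> (g \<circ> u)) x = \<zero>\<^bsub>N'\<^esub>}"
      then have "u y \<in> carrier E" "g (u y) = \<zero>\<^bsub>N\<^esub>"
        using n0 mod_homD(1)[OF u(1)] mod_homD(1)[OF g] by auto
      then show "y \<in> v ` {x \<in> carrier E. g x = \<zero>\<^bsub>N\<^esub>}" using v(4) y
        by (intro image_eqI[of _ _ "u y"]) auto
    qed
    finally show "(v \<circ> (f \<circ> l)) ` carrier L' = {x \<in> carrier E'. (n \<circ> (g \<circ> u)) x = \<zero>\<^bsub>N'\<^esub>}" .
    have "(n \<circ> (g \<circ> u)) ` carrier E' = n ` (g ` (u ` carrier E'))" by (simp add: image_comp)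
    also have "\<dots> = carrier N'" using u(2) n(2) exD by (simp add: bij_betw_def)
    finally show "(n \<circ> (g \<circ> u)) ` carrier E' = carrier N'" .
  qed
  then show ?thesis by (rule that)
qed

text \<open>Codes a pair of series by the even and odd coefficients of one series. A direct sum of
  modules on power series thus fits into every type into which power series inject.\<close>

definition interleave :: "'k::zero fps \<times> 'k fps \<Rightarrow> 'k fps" where
  "interleave p = Abs_fps (\<lambda>n. if even n then fps_nth (fst p) (n div 2) else fps_nth (snd p) (n div 2))"

lemma inj_interleave: "inj interleave"
proof (rule injI)
  fix p q :: "'a fps \<times> 'a fps" assume eq: "interleave p = interleave q"
  have "fps_nth (fst p) n = fps_nth (fst q) n" "fps_nth (snd p) n = fps_nth (snd q) n" for n
    using arg_cong[OF eq, of "\<lambda>f. fps_nth f (2 * n)"] arg_cong[OF eq, of "\<lambda>f. fps_nth f (2 * n + 1)"]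
    by (simp_all add: interleave_def)
  then show "p = q" by (simp add: prod_eq_iff fps_eq_iff)
qed

lemma mod_iso_modules:
  "mod_iso R M N \<Longrightarrow> module R M \<Longrightarrow> module R N \<Longrightarrow> fin_gen R M \<Longrightarrow> fin_gen R N"
  using fin_gen_surj unfolding mod_iso_def bij_betw_def by blast

section \<open>Numerical semigroup rings\<close>

text \<open>Here \<open>c\<close> is an index from which on \<open>H\<close> has no gaps; that it is
  the least one is a separate hypothesis of \<open>conductor_eq\<close>. The number \<open>e\<close>
  is the multiplicity of \<open>H\<close>.\<close>

locale semigroup_ring =
  fixes H :: "nat set" and c e :: nat and R :: "'k::field fps ring"
  assumes R_eq: "R = sg_ring H"
    and zero_mem: "0 \<in> H"
    and add_mem: "\<And>m n. m \<in> H \<Longrightarrow> n \<in> H \<Longrightarrow> m + n \<in> H"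
    and conductor_mem: "\<And>n. c \<le> n \<Longrightarrow> n \<in> H"
    and mult_mem: "e \<in> H" and mult_pos: "0 < e"
    and mult_le: "\<And>h. h \<in> H \<Longrightarrow> 0 < h \<Longrightarrow> e \<le> h"
begin

section \<open>The ring operations of \<open>k[[H]]\<close>\<close>

lemma carrier_iff: "f \<in> carrier R \<longleftrightarrow> (\<forall>n. n \<notin> H \<longrightarrow> fps_nth f n = 0)"
  by (simp add: R_eq sg_ring_def)

lemma ring_ops [simp]: "f \<otimes>\<^bsub>R\<^esub> g = f * g" "f \<oplus>\<^bsub>R\<^esub> g = f + g" "\<one>\<^bsub>R\<^esub> = 1" "\<zero>\<^bsub>R\<^esub> = 0"
  by (simp_all add: R_eq sg_ring_def)

lemma const_closed [simp]: "fps_const a \<in> carrier R"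
  using zero_mem by (auto simp: carrier_iff)

lemma closed_0 [simp]: "0 \<in> carrier R" and closed_1 [simp]: "1 \<in> carrier R"
  using const_closed[of 0] const_closed[of 1] by auto

lemma closed_add [simp]: "f \<in> carrier R \<Longrightarrow> g \<in> carrier R \<Longrightarrow> f + g \<in> carrier R"
  and closed_diff [simp]: "f \<in> carrier R \<Longrightarrow> g \<in> carrier R \<Longrightarrow> f - g \<in> carrier R"
  and closed_minus [simp]: "f \<in> carrier R \<Longrightarrow> - f \<in> carrier R"
  by (auto simp: carrier_iff)

lemma closed_mult [simp]:
  assumes "f \<in> carrier R" "g \<in> carrier R"
  shows "f * g \<in> carrier R"
proof -
  have "fps_nth f i * fps_nth g (n - i) = 0" if "n \<notin> H" "i \<le> n" for n i
    using assms that add_mem[of i "n - i"] by (auto simp: carrier_iff)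
  then show ?thesis by (auto simp: carrier_iff fps_mult_nth intro!: sum.neutral)
qed

lemma X_power_closed [simp]: "n \<in> H \<Longrightarrow> fps_X ^ n \<in> carrier R"
  by (auto simp: carrier_iff fps_X_power_nth)

lemma cring_R: "cring R"
  by (intro cringI abelian_groupI comm_monoidI)
     (auto simp: algebra_simps intro: bexI[of _ "- _"])

text \<open>In the convolution at a gap \<open>n\<close>, every index \<open>i > 0\<close> is a gap
  itself or leaves a smaller gap \<open>n - i\<close>, so by induction only the term with
  \<open>i = 0\<close> can survive. Hence \<open>R\<close> is local with maximal ideal
  \<open>filt 1\<close>.\<close>

lemma inverse_closed:
  assumes f: "f \<in> carrier R" and f0: "fps_nth f 0 \<noteq> 0"
  shows "inverse f \<in> carrier R"
  unfolding carrier_iff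
proof (intro allI impI)
  fix n assume "n \<notin> H"
  then show "fps_nth (inverse f) n = 0"
  proof (induction n rule: less_induct)
    case (less n)
    then have "n > 0" using zero_mem by (cases n) auto
    have "fps_nth f i * fps_nth (inverse f) (n - i) = 0" if "i \<in> {1..n}" for i
    proof (cases "i \<in> H")
      case True
      then have "n - i \<notin> H" using add_mem[of i "n - i"] that less.prems by auto
      then show ?thesis using less.IH[of "n - i"] that by auto
    next
      case False
      then show ?thesis using f by (auto simp: carrier_iff)
    qed
    then have "(\<Sum>i=1..n. fps_nth f i * fps_nth (inverse f) (n - i)) = 0"
      by (intro sum.neutral) auto
    moreover have "fps_nth (f * inverse f) n = 0"
      using inverse_mult_eq_1'[OF f0] \<open>n > 0\<close> by simp
    ultimately have "fps_nth f 0 * fps_nth (inverse f) n = 0"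
      by (simp add: fps_mult_nth sum.atLeast_Suc_atMost)
    then show ?case using f0 by simp
  qed
qed

section \<open>The filtration by order\<close>

definition filt :: "nat \<Rightarrow> 'k fps set" where
  "filt n = {f \<in> carrier R. \<forall>i<n. fps_nth f i = 0}"

lemma filt_closed: "f \<in> filt n \<Longrightarrow> f \<in> carrier R"
  by (simp add: filt_def)

lemma filt_nth: "f \<in> filt n \<Longrightarrow> i < n \<Longrightarrow> fps_nth f i = 0"
  by (simp add: filt_def)

lemma filt_1I: "f \<in> carrier R \<Longrightarrow> fps_nth f 0 = 0 \<Longrightarrow> f \<in> filt 1"
  by (simp add: filt_def)

lemma zero_filt [simp]: "0 \<in> filt n"
  by (simp add: filt_def)

lemma filt_0: "filt 0 = carrier R"
  by (auto simp: filt_def)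

lemma filt_add: "f \<in> filt n \<Longrightarrow> g \<in> filt n \<Longrightarrow> f + g \<in> filt n"
  by (auto simp: filt_def)

lemma filt_mult:
  assumes "f \<in> filt m" "g \<in> filt n"
  shows "f * g \<in> filt (m + n)"
proof -
  have "fps_nth f i * fps_nth g (k - i) = 0" if "k < m + n" "i \<le> k" for k i
  proof (cases "i < m")
    case False
    then have "k - i < n" using that by auto
    then show ?thesis using assms by (simp add: filt_def)
  qed (use assms in \<open>simp add: filt_def\<close>)
  then show ?thesis using assms by (auto simp: filt_def fps_mult_nth intro!: sum.neutral)
qed

lemma filt_smult: "r \<in> carrier R \<Longrightarrow> f \<in> filt n \<Longrightarrow> r * f \<in> filt n"
  using filt_mult[of r 0 f n] by (simp add: filt_0)

lemma filt_mono: "m \<le> n \<Longrightarrow> filt n \<subseteq> filt m"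
  by (auto simp: filt_def)

lemma filt_Suc: "f \<in> filt (Suc n) \<longleftrightarrow> f \<in> filt n \<and> fps_nth f n = 0"
  by (auto simp: filt_def less_Suc_eq)

lemma X_power_filt: "n \<in> H \<Longrightarrow> m \<le> n \<Longrightarrow> fps_X ^ n \<in> filt m"
  by (auto simp: filt_def fps_X_power_nth)

lemma filt_1_X_power:
  assumes "r \<in> filt 1" "n \<in> H"
  shows "r * fps_X ^ n \<in> filt (Suc n)"
  using filt_mult[OF assms(1) X_power_filt[OF assms(2) order_refl]] by simp

lemma filt_gap: "n \<notin> H \<Longrightarrow> filt (Suc n) = filt n"
  by (auto simp: filt_Suc) (auto simp: filt_def carrier_iff)

text \<open>Successive steps at \<open>n \<in> H\<close> differ by the line through
  \<open>fps_X ^ n\<close>. Together with \<open>filt_gap\<close> this carries the inductions on the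
  order.\<close>

lemma filt_split:
  assumes "f \<in> filt n" "n \<in> H"
  obtains g where "g \<in> filt (Suc n)" "f = fps_const (fps_nth f n) * fps_X ^ n + g"
proof
  have *: "fps_const (fps_nth f n) * fps_X ^ n \<in> filt n"
    using assms by (intro filt_smult X_power_filt) auto
  show "f - fps_const (fps_nth f n) * fps_X ^ n \<in> filt (Suc n)"
    using assms(1) * by (auto simp: filt_Suc filt_def fps_X_power_nth)
qed simp

text \<open>No element of \<open>H\<close> lies strictly between \<open>0\<close> and
  \<open>e\<close>, so the maximal ideal starts in order \<open>e\<close>.\<close>

lemma filt_1: "filt 1 = filt e"
proof -
  have "fps_nth f i = 0" if "f \<in> filt 1" "i < e" for f i
    using that mult_le[of i] by (cases "i \<in> H"; cases "i = 0") (auto simp: filt_def carrier_iff)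
  then have "filt 1 \<subseteq> filt e" by (auto simp: filt_def)
  then show ?thesis using filt_mono[of 1 e] mult_pos by auto
qed

lemma filt_subdegree: "f \<in> carrier R \<Longrightarrow> n \<le> subdegree f \<Longrightarrow> f \<in> filt n"
  by (auto simp: filt_def intro: nth_less_subdegree_zero)

lemma subdegree_filt: "f \<in> filt n \<Longrightarrow> f \<noteq> 0 \<Longrightarrow> n \<le> subdegree f"
  by (auto simp: filt_def intro: subdegree_geI)

lemma filt_conductor: "(\<And>i. i < n \<Longrightarrow> fps_nth f i = 0) \<Longrightarrow> c \<le> n \<Longrightarrow> f \<in> filt n"
  unfolding filt_def carrier_iff mem_Collect_eq using conductor_mem
  by (meson le_trans linorder_not_le)

text \<open>Divisibility in \<open>k[[t]]\<close> is decided by orders. The quotient has order at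
  least \<open>n \<ge> c\<close>, and every series of such order belongs to
  \<open>R\<close>.\<close>

lemma filt_principal:
  assumes "f \<noteq> 0" "g \<in> filt (n + subdegree f)" "c \<le> n"
  obtains h where "h \<in> filt n" "g = f * h"
proof (cases "g = 0")
  case True
  then show ?thesis using that[of 0] by simp
next
  case False
  have "n + subdegree f \<le> subdegree g" using subdegree_filt assms(2) False by blast
  then have "f dvd g" using fps_dvd_iff[OF assms(1) False] by simp
  then obtain h where h: "g = f * h" by (rule dvdE)
  with False have "h \<noteq> 0" by auto
  then have "n \<le> subdegree h"
    using \<open>n + subdegree f \<le> subdegree g\<close> assms(1) by (simp add: h)
  then have "fps_nth h i = 0" if "i < n" for i
    using that nth_less_subdegree_zero[of i h] by linarith
  then have "h \<in> filt n" using assms(3) by (rule filt_conductor)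
  then show ?thesis using that[OF _ h] by simp
qed

section \<open>The ring is Noetherian\<close>

declare filt_closed [simp]

text \<open>One nonzero element \<open>f0\<close> generates all elements of sufficiently high order,
  and below that bound one element for each attained order is enough, as leading coefficients lie in
  a field. The conclusion is a universal property, so that \<open>J\<close> can be any set with the
  closure properties.\<close>

lemma ideal_finitely_generated:
  assumes I: "I \<subseteq> carrier R"
    and add: "\<And>f g. f \<in> I \<Longrightarrow> g \<in> I \<Longrightarrow> f + g \<in> I"
    and smult: "\<And>r f. r \<in> carrier R \<Longrightarrow> f \<in> I \<Longrightarrow> r * f \<in> I"
  obtains B where "finite B" "B \<subseteq> I"
    "\<And>J. B \<subseteq> J \<Longrightarrow> 0 \<in> J \<Longrightarrow> (\<And>f g. f \<in> J \<Longrightarrow> g \<in> J \<Longrightarrow> f + g \<in> J) \<Longrightarrow>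
      (\<And>r f. r \<in> carrier R \<Longrightarrow> f \<in> J \<Longrightarrow> r * f \<in> J) \<Longrightarrow> I \<subseteq> J"
proof (cases "I \<subseteq> {0}")
  case True
  then show ?thesis using that[of "{}"] by blast
next
  case False
  then obtain f0 where f0: "f0 \<in> I" "f0 \<noteq> 0" by auto
  \<comment> \<open>From this order on, every element of \<open>R\<close> is a multiple of
    \<open>f0\<close> with cofactor in \<open>filt c\<close>.\<close>
  define n where "n = c + subdegree f0"
  define P where "P j g \<longleftrightarrow> g \<in> I \<inter> filt j \<and> fps_nth g j \<noteq> 0" for j g
  define G where "G j = (SOME g. P j g)" for j
  have G: "P j (G j)" if "P j g" for j g
    unfolding G_def using that by (rule someI)
  define B where "B = insert f0 (G ` {j. j < n \<and> (\<exists>g. P j g)})"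
  show ?thesis
  proof (rule that[of B])
    show "finite B" by (simp add: B_def)
    show "B \<subseteq> I" using G f0 by (auto simp: B_def P_def)
  next
    fix J assume J: "B \<subseteq> J" "0 \<in> J" "\<And>f g. f \<in> J \<Longrightarrow> g \<in> J \<Longrightarrow> f + g \<in> J"
      "\<And>r f. r \<in> carrier R \<Longrightarrow> f \<in> J \<Longrightarrow> r * f \<in> J"
    have "I \<inter> filt j \<subseteq> J" if "j \<le> n" for j
      using that
    proof (induction rule: inc_induct)
      case base
      show ?case
      proof
        fix f assume "f \<in> I \<inter> filt n"
        then obtain h where "h \<in> filt c" "f = f0 * h"
          using filt_principal[OF f0(2), of f c] by (auto simp: n_def)
        moreover have "f0 \<in> J" using J(1) by (simp add: B_def)
        ultimately show "f \<in> J" using J(4)[of h f0] by (simp add: mult.commute)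
      qed
    next
      case (step j)
      show ?case
      proof
        fix f assume f: "f \<in> I \<inter> filt j"
        show "f \<in> J"
        proof (cases "fps_nth f j = 0")
          case True
          then show ?thesis using f step.IH by (auto simp: filt_Suc)
        next
          case False
          then have "P j f" using f by (simp add: P_def)
          then have g: "P j (G j)" "G j \<in> J" using G[of j f] step(2) J(1) by (auto simp: B_def)
          define a where "a = fps_nth f j / fps_nth (G j) j"
          have "f + fps_const (- a) * G j \<in> I \<inter> filt j"
            using f g(1) by (intro IntI add smult filt_add filt_smult) (auto simp: P_def)
          moreover have "fps_nth (f + fps_const (- a) * G j) j = 0"
            using g(1) by (simp add: P_def a_def)
          ultimately have "f + fps_const (- a) * G j \<in> J" using step.IH by (auto simp: filt_Suc)
          then have "(f + fps_const (- a) * G j) + fps_const a * G j \<in> J"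
            using g(2) J(3,4) by simp
          moreover have "(f + fps_const (- a) * G j) + fps_const a * G j = f"
            by (simp add: algebra_simps flip: fps_const_neg)
          ultimately show ?thesis by simp
        qed
      qed
    qed
    from this[of 0] show "I \<subseteq> J" using I by (auto simp: filt_0)
  qed
qed

section \<open>Arithmetic in modules, and submodules of finitely generated modules\<close>

lemma smult_add: "module R M \<Longrightarrow> r \<in> carrier R \<Longrightarrow> s \<in> carrier R \<Longrightarrow> x \<in> carrier M \<Longrightarrow>
    (r + s) \<odot>\<^bsub>M\<^esub> x = r \<odot>\<^bsub>M\<^esub> x \<oplus>\<^bsub>M\<^esub> s \<odot>\<^bsub>M\<^esub> x"
  using module.smult_l_distr[of R M r s x] by simp

lemma smult_mult: "module R M \<Longrightarrow> r \<in> carrier R \<Longrightarrow> s \<in> carrier R \<Longrightarrow> x \<in> carrier M \<Longrightarrow>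
    (r * s) \<odot>\<^bsub>M\<^esub> x = r \<odot>\<^bsub>M\<^esub> (s \<odot>\<^bsub>M\<^esub> x)"
  using module.smult_assoc1[of R M r s x] by simp

lemma smult_0: "module R M \<Longrightarrow> x \<in> carrier M \<Longrightarrow> 0 \<odot>\<^bsub>M\<^esub> x = \<zero>\<^bsub>M\<^esub>"
  using module.smult_l_null[of R M x] by simp

lemma smult_1: "module R M \<Longrightarrow> x \<in> carrier M \<Longrightarrow> 1 \<odot>\<^bsub>M\<^esub> x = x"
  using module.smult_one[of R M x] by simp

lemma smult_zero: "module R M \<Longrightarrow> r \<in> carrier R \<Longrightarrow> r \<odot>\<^bsub>M\<^esub> \<zero>\<^bsub>M\<^esub> = \<zero>\<^bsub>M\<^esub>"
  by (rule module.smult_r_null)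

lemma smult_hom:
  assumes "module R M" "r \<in> carrier R"
  shows "(\<lambda>x. r \<odot>\<^bsub>M\<^esub> x) \<in> mod_hom R M M"
proof -
  interpret module R M by fact
  show ?thesis
    using assms smult_mult[OF assms(1), symmetric]
    by (intro mod_homI) (auto simp: smult_r_distr mult.commute)
qed

lemma smult_commute:
  fixes M (structure)
  assumes "module R M" "r \<in> carrier R" "s \<in> carrier R" "x \<in> carrier M"
  shows "r \<odot> (s \<odot> x) = s \<odot> (r \<odot> x)"
  using smult_mult[OF assms] smult_mult[OF assms(1,3,2,4)] by (simp add: mult.commute)

text \<open>Modulo \<open>filt (Suc n)\<close> the ideal \<open>filt n\<close> is spanned by
  \<open>fps_X ^ n\<close>, so a single monomial decides.\<close>

lemma killed_by_filt:
  fixes M (structure)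
  assumes M: "module R M" and x: "x \<in> carrier M" and n: "n \<in> H" "fps_X ^ n \<odot> x = \<zero>"
    and kill: "\<And>s. s \<in> filt (Suc n) \<Longrightarrow> s \<odot> x = \<zero>" and s: "s \<in> filt n"
  shows "s \<odot> x = \<zero>"
proof -
  interpret module R M by (rule M)
  obtain g where g: "g \<in> filt (Suc n)" "s = fps_const (fps_nth s n) * fps_X ^ n + g"
    using filt_split[OF s n(1)] .
  have "(fps_const (fps_nth s n) * fps_X ^ n + g) \<odot> x = \<zero>"
    using g(1) x n kill[OF g(1)] by (simp add: smult_add[OF M] smult_mult[OF M] smult_zero[OF M])
  then show ?thesis using g(2) by simp
qed

lemma smult_neg_add:
  fixes M (structure)
  assumes "module R M" "x \<in> carrier M"
  shows "(-1) \<odot> x \<oplus> x = \<zero>"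
  using smult_add[OF assms(1) closed_minus[OF closed_1] closed_1 assms(2)] assms
  by (simp add: smult_1 smult_0)

lemma add_cancel_left:
  fixes M (structure)
  assumes "module R M" "submodule K R M" "x \<oplus> y \<in> K" "x \<in> K" "y \<in> carrier M"
  shows "y \<in> K"
proof -
  interpret module R M by fact
  note K = submoduleD[OF assms(2)]
  have x: "x \<in> carrier M" using assms(4) K(1) by auto
  have m1: "(-1) \<odot> x \<in> carrier M" using x by (intro smult_closed) auto
  have "y = (-1) \<odot> x \<oplus> (x \<oplus> y)"
    using x m1 assms(5) smult_neg_add[OF assms(1) x] by (simp add: M.a_assoc[symmetric])
  also have "\<dots> \<in> K" using assms(3,4) by (intro K(3)[OF K(4)]) auto
  finally show ?thesis .
qed

lemma smult_mult_add:
  fixes M (structure)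
  assumes "module R M" "r \<in> carrier R" "s \<in> carrier R" "x \<in> carrier M" "y \<in> carrier M"
  shows "(r * s) \<odot> (x \<oplus> y) = s \<odot> (r \<odot> x) \<oplus> r \<odot> (s \<odot> y)"
proof -
  interpret module R M by fact
  show ?thesis
    using assms smult_mult[OF assms(1,3,2,4)] smult_mult[OF assms(1,2,3,5)]
    by (simp add: smult_r_distr mult.commute)
qed

text \<open>A relation and not a coefficient function, since \<open>b\<close> is determined only up
  to ring elements that carry \<open>a\<close> into \<open>K\<close>.\<close>

definition congruent_multiple :: "('k fps, 'm) module \<Rightarrow> 'm set \<Rightarrow> 'm \<Rightarrow> 'k fps \<Rightarrow> 'm \<Rightarrow> bool" where
  "congruent_multiple M K a b y \<longleftrightarrow> b \<in> carrier R \<and> (\<exists>w\<in>K. y = w \<oplus>\<^bsub>M\<^esub> b \<odot>\<^bsub>M\<^esub> a)"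

lemma congruent_multiple:
  fixes M (structure)
  assumes M: "module R M" and K: "submodule K R M" and a: "a \<in> carrier M"
  shows "congruent_multiple M K a b x \<Longrightarrow> x \<in> carrier M"
    and "congruent_multiple M K a b x \<Longrightarrow> congruent_multiple M K a d y \<Longrightarrow>
      congruent_multiple M K a (b + d) (x \<oplus> y)"
    and "congruent_multiple M K a b x \<Longrightarrow> r \<in> carrier R \<Longrightarrow> congruent_multiple M K a (r * b) (r \<odot> x)"
    and "congruent_multiple M K a 0 x \<longleftrightarrow> x \<in> K"
    and "congruent_multiple M K a b x \<Longrightarrow> congruent_multiple M K a d x \<Longrightarrow> (b - d) \<odot> a \<in> K"
proof -
  interpret module R M by (rule M)
  note KD = submoduleD[OF K]
  show closed: "x \<in> carrier M" if "congruent_multiple M K a b x" for b x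
    using that KD(1) a by (auto simp: congruent_multiple_def)
  show add: "congruent_multiple M K a (b + d) (x \<oplus> y)"
    if xy: "congruent_multiple M K a b x" "congruent_multiple M K a d y" for b d x y
  proof -
    obtain w v where *: "w \<in> K" "x = w \<oplus> b \<odot> a" "v \<in> K" "y = v \<oplus> d \<odot> a"
      "b \<in> carrier R" "d \<in> carrier R" using xy by (auto simp: congruent_multiple_def)
    then have "x \<oplus> y = (w \<oplus> v) \<oplus> (b + d) \<odot> a"
      using KD(1) a by (simp add: smult_add[OF M] M.a_ac subset_eq)
    then show ?thesis using * KD(3) closed_add unfolding congruent_multiple_def by blast
  qed
  show smult: "congruent_multiple M K a (r * b) (r \<odot> x)"
    if x: "congruent_multiple M K a b x" and r: "r \<in> carrier R" for b r x
  proof -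
    obtain w where *: "w \<in> K" "x = w \<oplus> b \<odot> a" "b \<in> carrier R"
      using x by (auto simp: congruent_multiple_def)
    then have "r \<odot> x = r \<odot> w \<oplus> (r * b) \<odot> a"
      using KD(1) a r by (simp add: smult_mult[OF M] smult_r_distr subset_eq)
    then show ?thesis using * r KD(4) closed_mult unfolding congruent_multiple_def by blast
  qed
  show zero: "congruent_multiple M K a 0 x \<longleftrightarrow> x \<in> K" for x
    using KD(1) a by (auto simp: congruent_multiple_def smult_0[OF M] subset_eq)
  show "(b - d) \<odot> a \<in> K"
    if b: "congruent_multiple M K a b x" and d: "congruent_multiple M K a d x"
  proof -
    have bd: "b \<in> carrier R" "d \<in> carrier R" using b d by (auto simp: congruent_multiple_def)
    have "congruent_multiple M K a ((-1) * d + b) ((-1) \<odot> x \<oplus> x)"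
      by (rule add[OF smult[OF d] b]) simp
    then have "congruent_multiple M K a (b - d) \<zero>"
      using smult_neg_add[OF M closed[OF b]] by simp
    then obtain w where w: "w \<in> K" "w \<oplus> (b - d) \<odot> a \<in> K"
      using KD(2) by (auto simp: congruent_multiple_def)
    then show ?thesis using add_cancel_left[OF M K w(2,1)] a bd by simp
  qed
qed

text \<open>The classical argument with coefficient ideals: \<open>N\<close> is generated by its
  part in the span of \<open>A\<close>, which the induction covers, together with lifts of
  generators of the ideal of coefficients that occur at \<open>a\<close>.\<close>

lemma submodule_finitely_generated:
  fixes M (structure)
  assumes M: "module R M" and "finite A" "A \<subseteq> carrier M" "submodule N R M" "N \<subseteq> mod_span R M A"
  shows "\<exists>B. finite B \<and> B \<subseteq> N \<and> mod_span R M B = N"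
  using assms(2-)
proof (induction A arbitrary: N)
  case empty
  then have "N = {\<zero>}" using submoduleD(2)[OF empty(2)] by (auto simp: span_empty[OF M])
  then show ?case by (intro exI[of _ "{}"]) (simp add: span_empty[OF M])
next
  case (insert a A)
  interpret module R M by (rule M)
  have a: "a \<in> carrier M" and A: "A \<subseteq> carrier M" using insert.prems by auto
  note N = submoduleD[OF insert.prems(2)]
  note sA = submodule_span[OF M A]
  note S = submoduleD[OF sA]
  note cm = congruent_multiple[OF M sA a]
  define Q where "Q r x \<longleftrightarrow> x \<in> N \<and> congruent_multiple M (mod_span R M A) a r x" for r x
  \<comment> \<open>The ideal of coefficients of \<open>a\<close> that occur in \<open>N\<close>;
    its generators are lifted to elements of \<open>N\<close> below.\<close>
  define I where "I = {r \<in> carrier R. \<exists>x. Q r x}"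
  have Q_add: "Q (r + s) (x \<oplus> y)" if "Q r x" "Q s y" for r s x y
    using that cm(2) N(3) by (auto simp: Q_def)
  have Q_smult: "Q (t * r) (t \<odot> x)" if "Q r x" "t \<in> carrier R" for r t x
    using that cm(3) N(4) by (auto simp: Q_def)
  obtain G where G: "finite G" "G \<subseteq> I" and GJ: "\<And>J. G \<subseteq> J \<Longrightarrow> 0 \<in> J \<Longrightarrow>
      (\<And>f g. f \<in> J \<Longrightarrow> g \<in> J \<Longrightarrow> f + g \<in> J) \<Longrightarrow>
      (\<And>r f. r \<in> carrier R \<Longrightarrow> f \<in> J \<Longrightarrow> r * f \<in> J) \<Longrightarrow> I \<subseteq> J"
  proof (rule ideal_finitely_generated[of I])
    show "I \<subseteq> carrier R" by (auto simp: I_def)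
    show "f + g \<in> I" if "f \<in> I" "g \<in> I" for f g using that Q_add by (fastforce simp: I_def)
    show "r * f \<in> I" if "r \<in> carrier R" "f \<in> I" for r f using that Q_smult by (fastforce simp: I_def)
  qed blast
  define x where "x r = (SOME x. Q r x)" for r
  have x: "Q r (x r)" if "r \<in> I" for r
    using that someI_ex[of "Q r"] by (auto simp: I_def x_def)
  have "N \<inter> mod_span R M A \<subseteq> mod_span R M A" by auto
  from insert.IH[OF A submodule_Int[OF M insert.prems(2) sA] this]
  obtain B where B: "finite B" "B \<subseteq> N" "mod_span R M B = N \<inter> mod_span R M A" by auto
  let ?B = "B \<union> x ` G"
  have BN: "?B \<subseteq> N" using B(2) G(2) x by (auto simp: Q_def)
  then have BM: "?B \<subseteq> carrier M" using N(1) by auto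
  note sB = submodule_span[OF M BM]
  note T = submoduleD[OF sB]
  \<comment> \<open>The coefficients attained inside the span of the candidates. That they exhaust
    \<open>I\<close> follows from the universal property \<open>GJ\<close>, because \<open>J\<close>
    contains the generators \<open>G\<close>.\<close>
  define J where "J = {r \<in> carrier R. \<exists>y \<in> mod_span R M ?B. Q r y}"
  have le: "mod_span R M B \<subseteq> mod_span R M ?B" by (rule span_mono) auto
  have BsN: "mod_span R M ?B \<subseteq> N" by (rule span_minimal[OF insert.prems(2) BN])
  have "I \<subseteq> J"
  proof (rule GJ)
    show "G \<subseteq> J"
    proof
      fix r assume "r \<in> G"
      then have "r \<in> I" "x r \<in> mod_span R M ?B" using G(2) span_superset[of ?B R M] by auto
      then show "r \<in> J" using x[of r] by (auto simp: J_def I_def)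
    qed
    have "Q 0 \<zero>" unfolding Q_def cm(4) using N(2) S(2) by simp
    then show "0 \<in> J" using T(2) by (auto simp: J_def)
    show "f + g \<in> J" if "f \<in> J" "g \<in> J" for f g using that Q_add T(3) by (fastforce simp: J_def)
    show "r * f \<in> J" if "r \<in> carrier R" "f \<in> J" for r f
      using that Q_smult T(4) by (fastforce simp: J_def)
  qed
  have "N \<subseteq> mod_span R M ?B"
  proof
    fix y assume y: "y \<in> N"
    then obtain w r where "w \<in> mod_span R M A" "r \<in> carrier R" "y = w \<oplus> r \<odot> a"
      using insert.prems(3) span_insert[OF M A a] by blast
    then have r: "r \<in> carrier R" "congruent_multiple M (mod_span R M A) a r y"
      unfolding congruent_multiple_def by auto
    then have "r \<in> I" using y by (auto simp: I_def Q_def)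
    then obtain z where z: "z \<in> mod_span R M ?B" "congruent_multiple M (mod_span R M A) a r z"
      using \<open>I \<subseteq> J\<close> by (auto simp: J_def Q_def)
    define u where "u = (-1) \<odot> z"
    have zM: "z \<in> carrier M" using T(1) z(1) by auto
    have u: "u \<in> mod_span R M ?B" "u \<oplus> z = \<zero>" "u \<in> carrier M"
      using T(1,4) z(1) smult_neg_add[OF M zM] by (auto simp: u_def)
    \<comment> \<open>Subtracting an element of the span with the same coefficient of
      \<open>a\<close> leaves an element of \<open>N\<close> in the span of \<open>A\<close>, which
      is the case covered by \<open>B\<close>.\<close>
    have "congruent_multiple M (mod_span R M A) a (r + (-1) * r) (y \<oplus> u)"
      unfolding u_def by (rule cm(2)[OF r(2) cm(3)[OF z(2)]]) simp
    then have "y \<oplus> u \<in> mod_span R M A" using cm(4) by simp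
    moreover have "y \<oplus> u \<in> N" using N(3) y u(1) BsN by auto
    ultimately have "(y \<oplus> u) \<oplus> z \<in> mod_span R M ?B" using B(3) le z(1) by (intro T(3)[of _ z]) auto
    then show "y \<in> mod_span R M ?B"
      using u N(1) y zM by (simp add: M.a_assoc subset_eq)
  qed
  then show ?case
    using B(1) G(1) BN BsN by (intro exI[of _ ?B]) auto
qed

lemma fin_gen_sub:
  assumes "module R M" "fin_gen R M" "submodule N R M"
  shows "fin_gen R (M\<lparr>carrier := N\<rparr>)"
proof -
  obtain A where A: "finite A" "A \<subseteq> carrier M" "mod_span R M A = carrier M"
    using assms(2) fin_gen_iff_span[OF assms(1)] by auto
  have "N \<subseteq> mod_span R M A" using A(3) submoduleD(1)[OF assms(3)] by simp
  then obtain B where "finite B" "B \<subseteq> N" "mod_span R M B = N"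
    using submodule_finitely_generated[OF assms(1) A(1,2) assms(3)] by auto
  then show ?thesis
    unfolding fin_gen_iff_span[OF module_sub[OF assms(1,3)]]
    by (intro exI[of _ B]) (simp add: span_sub[OF assms(1,3)])
qed

subsection \<open>Finite length\<close>

text \<open>A composition series of \<open>K\<close> with all terms regarded inside
  \<open>M\<close>. Keeping the top as a parameter allows a series to be prolonged by one factor at
  a time.\<close>

definition composition_top :: "('k fps, 'm) module \<Rightarrow> 'm set \<Rightarrow> bool" where
  "composition_top M K \<longleftrightarrow> (\<exists>(n::nat) C. C 0 = {\<zero>\<^bsub>M\<^esub>} \<and> C n = K \<and>
     (\<forall>i\<le>n. submodule (C i) R M) \<and>
     (\<forall>i<n. C i \<subset> C (Suc i) \<and> (\<nexists>N. submodule N R M \<and> C i \<subset> N \<and> N \<subset> C (Suc i))))"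

lemma finite_length_iff: "finite_length R M \<longleftrightarrow> composition_top M (carrier M)"
  by (simp add: finite_length_def composition_top_def)

lemma composition_top_zero: "module R M \<Longrightarrow> composition_top M {\<zero>\<^bsub>M\<^esub>}"
  unfolding composition_top_def
  by (intro exI[of _ 0] exI[of _ "\<lambda>_. {\<zero>\<^bsub>M\<^esub>}"]) (simp add: submodule_zero)

lemma composition_top_step:
  assumes "composition_top M K" "K \<subset> K'" "submodule K' R M"
    "\<nexists>N. submodule N R M \<and> K \<subset> N \<and> N \<subset> K'"
  shows "composition_top M K'"
proof -
  obtain n C where C: "C (0::nat) = {\<zero>\<^bsub>M\<^esub>}" "C n = K" "\<forall>i\<le>n. submodule (C i) R M"
    "\<forall>i<n. C i \<subset> C (Suc i) \<and> (\<nexists>N. submodule N R M \<and> C i \<subset> N \<and> N \<subset> C (Suc i))"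
    using assms(1) unfolding composition_top_def by blast
  show ?thesis
    unfolding composition_top_def
    by (intro exI[of _ "Suc n"] exI[of _ "C(Suc n := K')"])
       (use C assms in \<open>auto simp: less_Suc_eq le_Suc_eq\<close>)
qed

lemma composition_top_submodule: "composition_top M K \<Longrightarrow> submodule K R M"
  by (auto simp: composition_top_def)

text \<open>The new factor is cyclic and killed by the maximal ideal, so it is zero or simple: an
  element outside \<open>K\<close> has a coefficient of \<open>b\<close> with nonzero constant term,
  and this coefficient is invertible in \<open>R\<close>.\<close>

lemma composition_top_adjoin_simple:
  fixes M (structure)
  assumes M: "module R M" and K: "composition_top M K" and b: "b \<in> carrier M"
    and ann: "\<And>r. r \<in> filt 1 \<Longrightarrow> r \<odot> b \<in> K"
  shows "composition_top M {x \<oplus> r \<odot> b | x r. x \<in> K \<and> r \<in> carrier R}"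
    (is "composition_top M ?L")
proof -
  interpret module R M by (rule M)
  note sK = composition_top_submodule[OF K]
  note KD = submoduleD[OF sK]
  note sL = submodule_adjoin[OF M sK b]
  have KL: "K \<subseteq> ?L" and bL: "b \<in> ?L" using adjoin_superset[OF M sK b] by auto
  show ?thesis
  proof (cases "b \<in> K")
    case True
    then have "?L \<subseteq> K" using KD(3,4) by blast
    with KL have "?L = K" by (intro equalityI)
    then show ?thesis using K by (simp only:)
  next
    case False
    have "?L \<subseteq> N" if N: "submodule N R M" "K \<subseteq> N" "y \<in> N" "y \<notin> K" "y \<in> ?L" for N y
    proof -
      note ND = submoduleD[OF N(1)]
      obtain x r where y: "y = x \<oplus> r \<odot> b" "x \<in> K" "r \<in> carrier R" using N(5) by blast
      have "fps_nth r 0 \<noteq> 0"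
      proof
        assume "fps_nth r 0 = 0"
        then have "r \<in> filt 1" using y(3) by (intro filt_1I)
        then show False using y N(4) KD(3) ann by blast
      qed
      then have inv: "inverse r \<in> carrier R" "inverse r * r = 1"
        using y(3) inverse_closed inverse_mult_eq_1 by auto
      have "r \<odot> b \<in> N"
        using add_cancel_left[OF M N(1), of x "r \<odot> b"] y N(2,3) b by auto
      then have "inverse r \<odot> (r \<odot> b) \<in> N" using inv ND(4) by blast
      then have "b \<in> N"
        using b inv y(3) smult_mult[OF M inv(1) y(3) b] smult_1[OF M b] by simp
      then show "?L \<subseteq> N" using N(2) ND(3,4) by blast
    qed
    then have "\<nexists>N. submodule N R M \<and> K \<subset> N \<and> N \<subset> ?L" by blast
    moreover have "K \<subset> ?L" using KL bL False by blast
    ultimately show ?thesis using composition_top_step[OF K _ sL] by blast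
  qed
qed

text \<open>In the induction step the multiple \<open>fps_X ^ n \<odot> b\<close> is adjoined first.
  The maximal ideal sends it into \<open>K\<close>, so this costs at most one simple factor, and
  over the larger submodule all of \<open>filt n\<close> annihilates \<open>b\<close>.\<close>

lemma composition_top_adjoin:
  fixes M (structure)
  assumes M: "module R M" and "composition_top M K" and b: "b \<in> carrier M"
    and "\<And>r. r \<in> filt n \<Longrightarrow> r \<odot> b \<in> K"
  shows "composition_top M {x \<oplus> r \<odot> b | x r. x \<in> K \<and> r \<in> carrier R}"
  using assms(2,4)
proof (induction n arbitrary: K)
  case 0
  show ?case
    by (rule composition_top_adjoin_simple[OF M 0(1) b]) (use 0(2) in \<open>auto simp: filt_0\<close>)
next
  case (Suc n)
  interpret module R M by (rule M)
  show ?case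
  proof (cases "n \<in> H")
    case False
    then show ?thesis using Suc by (simp add: filt_gap)
  next
    case True
    define y where "y = fps_X ^ n \<odot> b"
    have y: "y \<in> carrier M" using True b by (simp add: y_def)
    let ?L = "{x \<oplus> r \<odot> y | x r. x \<in> K \<and> r \<in> carrier R}"
    note sK = composition_top_submodule[OF Suc.prems(1)]
    note KD = submoduleD[OF sK]
    have L: "composition_top M ?L"
    proof (rule composition_top_adjoin_simple[OF M Suc.prems(1) y])
      fix r assume r: "r \<in> filt 1"
      have "(r * fps_X ^ n) \<odot> b \<in> K" by (rule Suc.prems(2)[OF filt_1_X_power[OF r True]])
      then show "r \<odot> y \<in> K"
        using smult_mult[OF M filt_closed[OF r] X_power_closed[OF True] b] by (simp add: y_def)
    qed
    note LD = submoduleD[OF composition_top_submodule[OF L]]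
    have KL: "K \<subseteq> ?L" and yL: "y \<in> ?L" using adjoin_superset[OF M sK y] by auto
    have rL: "r \<odot> b \<in> ?L" if r: "r \<in> filt n" for r
    proof -
      obtain g where g: "g \<in> filt (Suc n)" "r = fps_const (fps_nth r n) * fps_X ^ n + g"
        using filt_split[OF r True] .
      have "(fps_const (fps_nth r n) * fps_X ^ n + g) \<odot> b =
          fps_const (fps_nth r n) \<odot> y \<oplus> g \<odot> b"
        using g(1) b True by (simp add: smult_add[OF M] smult_mult[OF M] y_def)
      moreover have "g \<odot> b \<in> ?L" using Suc.prems(2)[OF g(1)] KL by blast
      then have "fps_const (fps_nth r n) \<odot> y \<oplus> g \<odot> b \<in> ?L"
        by (rule LD(3)[OF LD(4)[OF const_closed yL]])
      ultimately show ?thesis by (simp only: g(2)[symmetric])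
    qed
    \<comment> \<open>Since \<open>y\<close> is a multiple of \<open>b\<close>, passing through the
      intermediate submodule does not change the result.\<close>
    have "{x \<oplus> r \<odot> b | x r. x \<in> ?L \<and> r \<in> carrier R} =
        {x \<oplus> r \<odot> b | x r. x \<in> K \<and> r \<in> carrier R}" (is "?P = ?Q")
    proof
      show "?Q \<subseteq> ?P" using KL by blast
      have "x \<oplus> r \<odot> b \<in> ?Q" if x: "x \<in> ?L" and r: "r \<in> carrier R" for x r
      proof -
        obtain z s where z: "x = z \<oplus> s \<odot> y" "z \<in> K" "s \<in> carrier R" using x by blast
        have "x \<oplus> r \<odot> b = z \<oplus> (s * fps_X ^ n + r) \<odot> b"
          using z r b True KD(1)
          by (simp add: smult_add[OF M] smult_mult[OF M] y_def M.a_assoc subset_eq)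
        moreover have "s * fps_X ^ n + r \<in> carrier R" using z r True by simp
        ultimately show ?thesis using z(2) by blast
      qed
      then show "?P \<subseteq> ?Q" by blast
    qed
    then show ?thesis using Suc.IH[OF L rL] by simp
  qed
qed

section \<open>Finite length and torsion\<close>

definition torsion :: "('k fps, 'm) module \<Rightarrow> bool" where
  "torsion M \<longleftrightarrow> (\<forall>x\<in>carrier M. \<exists>r\<in>carrier R. r \<noteq> 0 \<and> r \<odot>\<^bsub>M\<^esub> x = \<zero>\<^bsub>M\<^esub>)"

text \<open>All elements of order at least \<open>c + subdegree r\<close> are multiples of
  \<open>r\<close> in \<open>R\<close>, so a single nonzero annihilator yields a whole step of the
  filtration.\<close>

lemma filt_annihilates:
  fixes M (structure)
  assumes M: "module R M" and x: "x \<in> carrier M" and r: "r \<in> carrier R" "r \<noteq> 0" "r \<odot> x = \<zero>"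
    and s: "s \<in> filt (c + subdegree r)"
  shows "s \<odot> x = \<zero>"
proof -
  obtain h where h: "h \<in> filt c" "s = r * h" using filt_principal[OF r(2) s order_refl] .
  then have "s \<odot> x = h \<odot> (r \<odot> x)"
    using smult_mult[OF M, of h r x] r(1) x by (simp add: mult.commute)
  then show ?thesis using r(3) h(1) smult_zero[OF M] by simp
qed

lemma finite_length_of_torsion:
  fixes M (structure)
  assumes M: "module R M" and "fin_gen R M" "torsion M"
  shows "finite_length R M"
proof -
  obtain A where A: "finite A" "A \<subseteq> carrier M" "mod_span R M A = carrier M"
    using assms(2) fin_gen_iff_span[OF M] by auto
  from A(1,2) have "composition_top M (mod_span R M A)"
  proof (induction A)
    case empty
    then show ?case using composition_top_zero[OF M] by (simp add: span_empty[OF M])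
  next
    case (insert a A)
    have a: "a \<in> carrier M" and A: "A \<subseteq> carrier M" using insert by auto
    obtain r where "r \<in> carrier R" "r \<noteq> 0" "r \<odot> a = \<zero>"
      using assms(3) a by (auto simp: torsion_def)
    then have "s \<odot> a \<in> mod_span R M A" if "s \<in> filt (c + subdegree r)" for s
      using filt_annihilates[OF M a] that submoduleD(2)[OF submodule_span[OF M A]] by simp
    from composition_top_adjoin[OF M insert.IH[OF A] a this]
    show ?case by (simp add: span_insert[OF M A a])
  qed
  then show ?thesis using A(3) by (simp add: finite_length_iff)
qed

text \<open>The second claim is Nakayama for a simple factor: if \<open>r \<odot> z\<close> were
  outside \<open>K\<close>, it would generate \<open>L\<close> over \<open>K\<close>, and
  \<open>z\<close> would agree with \<open>s r z\<close> modulo \<open>K\<close>, although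
  \<open>1 - s r\<close> is invertible.\<close>

lemma simple_step:
  fixes M (structure)
  assumes M: "module R M" and K: "submodule K R M" and L: "submodule L R M" and "K \<subset> L"
    and simple: "\<nexists>N. submodule N R M \<and> K \<subset> N \<and> N \<subset> L" and z: "z \<in> L" "z \<notin> K"
  shows "L = {x \<oplus> r \<odot> z | x r. x \<in> K \<and> r \<in> carrier R}"
    and "r \<in> filt 1 \<Longrightarrow> r \<odot> z \<in> K"
proof -
  interpret module R M by (rule M)
  note KD = submoduleD[OF K] and LD = submoduleD[OF L]
  have zM: "z \<in> carrier M" using z LD(1) by auto
  let ?N = "\<lambda>y. {x \<oplus> r \<odot> y | x r. x \<in> K \<and> r \<in> carrier R}"
  have dich: "y \<in> K \<or> ?N y = L" if y: "y \<in> L" for y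
  proof -
    have yM: "y \<in> carrier M" using y LD(1) by auto
    have NL: "?N y \<subseteq> L" using y LD \<open>K \<subset> L\<close> by blast
    have "submodule N R M \<Longrightarrow> N \<subseteq> L \<Longrightarrow> insert y K \<subseteq> N \<Longrightarrow> y \<in> K \<or> N = L" for N
      using simple by blast
    from this[OF submodule_adjoin[OF M K yM] NL adjoin_superset[OF M K yM]] show ?thesis .
  qed
  show "L = ?N z" using dich[OF z(1)] z(2) by blast
  show "r \<odot> z \<in> K" if r: "r \<in> filt 1"
  proof (rule ccontr)
    assume nK: "r \<odot> z \<notin> K"
    have rL: "r \<odot> z \<in> L" using r z LD(4) by auto
    have "z \<in> ?N (r \<odot> z)" using dich[OF rL] nK z(1) by blast
    then obtain x s where xs: "z = x \<oplus> s \<odot> (r \<odot> z)" "x \<in> K" "s \<in> carrier R" by blast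
    have xM: "x \<in> carrier M" using xs(2) KD(1) by auto
    let ?u = "1 - s * r"
    have u: "?u \<in> carrier R" "fps_nth ?u 0 \<noteq> 0" using xs(3) r filt_nth[OF r, of 0] by auto
    have "(?u + s * r) \<odot> z = ?u \<odot> z \<oplus> (s * r) \<odot> z"
      using u(1) xs(3) r zM by (intro smult_add[OF M]) auto
    then have "z = ?u \<odot> z \<oplus> s \<odot> (r \<odot> z)"
      using smult_1[OF M zM] smult_mult[OF M xs(3) _ zM, of r] r by simp
    then have "?u \<odot> z = x"
      using xs M.add.right_cancel[of "s \<odot> (r \<odot> z)" "?u \<odot> z" x] u(1) zM r xM by simp
    then have "inverse ?u \<odot> (?u \<odot> z) \<in> K" using inverse_closed[OF u] KD(4) xs(2) by simp
    moreover have "inverse ?u \<odot> (?u \<odot> z) = z"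
      using smult_mult[OF M inverse_closed[OF u] u(1) zM] inverse_mult_eq_1[OF u(2)] smult_1[OF M zM]
      by simp
    ultimately show False using z(2) by simp
  qed
qed

text \<open>Each simple factor contributes one generator and is killed by \<open>fps_X ^ e\<close>.
  Hence the \<open>i\<close>-th term of the series has finitely many generators and is annihilated
  by the \<open>i\<close>-th power of this element.\<close>

lemma finite_lengthD:
  fixes M (structure)
  assumes M: "module R M" and "finite_length R M"
  shows "fin_gen R M" "torsion M"
proof -
  obtain n C where C12: "C (0::nat) = {\<zero>}" "C n = carrier M" "\<forall>i\<le>n. submodule (C i) R M"
    "\<forall>i<n. C i \<subset> C (Suc i) \<and> (\<nexists>N. submodule N R M \<and> C i \<subset> N \<and> N \<subset> C (Suc i))"
    using assms(2) unfolding finite_length_def by (elim exE conjE) (rule that)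
  note C = C12(1,2) C12(3)[rule_format] C12(4)[rule_format, THEN conjunct1]
    C12(4)[rule_format, THEN conjunct2]
  have "(\<exists>A. finite A \<and> A \<subseteq> C i \<and> mod_span R M A = C i) \<and>
      (\<forall>x\<in>C i. (fps_X ^ e) ^ i \<odot> x = \<zero>)" if "i \<le> n" for i
    using that
  proof (induction i)
    case 0
    have "\<zero> \<in> carrier M" using submoduleD(1)[OF submodule_zero[OF M]] by simp
    then show ?case unfolding C(1)
      by (intro conjI exI[of _ "{}"]) (simp_all add: span_empty[OF M] smult_1[OF M])
  next
    case (Suc i)
    then have i: "i < n" by simp
    obtain A where A: "finite A" "A \<subseteq> C i" "mod_span R M A = C i" using Suc by auto
    note CS = submoduleD[OF C(3)[OF Suc.prems]]
    note Ci = submoduleD[OF C(3)[of i]]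
    obtain z where z: "z \<in> C (Suc i)" "z \<notin> C i" using C(4)[OF i] by blast
    have st: "C (Suc i) = {x \<oplus> r \<odot> z | x r. x \<in> C i \<and> r \<in> carrier R}"
      "\<And>z r. z \<in> C (Suc i) \<Longrightarrow> r \<in> filt 1 \<Longrightarrow> r \<odot> z \<in> C i"
    proof -
      show "C (Suc i) = {x \<oplus> r \<odot> z | x r. x \<in> C i \<and> r \<in> carrier R}"
        using simple_step(1)[OF M C(3)[of i] C(3)[of "Suc i"] C(4)[OF i] C(5)[OF i] z] i by simp
      show "r \<odot> z \<in> C i" if "z \<in> C (Suc i)" "r \<in> filt 1" for z r
      proof (cases "z \<in> C i")
        case True
        then show ?thesis using Ci(4) i that(2) by simp
      next
        case False
        then show ?thesis
          using simple_step(2)[OF M C(3)[of i] C(3)[of "Suc i"] C(4)[OF i] C(5)[OF i] that(1)] i that(2)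
          by simp
      qed
    qed
    have "A \<subseteq> carrier M" "z \<in> carrier M" using A(2) z Ci(1) CS(1) i by auto
    then have "mod_span R M (insert z A) = C (Suc i)"
      using span_insert[OF M, of A z] A(3) st(1) by simp
    moreover have "insert z A \<subseteq> C (Suc i)" using A(2) z(1) C(4)[OF i] by auto
    moreover have "(fps_X ^ e) ^ Suc i \<odot> x = \<zero>" if x: "x \<in> C (Suc i)" for x
    proof -
      have X: "(fps_X ^ e) ^ i \<in> carrier R" for i
        using mult_mem by (induction i) auto
      have "fps_X ^ e \<in> filt 1" using X_power_filt[OF mult_mem, of 1] mult_pos by simp
      then have "fps_X ^ e \<odot> x \<in> C i" using st(2) x by blast
      then show ?thesis
        using Suc i smult_mult[OF M X[of i] X[of 1], of x] CS(1) x
        by (auto simp: mult.commute[of "fps_X ^ e"])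
    qed
    ultimately show ?case using A(1) by (meson finite_insert)
  qed
  note * = this[OF order_refl, unfolded C(2)]
  show "fin_gen R M" using * fin_gen_iff_span[OF M] by blast
  have "(fps_X ^ e) ^ n \<in> carrier R" using mult_mem by (induction n) auto
  then show "torsion M" unfolding torsion_def using *
    by (intro ballI bexI[of _ "(fps_X ^ e) ^ n"]) auto
qed

lemma finite_length_iff_torsion:
  "module R M \<Longrightarrow> finite_length R M \<longleftrightarrow> fin_gen R M \<and> torsion M"
  using finite_lengthD finite_length_of_torsion by blast

section \<open>Linear functionals and devissage\<close>

text \<open>Covers the two maps that matter: the constant term, towards the residue field, and the
  inclusion into Laurent series, towards the fraction field. With a common target type, the linear
  algebra over both fields is done once.\<close>

definition ring_map :: "('k fps \<Rightarrow> 'k fls) \<Rightarrow> bool" where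
  "ring_map \<rho> \<longleftrightarrow> \<rho> 1 = 1 \<and> (\<forall>r s. \<rho> (r + s) = \<rho> r + \<rho> s) \<and> (\<forall>r s. \<rho> (r * s) = \<rho> r * \<rho> s)"

lemma ring_mapD:
  assumes "ring_map \<rho>"
  shows "\<rho> 1 = 1" "\<rho> (r + s) = \<rho> r + \<rho> s" "\<rho> (r * s) = \<rho> r * \<rho> s" "\<rho> 0 = 0" "\<rho> (r - s) = \<rho> r - \<rho> s"
proof -
  show *: "\<rho> 1 = 1" "\<rho> (r + s) = \<rho> r + \<rho> s" "\<rho> (r * s) = \<rho> r * \<rho> s" for r s
    using assms by (auto simp: ring_map_def)
  have "\<rho> 0 + \<rho> 0 = \<rho> 0 + 0" using *(2)[of 0 0] by (simp only: add_0_right)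
  then show "\<rho> 0 = 0" by (simp only: add_left_cancel)
  show "\<rho> (r - s) = \<rho> r - \<rho> s" using *(2)[of "r - s" s] by simp
qed

definition fls_module :: "('k fps \<Rightarrow> 'k fls) \<Rightarrow> 'k fls set \<Rightarrow> ('k fps, 'k fls) module" where
  "fls_module \<rho> D = \<lparr>carrier = D, mult = (*), one = 1, zero = 0, add = (+), smult = (\<lambda>r x. \<rho> r * x)\<rparr>"

lemma fls_module_simps [simp]:
  "carrier (fls_module \<rho> D) = D" "\<zero>\<^bsub>fls_module \<rho> D\<^esub> = 0" "x \<oplus>\<^bsub>fls_module \<rho> D\<^esub> y = x + y"
  "r \<odot>\<^bsub>fls_module \<rho> D\<^esub> x = \<rho> r * x" "(fls_module \<rho> D)\<lparr>carrier := E\<rparr> = fls_module \<rho> E"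
  by (simp_all add: fls_module_def)

lemma module_fls_UNIV: "ring_map \<rho> \<Longrightarrow> module R (fls_module \<rho> UNIV)"
  by (intro moduleI abelian_groupI cring_R)
     (auto simp: ring_mapD algebra_simps intro: bexI[of _ "- _"] exI[of _ "- _"])

lemma module_fls: "ring_map \<rho> \<Longrightarrow> submodule D R (fls_module \<rho> UNIV) \<Longrightarrow> module R (fls_module \<rho> D)"
  using module_sub[OF module_fls_UNIV] by fastforce

text \<open>For \<open>residue_map\<close> this says that the maximal ideal kills \<open>M\<close>,
  which is then a vector space over \<open>k\<close>; for \<open>fps_to_fls\<close> it says that
  \<open>M\<close> is torsionfree.\<close>

definition faithful :: "('k fps \<Rightarrow> 'k fls) \<Rightarrow> ('k fps, 'm) module \<Rightarrow> bool" where
  "faithful \<rho> M \<longleftrightarrow> (\<forall>r\<in>carrier R. \<forall>x\<in>carrier M. r \<odot>\<^bsub>M\<^esub> x = \<zero>\<^bsub>M\<^esub> \<longleftrightarrow> \<rho> r = 0 \<or> x = \<zero>\<^bsub>M\<^esub>)"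

text \<open>The trace on \<open>M\<close> of the subspace generated by \<open>A\<close> after all
  \<open>r\<close> with \<open>\<rho> r \<noteq> 0\<close> have been inverted.\<close>

definition pure_span :: "('k fps \<Rightarrow> 'k fls) \<Rightarrow> ('k fps, 'm) module \<Rightarrow> 'm set \<Rightarrow> 'm set" where
  "pure_span \<rho> M A = {x \<in> carrier M. \<exists>r\<in>carrier R. \<rho> r \<noteq> 0 \<and> r \<odot>\<^bsub>M\<^esub> x \<in> mod_span R M A}"

lemma span_le_pure_span:
  assumes "module R M" "ring_map \<rho>" "A \<subseteq> carrier M"
  shows "mod_span R M A \<subseteq> pure_span \<rho> M A"
proof
  fix x assume x: "x \<in> mod_span R M A"
  then have "x \<in> carrier M" using span_closed[OF assms(1,3)] by auto
  then show "x \<in> pure_span \<rho> M A"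
    using x ring_mapD(1)[OF assms(2)] closed_1 unfolding pure_span_def
    by (auto intro!: bexI[of _ 1] simp: smult_1[OF assms(1)])
qed

lemma submodule_pure_span:
  fixes M (structure)
  assumes M: "module R M" and \<rho>: "ring_map \<rho>" and A: "A \<subseteq> carrier M"
  shows "submodule (pure_span \<rho> M A) R M"
proof (rule submoduleI'[OF M])
  interpret module R M by (rule M)
  note sp = submoduleD[OF submodule_span[OF M A]]
  show "pure_span \<rho> M A \<subseteq> carrier M" by (auto simp: pure_span_def)
  show "\<zero> \<in> pure_span \<rho> M A" using sp(2) span_le_pure_span[OF assms] by auto
  show "x \<oplus> y \<in> pure_span \<rho> M A" if x: "x \<in> pure_span \<rho> M A" and y: "y \<in> pure_span \<rho> M A" for x y
  proof -
    obtain r s where r: "r \<in> carrier R" "\<rho> r \<noteq> 0" "r \<odot> x \<in> mod_span R M A" "x \<in> carrier M"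
      and s: "s \<in> carrier R" "\<rho> s \<noteq> 0" "s \<odot> y \<in> mod_span R M A" "y \<in> carrier M"
      using x y by (auto simp: pure_span_def)
    have "(r * s) \<odot> (x \<oplus> y) = s \<odot> (r \<odot> x) \<oplus> r \<odot> (s \<odot> y)"
      by (rule smult_mult_add[OF M r(1) s(1) r(4) s(4)])
    also have "\<dots> \<in> mod_span R M A" using r s by (intro sp(3)[OF sp(4) sp(4)])
    finally show ?thesis
      using r s ring_mapD(3)[OF \<rho>] unfolding pure_span_def
      by (intro CollectI conjI bexI[of _ "r * s"]) auto
  qed
  show "t \<odot> x \<in> pure_span \<rho> M A" if t: "t \<in> carrier R" and x: "x \<in> pure_span \<rho> M A" for t x
  proof -
    obtain r where r: "r \<in> carrier R" "\<rho> r \<noteq> 0" "r \<odot> x \<in> mod_span R M A" "x \<in> carrier M"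
      using x by (auto simp: pure_span_def)
    have "r \<odot> (t \<odot> x) = t \<odot> (r \<odot> x)" using smult_commute[OF M r(1) t r(4)] .
    also have "\<dots> \<in> mod_span R M A" using r t by (intro sp(4)[of t "r \<odot> x"])
    finally show ?thesis using r t by (auto simp: pure_span_def)
  qed
qed

lemma pure_span_trans:
  fixes M (structure)
  assumes M: "module R M" and \<rho>: "ring_map \<rho>" and A: "A \<subseteq> pure_span \<rho> M B" and B: "B \<subseteq> carrier M"
  shows "pure_span \<rho> M A \<subseteq> pure_span \<rho> M B"
proof
  fix x assume "x \<in> pure_span \<rho> M A"
  then obtain r where r: "r \<in> carrier R" "\<rho> r \<noteq> 0" "r \<odot> x \<in> mod_span R M A" and x: "x \<in> carrier M"
    by (auto simp: pure_span_def)
  have "r \<odot> x \<in> pure_span \<rho> M B"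
    using span_minimal[OF submodule_pure_span[OF M \<rho> B] A] r(3) by auto
  then obtain s where s: "s \<in> carrier R" "\<rho> s \<noteq> 0" "s \<odot> (r \<odot> x) \<in> mod_span R M B"
    by (auto simp: pure_span_def)
  then have "(s * r) \<odot> x \<in> mod_span R M B" using smult_mult[OF M s(1) r(1) x] by simp
  then show "x \<in> pure_span \<rho> M B"
    using r s x ring_mapD(3)[OF \<rho>] unfolding pure_span_def
    by (intro CollectI conjI bexI[of _ "s * r"]) auto
qed

text \<open>If \<open>r x\<close> is congruent to \<open>b a\<close> modulo the span of
  \<open>A\<close>, the coordinate of \<open>x\<close> along \<open>a\<close> is the fraction
  \<open>\<rho> b / \<rho> r\<close>. Such a relation exists because \<open>insert a A\<close> spans
  up to denominators, and the fraction is unique because \<open>a\<close> lies outside the pure span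
  of \<open>A\<close>.\<close>

lemma linear_functional:
  fixes M :: "('k fps, 'm) module" (structure)
  assumes M: "module R M" and \<rho>: "ring_map \<rho>" and ff: "faithful \<rho> M"
    and A: "A \<subseteq> carrier M" and a: "a \<in> carrier M" and total: "pure_span \<rho> M (insert a A) = carrier M"
    and indep: "a \<notin> pure_span \<rho> M A"
  obtains \<phi> where "\<phi> \<in> mod_hom R M (fls_module \<rho> UNIV)" "\<phi> a = 1"
    "\<And>x. x \<in> carrier M \<Longrightarrow> \<phi> x = 0 \<longleftrightarrow> x \<in> pure_span \<rho> M A"
    "\<And>x. x \<in> carrier M \<Longrightarrow> \<exists>b\<in>carrier R. \<exists>r\<in>carrier R. \<rho> r \<noteq> 0 \<and> \<phi> x = \<rho> b / \<rho> r"
proof -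
  interpret module R M by (rule M)
  note sA = submodule_span[OF M A]
  note S = submoduleD[OF sA]
  note \<rho>D = ring_mapD[OF \<rho>]
  note cm = congruent_multiple[OF M sA a]
  define Q where "Q x r b \<longleftrightarrow> r \<in> carrier R \<and> b \<in> carrier R \<and> \<rho> r \<noteq> 0 \<and>
    congruent_multiple M (mod_span R M A) a b (r \<odot> x)" for x r b
  have ex: "\<exists>r b. Q x r b" if x: "x \<in> carrier M" for x
  proof -
    obtain r where r: "r \<in> carrier R" "\<rho> r \<noteq> 0" "r \<odot> x \<in> mod_span R M (insert a A)"
      using x total by (auto simp: pure_span_def)
    from r(3) show ?thesis
      unfolding span_insert[OF M A a] Q_def congruent_multiple_def using r(1,2) by blast
  qed
  have unique: "\<rho> b / \<rho> r = \<rho> b' / \<rho> r'" if Q: "Q x r b" "Q x r' b'" and x: "x \<in> carrier M" for x r b r' b'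
  proof -
    have *: "r \<in> carrier R" "b \<in> carrier R" "\<rho> r \<noteq> 0" "r' \<in> carrier R" "b' \<in> carrier R" "\<rho> r' \<noteq> 0"
      using Q by (auto simp: Q_def)
    have "congruent_multiple M (mod_span R M A) a (r' * b) (r' \<odot> (r \<odot> x))"
      "congruent_multiple M (mod_span R M A) a (r * b') (r' \<odot> (r \<odot> x))"
      using cm(3)[of b "r \<odot> x" r'] cm(3)[of b' "r' \<odot> x" r] Q smult_commute[OF M *(4,1) x]
      by (simp_all add: Q_def)
    then have "(r' * b - r * b') \<odot> a \<in> mod_span R M A" by (rule cm(5))
    then have "\<rho> (r' * b - r * b') = 0" using indep a * by (auto simp: pure_span_def)
    then show ?thesis using * by (simp add: \<rho>D field_simps)
  qed
  define \<phi> where "\<phi> x = (SOME q. \<exists>r b. Q x r b \<and> q = \<rho> b / \<rho> r)" for x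
  have \<phi>: "\<phi> x = \<rho> b / \<rho> r" if "Q x r b" "x \<in> carrier M" for x r b
    unfolding \<phi>_def using that unique by (intro some_equality) blast+
  show ?thesis
  proof (rule that[of \<phi>])
    show "\<phi> \<in> mod_hom R M (fls_module \<rho> UNIV)"
    proof (rule mod_homI)
      fix x y assume x: "x \<in> carrier M" and y: "y \<in> carrier M"
      obtain r b where Qx: "Q x r b" using ex[OF x] by blast
      obtain r' b' where Qy: "Q y r' b'" using ex[OF y] by blast
      have *: "r \<in> carrier R" "b \<in> carrier R" "\<rho> r \<noteq> 0" "r' \<in> carrier R" "b' \<in> carrier R" "\<rho> r' \<noteq> 0"
        using Qx Qy by (auto simp: Q_def)
      have "congruent_multiple M (mod_span R M A) a (r' * b + r * b') ((r * r') \<odot> (x \<oplus> y))"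
        unfolding smult_mult_add[OF M *(1,4) x y] using Qx Qy by (intro cm(2) cm(3)) (auto simp: Q_def)
      then have "Q (x \<oplus> y) (r * r') (r' * b + r * b')" unfolding Q_def using * by (auto simp: \<rho>D)
      then have "\<phi> (x \<oplus> y) = \<rho> (r' * b + r * b') / \<rho> (r * r')" using x y by (intro \<phi>) auto
      also have "\<dots> = \<phi> x + \<phi> y"
        using * by (simp add: \<phi>[OF Qx x] \<phi>[OF Qy y] \<rho>D field_simps)
      finally show "\<phi> (x \<oplus> y) = \<phi> x \<oplus>\<^bsub>fls_module \<rho> UNIV\<^esub> \<phi> y" by simp
    next
      fix s x assume s: "s \<in> carrier R" and x: "x \<in> carrier M"
      obtain r b where Qx: "Q x r b" using ex[OF x] by blast
      then have r: "r \<in> carrier R" by (simp add: Q_def)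
      have "Q (s \<odot> x) r (s * b)"
        using Qx s cm(3) unfolding Q_def smult_commute[OF M r s x] by auto
      then show "\<phi> (s \<odot> x) = s \<odot>\<^bsub>fls_module \<rho> UNIV\<^esub> \<phi> x"
        using \<phi>[of "s \<odot> x"] \<phi>[OF Qx x] s x by (simp add: \<rho>D)
    qed simp
    have "1 \<odot> a = \<zero> \<oplus> 1 \<odot> a" using a by simp
    then have "Q a 1 1" unfolding Q_def congruent_multiple_def using S(2) \<rho>D(1) by auto
    then show "\<phi> a = 1" using \<phi> a \<rho>D(1) by fastforce
    fix x assume x: "x \<in> carrier M"
    obtain r b where Qx: "Q x r b" using ex[OF x] by blast
    then obtain w where *: "r \<in> carrier R" "b \<in> carrier R" "\<rho> r \<noteq> 0"
      and w: "w \<in> mod_span R M A" "r \<odot> x = w \<oplus> b \<odot> a"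
      by (auto simp: Q_def congruent_multiple_def)
    show "\<exists>b\<in>carrier R. \<exists>r\<in>carrier R. \<rho> r \<noteq> 0 \<and> \<phi> x = \<rho> b / \<rho> r"
      using \<phi>[OF Qx x] * by auto
    show "\<phi> x = 0 \<longleftrightarrow> x \<in> pure_span \<rho> M A"
    proof
      assume "\<phi> x = 0"
      then have "\<rho> b = 0" using \<phi>[OF Qx x] * by simp
      then have "b \<odot> a = \<zero>" using ff * a by (simp add: faithful_def)
      then have "r \<odot> x = w" using w S(1) by auto
      then show "x \<in> pure_span \<rho> M A" using w * x by (auto simp: pure_span_def)
    next
      assume "x \<in> pure_span \<rho> M A"
      then obtain s where s: "s \<in> carrier R" "\<rho> s \<noteq> 0" "s \<odot> x \<in> mod_span R M A"
        by (auto simp: pure_span_def)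
      then have "Q x s 0" unfolding Q_def cm(4) by simp
      then show "\<phi> x = 0" using \<phi> x \<rho>D(4) by fastforce
    qed
  qed
qed

text \<open>A finite set of least cardinality that spans up to denominators behaves like a basis: no
  element lies in the pure span of the others, so the coordinate along any of them is
  defined.\<close>

lemma nonzero_functional:
  fixes M :: "('k fps, 'm) module"
  assumes M: "module R M" "fin_gen R M" and \<rho>: "ring_map \<rho>" and ff: "faithful \<rho> M"
    and nz: "carrier M \<noteq> {\<zero>\<^bsub>M\<^esub>}"
  obtains \<phi> a where "a \<in> carrier M" "\<phi> \<in> mod_hom R M (fls_module \<rho> UNIV)" "\<phi> a = 1"
    "\<And>x. x \<in> carrier M \<Longrightarrow> \<exists>b\<in>carrier R. \<exists>r\<in>carrier R. \<rho> r \<noteq> 0 \<and> \<phi> x = \<rho> b / \<rho> r"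
proof -
  interpret module R M by (rule M)
  define P where "P A \<longleftrightarrow> finite A \<and> A \<subseteq> carrier M \<and> pure_span \<rho> M A = carrier M" for A
  obtain A0 where A0: "finite A0" "A0 \<subseteq> carrier M" "mod_span R M A0 = carrier M"
    using M(2) unfolding fin_gen_iff_span[OF M(1)] by blast
  then have "P A0"
    using span_le_pure_span[OF M(1) \<rho> A0(2)] unfolding P_def by (auto simp: pure_span_def)
  then obtain A where A: "P A" and minimal: "\<And>B. P B \<Longrightarrow> card A \<le> card B"
    using ex_has_least_nat[of P A0 card] by metis
  have "A \<noteq> {}"
  proof
    assume "A = {}"
    then have "pure_span \<rho> M {} = carrier M" using A by (simp add: P_def)
    moreover have "pure_span \<rho> M {} \<subseteq> {\<zero>\<^bsub>M\<^esub>}"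
      using ff by (auto simp: pure_span_def span_empty[OF M(1)] faithful_def)
    ultimately show False using nz M.zero_closed by blast
  qed
  then obtain a where a: "a \<in> A" by blast
  have AM: "A - {a} \<subseteq> carrier M" "a \<in> carrier M" "finite A" using A a by (auto simp: P_def)
  have "a \<notin> pure_span \<rho> M (A - {a})"
  proof
    assume "a \<in> pure_span \<rho> M (A - {a})"
    then have "A \<subseteq> pure_span \<rho> M (A - {a})"
      using span_le_pure_span[OF M(1) \<rho> AM(1)] span_superset[of "A - {a}" R M] by auto
    then have "pure_span \<rho> M A \<subseteq> pure_span \<rho> M (A - {a})" by (rule pure_span_trans[OF M(1) \<rho> _ AM(1)])
    then have "P (A - {a})" using A AM by (auto simp: P_def pure_span_def)
    from minimal[OF this] show False using a AM(3) by (metis card_Diff1_less leD)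
  qed
  moreover have "pure_span \<rho> M (insert a (A - {a})) = carrier M"
    using A a by (simp add: P_def insert_absorb)
  ultimately show ?thesis
    using linear_functional[OF M(1) \<rho> ff AM(1,2)] that AM(2) by metis
qed

section \<open>Devissage along linear functionals\<close>

lemma closed_extensions_surj:
  fixes X :: "('k fps, 'm) module set"
  assumes "closed_extensions R X" "M \<in> mod_cat R" "g \<in> mod_hom R M N" "g ` carrier M = carrier N"
    "N \<in> X" "M\<lparr>carrier := {x \<in> carrier M. g x = \<zero>\<^bsub>N\<^esub>}\<rparr> \<in> X"
  shows "M \<in> X"
proof -
  have "short_exact R (M\<lparr>carrier := {x \<in> carrier M. g x = \<zero>\<^bsub>N\<^esub>}\<rparr>) id M g N"
    using assms(3,4) by (auto simp: short_exact_def mod_hom_def)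
  then show ?thesis using assms unfolding closed_extensions_def by blast
qed

lemma mod_catD: "M \<in> mod_cat R \<Longrightarrow> module R M" "M \<in> mod_cat R \<Longrightarrow> fin_gen R M"
  by (simp_all add: mod_cat_def)

lemma mod_cat_sub: "M \<in> mod_cat R \<Longrightarrow> submodule K R M \<Longrightarrow> M\<lparr>carrier := K\<rparr> \<in> mod_cat R"
  using module_sub fin_gen_sub by (auto simp: mod_cat_def)

text \<open>Induction on the number of generators up to denominators. A redundant generator is
  dropped; otherwise the coordinate along it maps \<open>M\<close> onto a module \<open>D\<close> of
  fractions with \<open>1 \<in> D\<close>, and the kernel is the pure span of the other generators.
  So \<open>X\<close> only has to contain the pieces of rank one.\<close>

lemma devissage:
  fixes X :: "('k fps, 'm) module set"
  assumes ext: "closed_extensions R X" and zero: "zero_cat R \<subseteq> X" and \<rho>: "ring_map \<rho>"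
    and base: "\<And>D N. submodule D R (fls_module \<rho> UNIV) \<Longrightarrow> 1 \<in> D \<Longrightarrow>
      D \<subseteq> {\<rho> b / \<rho> r | b r. b \<in> carrier R \<and> r \<in> carrier R \<and> \<rho> r \<noteq> 0} \<Longrightarrow>
      fin_gen R (fls_module \<rho> D) \<Longrightarrow> N \<in> mod_cat R \<Longrightarrow> mod_iso R (fls_module \<rho> D) N \<Longrightarrow> N \<in> X"
    and M: "M \<in> mod_cat R" "faithful \<rho> M"
  shows "M \<in> X"
proof -
  obtain A where A: "finite A" "A \<subseteq> carrier M" "mod_span R M A = carrier M"
    using mod_catD(2)[OF M(1)] unfolding fin_gen_iff_span[OF mod_catD(1)[OF M(1)]] by blast
  have "pure_span \<rho> M A = carrier M"
    using span_le_pure_span[OF mod_catD(1)[OF M(1)] \<rho> A(2)] A(3) by (auto simp: pure_span_def)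
  with A(1,2) M show ?thesis
  proof (induction "card A" arbitrary: A M)
    case 0
    then have "A = {}" by simp
    note Mm = mod_catD(1)[OF 0(4)]
    interpret module R M by (rule Mm)
    have "pure_span \<rho> M {} \<subseteq> {\<zero>\<^bsub>M\<^esub>}"
      using 0(5) by (auto simp: pure_span_def span_empty[OF Mm] faithful_def)
    then have "carrier M = {\<zero>\<^bsub>M\<^esub>}" using 0(6) \<open>A = {}\<close> M.zero_closed by blast
    then show ?case using zero 0(4) by (auto simp: zero_cat_def)
  next
    case (Suc n)
    note Mm = mod_catD(1)[OF Suc.prems(3)]
    obtain a where a: "a \<in> A" using Suc.hyps(2) by fastforce
    define B where "B = A - {a}"
    have B: "finite B" "B \<subseteq> carrier M" "n = card B" "insert a B = A" "a \<in> carrier M"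
      using a Suc.prems(1,2) Suc.hyps(2) by (auto simp: B_def)
    show ?case
    proof (cases "a \<in> pure_span \<rho> M B")
      case True
      then have "A \<subseteq> pure_span \<rho> M B"
        using span_le_pure_span[OF Mm \<rho> B(2)] span_superset[of B R M] B(4) by auto
      from pure_span_trans[OF Mm \<rho> this B(2)] have "pure_span \<rho> M B = carrier M"
        using Suc.prems(5) by (auto simp: pure_span_def)
      then show ?thesis using Suc.hyps(1)[OF B(3,1,2) Suc.prems(3,4)] by simp
    next
      case False
      have tot: "pure_span \<rho> M (insert a B) = carrier M" using Suc.prems(5) B(4) by simp
      obtain \<phi> where \<phi>: "\<phi> \<in> mod_hom R M (fls_module \<rho> UNIV)" "\<phi> a = 1"
        "\<And>x. x \<in> carrier M \<Longrightarrow> \<phi> x = 0 \<longleftrightarrow> x \<in> pure_span \<rho> M B"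
        "\<And>x. x \<in> carrier M \<Longrightarrow> \<exists>b\<in>carrier R. \<exists>r\<in>carrier R. \<rho> r \<noteq> 0 \<and> \<phi> x = \<rho> b / \<rho> r"
        using linear_functional[OF Mm \<rho> Suc.prems(4) B(2,5) tot False] by metis
      let ?D = "\<phi> ` carrier M"
      note U = module_fls_UNIV[OF \<rho>]
      have D: "submodule ?D R (fls_module \<rho> UNIV)"
        by (rule submodule_image[OF Mm U \<phi>(1) submodule_carrier[OF Mm]])
      note Dm = module_fls[OF \<rho> D]
      have h: "\<phi> \<in> mod_hom R M (fls_module \<rho> ?D)" using \<phi>(1) by (auto simp: mod_hom_def)
      have hs: "\<phi> ` carrier M = carrier (fls_module \<rho> ?D)" by simp
      have fg: "fin_gen R (fls_module \<rho> ?D)"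
        by (rule fin_gen_surj[OF Mm Dm h hs mod_catD(2)[OF Suc.prems(3)]])
      \<comment> \<open>The image of \<open>\<phi>\<close> consists of Laurent series; closure under
        extensions needs a copy on the carrier type of \<open>M\<close>.\<close>
      obtain N :: "('k fps, 'm) module" and g where N: "module R N" "mod_iso R (fls_module \<rho> ?D) N"
        "g \<in> mod_hom R M N" "g ` carrier M = carrier N"
        "\<And>x. x \<in> carrier M \<Longrightarrow> g x = \<zero>\<^bsub>N\<^esub> \<longleftrightarrow> \<phi> x = \<zero>\<^bsub>fls_module \<rho> ?D\<^esub>"
        using quotient_transport[OF Mm Dm h hs] by metis
      have Nc: "N \<in> mod_cat R"
        using N(1) fin_gen_surj[OF Mm N(1,3,4) mod_catD(2)[OF Suc.prems(3)]] by (simp add: mod_cat_def)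
      have "?D \<subseteq> {\<rho> b / \<rho> r | b r. b \<in> carrier R \<and> r \<in> carrier R \<and> \<rho> r \<noteq> 0}"
        using \<phi>(4) by blast
      moreover have "1 \<in> ?D" using \<phi>(2) B(5) by force
      ultimately have NX: "N \<in> X" using base[OF D _ _ fg Nc N(2)] by blast
      let ?K = "pure_span \<rho> M B"
      note sK = submodule_pure_span[OF Mm \<rho> B(2)]
      have BK: "B \<subseteq> ?K" using span_le_pure_span[OF Mm \<rho> B(2)] span_superset[of B R M] by auto
      have Kf: "faithful \<rho> (M\<lparr>carrier := ?K\<rparr>)"
        using Suc.prems(4) by (auto simp: faithful_def pure_span_def)
      have "pure_span \<rho> (M\<lparr>carrier := ?K\<rparr>) B = ?K"
        unfolding pure_span_def[of \<rho> "M\<lparr>carrier := ?K\<rparr>"] span_sub[OF Mm sK BK]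
        by (auto simp: pure_span_def)
      then have KX: "M\<lparr>carrier := ?K\<rparr> \<in> X"
        using Suc.hyps(1)[OF B(3,1) _ mod_cat_sub[OF Suc.prems(3) sK] Kf] BK by simp
      have "{x \<in> carrier M. g x = \<zero>\<^bsub>N\<^esub>} = ?K"
        using N(5) \<phi>(3) submoduleD(1)[OF sK] by auto
      then show ?thesis
        using closed_extensions_surj[OF ext Suc.prems(3) N(3,4) NX] KX by simp
    qed
  qed
qed

section \<open>The residue field and torsion modules\<close>

definition residue_map :: "'k fps \<Rightarrow> 'k fls" where
  "residue_map f = fls_const (fps_nth f 0)"

lemma ring_map_residue: "ring_map residue_map"
  by (simp add: ring_map_def residue_map_def fls_plus_const fls_const_mult_const)

lemma ring_map_fps_to_fls: "ring_map fps_to_fls"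
  by (simp add: ring_map_def fls_times_fps_to_fls)

abbreviation residue_module :: "('k fps, 'k fls) module" where
  "residue_module \<equiv> fls_module residue_map (range fls_const)"

lemma faithful_residue:
  fixes M (structure)
  assumes M: "module R M" and kill: "\<And>r x. r \<in> filt 1 \<Longrightarrow> x \<in> carrier M \<Longrightarrow> r \<odot> x = \<zero>"
  shows "faithful residue_map M"
  unfolding faithful_def
proof (intro ballI)
  fix r x assume r: "r \<in> carrier R" and x: "x \<in> carrier M"
  show "r \<odot> x = \<zero> \<longleftrightarrow> residue_map r = 0 \<or> x = \<zero>"
  proof (cases "fps_nth r 0 = 0")
    case True
    then show ?thesis using kill[OF filt_1I[OF r] x] by (simp add: residue_map_def)
  next
    case False
    then have i: "inverse r \<in> carrier R" "inverse r * r = 1"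
      using inverse_closed[OF r] inverse_mult_eq_1 by auto
    have "x = \<zero>" if "r \<odot> x = \<zero>"
      using smult_mult[OF M i(1) r x] that smult_zero[OF M i(1)] smult_1[OF M x] i(2) by simp
    then show ?thesis using False smult_zero[OF M r] by (auto simp: residue_map_def)
  qed
qed

text \<open>For \<open>residue_map\<close> all fractions are constants, so the only piece
  \<open>D\<close> of rank one with \<open>1 \<in> D\<close> is the field \<open>k\<close>
  itself.\<close>

lemma killed_in:
  fixes X :: "('k fps, 'm) module set"
  assumes ext: "closed_extensions R X" and zero: "zero_cat R \<subseteq> X"
    and res: "\<And>N. N \<in> mod_cat R \<Longrightarrow> mod_iso R residue_module N \<Longrightarrow> N \<in> X"
    and M: "M \<in> mod_cat R" and kill: "\<And>r x. r \<in> filt 1 \<Longrightarrow> x \<in> carrier M \<Longrightarrow> r \<odot>\<^bsub>M\<^esub> x = \<zero>\<^bsub>M\<^esub>"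
  shows "M \<in> X"
proof (rule devissage[OF ext zero ring_map_residue _ M faithful_residue[OF mod_catD(1)[OF M] kill]])
  fix D and N :: "('k fps, 'm) module"
  assume D: "submodule D R (fls_module residue_map UNIV)" "1 \<in> D"
    "D \<subseteq> {residue_map b / residue_map r | b r. b \<in> carrier R \<and> r \<in> carrier R \<and> residue_map r \<noteq> 0}"
    and N: "N \<in> mod_cat R" "mod_iso R (fls_module residue_map D) N"
  have "D \<subseteq> range fls_const"
    using D(3) by (auto simp: residue_map_def fls_const_divide_const)
  moreover have "fls_const a \<in> D" for a
    using submoduleD(4)[OF D(1) const_closed[of a] D(2)] by (simp add: residue_map_def)
  ultimately have "D = range fls_const" by blast
  then show "N \<in> X" using res N by simp
qed

lemma torsion_killed:
  fixes M (structure)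
  assumes M: "M \<in> mod_cat R" and "torsion M"
  obtains n where "\<And>r x. r \<in> filt n \<Longrightarrow> x \<in> carrier M \<Longrightarrow> r \<odot> x = \<zero>"
proof -
  note Mm = mod_catD(1)[OF M]
  interpret module R M by (rule Mm)
  obtain A where A: "finite A" "A \<subseteq> carrier M" "mod_span R M A = carrier M"
    using mod_catD(2)[OF M] unfolding fin_gen_iff_span[OF mod_catD(1)[OF M]] by blast
  define K where "K n = {x \<in> carrier M. \<forall>r\<in>filt n. r \<odot> x = \<zero>}" for n
  have K: "submodule (K n) R M" for n
  proof (rule submoduleI'[OF Mm])
    show "s \<odot> x \<in> K n" if "s \<in> carrier R" "x \<in> K n" for s x
    proof -
      have "r \<odot> (s \<odot> x) = \<zero>" if r: "r \<in> filt n" for r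
        using r \<open>x \<in> K n\<close> smult_commute[OF Mm filt_closed[OF r] \<open>s \<in> carrier R\<close>, of x]
          smult_zero[OF Mm \<open>s \<in> carrier R\<close>] by (simp add: K_def)
      then show ?thesis using that by (simp add: K_def)
    qed
  qed (auto simp: K_def smult_r_distr)
  have mono: "K m \<subseteq> K n" if "m \<le> n" for m n
    using filt_mono[OF that] by (auto simp: K_def)
  have "\<exists>n. A \<subseteq> K n" using A(1,2)
  proof (induction A)
    case (insert a A)
    then obtain n where n: "A \<subseteq> K n" by auto
    have a: "a \<in> carrier M" using insert by auto
    obtain r where r: "r \<in> carrier R" "r \<noteq> 0" "r \<odot> a = \<zero>"
      using a assms(2) by (auto simp: torsion_def)
    have "a \<in> K (c + subdegree r)" using filt_annihilates[OF Mm a r] a by (simp add: K_def)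
    then show ?case
      using n mono[of n "max n (c + subdegree r)"] mono[of "c + subdegree r" "max n (c + subdegree r)"]
      by (intro exI[of _ "max n (c + subdegree r)"]) auto
  qed simp
  then obtain n where "A \<subseteq> K n" ..
  then have "carrier M \<subseteq> K n" using span_minimal[OF K, of A n] A(3) by simp
  then show ?thesis by (intro that[of n]) (auto simp: K_def)
qed

text \<open>For \<open>n \<in> H\<close>, multiplication by \<open>fps_X ^ n\<close> cuts a module
  killed by \<open>filt (Suc n)\<close> into an image killed by the maximal ideal and a kernel
  killed by \<open>filt n\<close>.\<close>

lemma torsion_in:
  fixes X :: "('k fps, 'm) module set"
  assumes ext: "closed_extensions R X" and zero: "zero_cat R \<subseteq> X"
    and res: "\<And>N. N \<in> mod_cat R \<Longrightarrow> mod_iso R residue_module N \<Longrightarrow> N \<in> X"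
    and M: "M \<in> mod_cat R" "torsion M"
  shows "M \<in> X"
proof -
  obtain n where "\<And>r x. r \<in> filt n \<Longrightarrow> x \<in> carrier M \<Longrightarrow> r \<odot>\<^bsub>M\<^esub> x = \<zero>\<^bsub>M\<^esub>"
    using torsion_killed[OF M] by metis
  then show ?thesis using M(1)
  proof (induction n arbitrary: M)
    case 0
    note Mm = mod_catD(1)[OF 0(2)]
    interpret module R M by (rule Mm)
    have "x = \<zero>\<^bsub>M\<^esub>" if x: "x \<in> carrier M" for x
      using 0(1)[of 1 x] x smult_1[OF Mm x] by (simp add: filt_0)
    then have "carrier M = {\<zero>\<^bsub>M\<^esub>}" using M.zero_closed by blast
    then show ?case using zero 0(2) by (auto simp: zero_cat_def)
  next
    case (Suc n)
    note Mm = mod_catD(1)[OF Suc.prems(2)]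
    interpret module R M by (rule Mm)
    show ?case
    proof (cases "n \<in> H")
      case False
      then show ?thesis using Suc by (simp add: filt_gap)
    next
      case True
      let ?f = "\<lambda>x. fps_X ^ n \<odot>\<^bsub>M\<^esub> x"
      note X = X_power_closed[OF True]
      note f = smult_hom[OF Mm X]
      let ?K = "M\<lparr>carrier := {x \<in> carrier M. ?f x = \<zero>\<^bsub>M\<^esub>}\<rparr>"
      let ?N = "mod_image M M ?f"
      have Nc: "?N \<in> mod_cat R"
        using module_image[OF Mm Mm f] fin_gen_image[OF Mm Mm f] mod_catD[OF Suc.prems(2)]
        by (simp add: mod_cat_def)
      have NX: "?N \<in> X"
      proof (rule killed_in[OF ext zero res Nc])
        fix r y assume r: "r \<in> filt 1" and "y \<in> carrier ?N"
        then obtain x where x: "x \<in> carrier M" "y = ?f x" by (auto simp: mod_image_def)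
        have "(r * fps_X ^ n) \<odot>\<^bsub>M\<^esub> x = \<zero>\<^bsub>M\<^esub>"
          using Suc.prems(1)[OF filt_1_X_power[OF r True] x(1)] .
        then show "r \<odot>\<^bsub>?N\<^esub> y = \<zero>\<^bsub>?N\<^esub>"
          using smult_mult[OF Mm filt_closed[OF r] X x(1)] x(2) by (simp add: mod_image_def)
      qed
      have KX: "?K \<in> X"
      proof (rule Suc.IH)
        show "?K \<in> mod_cat R" by (rule mod_cat_sub[OF Suc.prems(2) submodule_kernel[OF Mm Mm f]])
        fix r x assume r: "r \<in> filt n" and x: "x \<in> carrier ?K"
        show "r \<odot>\<^bsub>?K\<^esub> x = \<zero>\<^bsub>?K\<^esub>"
          using killed_by_filt[OF Mm _ True _ Suc.prems(1) r, of x] x by simp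
      qed
      show ?thesis
        using closed_extensions_surj[OF ext Suc.prems(2) mod_hom_to_image[OF f] _ NX] KX
        by (simp add: mod_image_def)
    qed
  qed
qed

section \<open>Copies of modules in the ambient category\<close>

text \<open>The exact sequences below live on the type of power series, where concrete modules are at
  hand; \<open>copies_in\<close> moves them to the carrier type of the category.\<close>

definition copies_in :: "('k fps, 'm) module set \<Rightarrow> ('k fps, 'n) module \<Rightarrow> bool" where
  "copies_in X M \<longleftrightarrow> (\<forall>N\<in>mod_cat R. mod_iso R M N \<longrightarrow> N \<in> X)"

lemma copies_inI: "subcategory R X \<Longrightarrow> module R M \<Longrightarrow> N \<in> X \<Longrightarrow> mod_iso R M N \<Longrightarrow> copies_in X M"
  unfolding copies_in_def subcategory_def using mod_iso_sym mod_iso_trans by metis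

lemma copies_in_iso: "copies_in X M \<Longrightarrow> module R M \<Longrightarrow> mod_iso R M N \<Longrightarrow> copies_in X N"
  unfolding copies_in_def using mod_iso_trans by metis

lemma copy_mod_cat:
  assumes "inj emb" "M \<in> mod_cat R"
  shows "mod_transport emb M \<in> mod_cat R" "mod_iso R M (mod_transport emb M)"
    "module R (mod_transport emb M)"
proof -
  have "inj_on emb (carrier M)" using assms(1) inj_on_subset by blast
  note t = mod_transport[OF mod_catD(1)[OF assms(2)] this]
  show "mod_iso R M (mod_transport emb M)" "module R (mod_transport emb M)" by fact+
  then show "mod_transport emb M \<in> mod_cat R"
    using mod_iso_modules[OF t(4) mod_catD(1)[OF assms(2)] t(1) mod_catD(2)[OF assms(2)]]
    by (simp add: mod_cat_def)
qed

lemma copy_in: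
  "inj emb \<Longrightarrow> M \<in> mod_cat R \<Longrightarrow> copies_in X M \<Longrightarrow> mod_transport emb M \<in> X"
  unfolding copies_in_def using copy_mod_cat by blast

lemma mod_sum_mod_cat: "A \<in> mod_cat R \<Longrightarrow> B \<in> mod_cat R \<Longrightarrow> mod_sum A B \<in> mod_cat R"
  by (simp add: mod_cat_def module_mod_sum fin_gen_mod_sum)

lemma extension_copy_in:
  assumes "closed_extensions R X" "L' \<in> X" "mod_iso R L' L" "N' \<in> X" "mod_iso R N' N" "X \<subseteq> mod_cat R"
    "L \<in> mod_cat R" "N \<in> mod_cat R" "E \<in> mod_cat R" "E' \<in> mod_cat R" "mod_iso R E' E"
    "short_exact R L f E g N"
  shows "E' \<in> X"
proof -
  obtain f' g' where "short_exact R L' f' E' g' N'"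
    using short_exact_iso[of R L' L N' N E' E f g] assms mod_catD(1) by (metis subsetD)
  then show ?thesis using assms unfolding closed_extensions_def by blast
qed

text \<open>The middle term lives on pairs of series. The injection
  \<open>emb \<circ> interleave\<close> gives it a copy on \<open>'m\<close>, where closure under
  extensions and then under summands applies.\<close>

lemma summand_copies_in:
  fixes emb :: "'k fps \<Rightarrow> 'm" and X :: "('k fps, 'm) module set"
    and A B L N :: "('k fps, 'k fps) module"
  assumes emb: "inj emb" and X: "subcategory R X" "closed_extensions R X" "closed_summands R X"
    and M: "A \<in> mod_cat R" "B \<in> mod_cat R" "L \<in> mod_cat R" "N \<in> mod_cat R"
    and LN: "copies_in X L" "copies_in X N" and ex: "short_exact R L f (mod_sum A B) g N"
  shows "copies_in X A"
proof -
  let ?E = "mod_sum A B"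
  note Ec = mod_sum_mod_cat[OF M(1,2)]
  have inj: "inj (emb \<circ> interleave)" using emb inj_interleave by (rule inj_compose)
  note E' = copy_mod_cat[OF inj Ec]
  note iso = mod_iso_sym[OF mod_catD(1)]
  have EX: "mod_transport (emb \<circ> interleave) ?E \<in> X"
    by (rule extension_copy_in[OF X(2) copy_in[OF emb M(3) LN(1)] iso[OF M(3)] copy_in[OF emb M(4) LN(2)] iso[OF M(4)]
          _ M(3,4) Ec E'(1) iso[OF Ec] ex])
       (use X(1) copy_mod_cat[OF emb] M E' in \<open>auto simp: subcategory_def\<close>)
  have "mod_iso R ?E (mod_sum (mod_transport emb A) (mod_transport emb B))"
    by (rule mod_sum_cong[OF copy_mod_cat(2)[OF emb M(1)] copy_mod_cat(2)[OF emb M(2)]])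
  then have "mod_iso R (mod_transport (emb \<circ> interleave) ?E) (mod_sum (mod_transport emb A) (mod_transport emb B))"
    using mod_iso_trans[OF iso[OF Ec E'(2)]] by blast
  then have "mod_transport emb A \<in> X"
    using X(3) EX copy_mod_cat(1)[OF emb M(1)] copy_mod_cat(1)[OF emb M(2)]
    unfolding closed_summands_def by blast
  then show ?thesis
    using copies_inI[OF X(1) mod_catD(1)[OF M(1)] _ copy_mod_cat(2)[OF emb M(1)]] by blast
qed

text \<open>The direct sum is the middle term of a split sequence, so closure under extensions
  suffices.\<close>

lemma sum_copies_in:
  fixes emb :: "'k fps \<Rightarrow> 'm" and X :: "('k fps, 'm) module set"
    and A B :: "('k fps, 'k fps) module"
  assumes emb: "inj emb" and X: "subcategory R X" "closed_extensions R X"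
    and M: "A \<in> mod_cat R" "B \<in> mod_cat R" and AB: "copies_in X A" "copies_in X B"
  shows "mod_transport (emb \<circ> interleave) (mod_sum A B) \<in> X"
proof -
  let ?E = "mod_sum A B"
  note Ec = mod_sum_mod_cat[OF M(1,2)]
  interpret A: module R A by (rule mod_catD(1)[OF M(1)])
  interpret B: module R B by (rule mod_catD(1)[OF M(2)])
  have inj: "inj (emb \<circ> interleave)" using emb inj_interleave by (rule inj_compose)
  note E' = copy_mod_cat[OF inj Ec]
  note iso = mod_iso_sym[OF mod_catD(1)]
  have ex: "short_exact R A (\<lambda>x. (x, \<zero>\<^bsub>B\<^esub>)) ?E snd B"
    by (auto simp: short_exact_def mod_hom_def mod_sum_def inj_on_def image_iff intro: A.M.zero_closed)
  show ?thesis
    by (rule extension_copy_in[OF X(2) copy_in[OF emb M(1) AB(1)] iso[OF M(1)] copy_in[OF emb M(2) AB(2)] iso[OF M(2)]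
          _ M(1,2) Ec E'(1) iso[OF Ec] ex])
       (use X(1) copy_mod_cat[OF emb] M E' in \<open>auto simp: subcategory_def\<close>)
qed

section \<open>Ideals and cyclic modules\<close>

definition ideal_module :: "'k fps set \<Rightarrow> ('k fps, 'k fps) module" where
  "ideal_module I = \<lparr>carrier = I, mult = (*), one = 1, zero = 0, add = (+), smult = (*)\<rparr>"

lemma ideal_module_simps [simp]:
  "carrier (ideal_module I) = I" "\<zero>\<^bsub>ideal_module I\<^esub> = 0" "x \<oplus>\<^bsub>ideal_module I\<^esub> y = x + y"
  "r \<odot>\<^bsub>ideal_module I\<^esub> x = r * x" "(ideal_module I)\<lparr>carrier := J\<rparr> = ideal_module J"
  by (simp_all add: ideal_module_def)

definition is_ideal :: "'k fps set \<Rightarrow> bool" where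
  "is_ideal I \<longleftrightarrow> I \<subseteq> carrier R \<and> 0 \<in> I \<and> (\<forall>f\<in>I. \<forall>g\<in>I. f + g \<in> I) \<and> (\<forall>r\<in>carrier R. \<forall>f\<in>I. r * f \<in> I)"

lemma is_idealD:
  assumes "is_ideal I"
  shows "\<And>f. f \<in> I \<Longrightarrow> f \<in> carrier R" "0 \<in> I" "\<And>f g. f \<in> I \<Longrightarrow> g \<in> I \<Longrightarrow> f + g \<in> I"
    "\<And>r f. r \<in> carrier R \<Longrightarrow> f \<in> I \<Longrightarrow> r * f \<in> I" "\<And>f. f \<in> I \<Longrightarrow> - f \<in> I"
    "\<And>f g. f \<in> I \<Longrightarrow> g \<in> I \<Longrightarrow> f - g \<in> I"
proof -
  show *: "\<And>f. f \<in> I \<Longrightarrow> f \<in> carrier R" "0 \<in> I" "\<And>f g. f \<in> I \<Longrightarrow> g \<in> I \<Longrightarrow> f + g \<in> I"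
    "\<And>r f. r \<in> carrier R \<Longrightarrow> f \<in> I \<Longrightarrow> r * f \<in> I"
    using assms unfolding is_ideal_def by blast+
  show **: "- f \<in> I" if "f \<in> I" for f using *(4)[of "-1" f] that by simp
  show "f - g \<in> I" if "f \<in> I" "g \<in> I" for f g using *(3)[of f "- g"] ** that by simp
qed

lemma is_ideal_carrier: "is_ideal (carrier R)"
  by (auto simp: is_ideal_def)

lemma is_ideal_filt: "is_ideal (filt n)"
  by (auto simp: is_ideal_def intro: filt_add filt_smult)

lemma module_regular: "module R (ideal_module (carrier R))"
  by (intro moduleI abelian_groupI cring_R) (auto simp: algebra_simps intro: bexI[of _ "- _"])

lemma submodule_regular: "submodule I R (ideal_module (carrier R)) \<longleftrightarrow> is_ideal I"
  by (simp add: submodule_iff[OF module_regular] is_ideal_def)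

lemma regular_mod_cat: "ideal_module (carrier R) \<in> mod_cat R"
proof -
  have "f \<in> mod_span R (ideal_module (carrier R)) {1}" if f: "f \<in> carrier R" for f
    using submoduleD(4)[OF submodule_span[OF module_regular], of "{1}" f 1] f
      span_superset[of "{1}" R "ideal_module (carrier R)"] by auto
  then have "mod_span R (ideal_module (carrier R)) {1} = carrier (ideal_module (carrier R))"
    using span_closed[OF module_regular, of "{1}"] by auto
  then have "fin_gen R (ideal_module (carrier R))"
    unfolding fin_gen_iff_span[OF module_regular] by (intro exI[of _ "{1}"]) simp
  then show ?thesis by (simp add: mod_cat_def module_regular)
qed

lemma ideal_mod_cat: "is_ideal I \<Longrightarrow> ideal_module I \<in> mod_cat R"
  using mod_cat_sub[OF regular_mod_cat, of I] by (simp add: submodule_regular)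

section \<open>The self-extensions that lower the order by one\<close>

definition step_ideal :: "nat \<Rightarrow> 'k fps set" where
  "step_ideal n = {f \<in> filt (Suc n). fps_nth f (n + e) = 0}"

text \<open>Up to its constant term, \<open>r\<close> lies in the maximal ideal, whose elements have
  order at least \<open>e\<close> and whose products with \<open>f\<close> start beyond
  \<open>n + e\<close>. So the coefficient at \<open>n + e\<close> is only rescaled.\<close>

lemma is_ideal_step: "is_ideal (step_ideal n)"
proof -
  have "r * f \<in> step_ideal n" if r: "r \<in> carrier R" and f: "f \<in> step_ideal n" for r f
  proof -
    obtain s where s: "s \<in> filt (Suc 0)" "r = fps_const (fps_nth r 0) * fps_X ^ 0 + s"
      using filt_split[of r 0] r zero_mem by (auto simp: filt_0)
    have fn: "f \<in> filt (Suc n)" "fps_nth f (n + e) = 0" using f by (auto simp: step_ideal_def)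
    have "s * f \<in> filt (e + Suc n)" using filt_mult[OF _ fn(1)] s(1) filt_1 by simp
    then have "fps_nth (s * f) (n + e) = 0" by (rule filt_nth) simp
    moreover have "r * f = fps_const (fps_nth r 0) * f + s * f"
      by (subst s(2)) (simp add: algebra_simps)
    ultimately have "fps_nth (r * f) (n + e) = 0" using fn(2) by simp
    then show ?thesis using filt_smult[OF r fn(1)] by (simp add: step_ideal_def)
  qed
  then show ?thesis by (auto simp: is_ideal_def step_ideal_def intro: filt_add)
qed

text \<open>The coefficient of \<open>fps_X ^ e * r\<close> at \<open>n + e\<close> is that of
  \<open>r\<close> at \<open>n\<close>, so the condition defining \<open>step_ideal n\<close>
  removes exactly the term of order \<open>n\<close> from \<open>r\<close>.\<close>

lemma step_ideal_colon:
  assumes "r \<in> carrier R"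
  shows "r \<in> filt n \<and> fps_X ^ e * r \<in> step_ideal n \<longleftrightarrow> r \<in> filt (Suc n)"
proof -
  have "fps_nth (fps_X ^ e * r) (n + e) = fps_nth r n" by (simp add: fps_X_power_mult_nth)
  moreover have "fps_X ^ e * r \<in> filt (Suc n)" if "r \<in> filt n"
    using filt_mult[OF X_power_filt[OF mult_mem order_refl] that] filt_mono[of "Suc n" "e + n"] mult_pos
    by auto
  ultimately show ?thesis by (auto simp: step_ideal_def filt_Suc)
qed

text \<open>Because \<open>n \<in> H\<close>, the monomial \<open>fps_X ^ n\<close> lies in
  \<open>filt n\<close>, and its product with \<open>fps_X ^ e\<close> is the monomial of order
  \<open>n + e\<close> that \<open>step_ideal n\<close> lacks.\<close>

lemma step_ideal_sum:
  assumes n: "n \<in> H"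
  shows "f \<in> filt (Suc n) \<longleftrightarrow> (\<exists>i \<in> step_ideal n. \<exists>j \<in> filt n. f = i + fps_X ^ e * j)"
proof
  assume f: "f \<in> filt (Suc n)"
  define j where "j = fps_const (fps_nth f (n + e)) * fps_X ^ n"
  have j: "j \<in> filt n" unfolding j_def using n by (intro filt_smult X_power_filt) auto
  have xj: "fps_X ^ e * j \<in> filt (Suc n)"
    using filt_mult[OF X_power_filt[OF mult_mem order_refl] j] filt_mono[of "Suc n" "e + n"] mult_pos
    by auto
  have "f - fps_X ^ e * j \<in> filt (Suc n)"
    using is_idealD(6)[OF is_ideal_filt f xj] .
  moreover have "fps_nth (f - fps_X ^ e * j) (n + e) = 0"
    by (simp add: j_def fps_X_power_mult_nth fps_X_power_nth)
  ultimately have "f - fps_X ^ e * j \<in> step_ideal n" by (simp add: step_ideal_def)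
  then show "\<exists>i \<in> step_ideal n. \<exists>j \<in> filt n. f = i + fps_X ^ e * j"
    using j by (intro bexI[of _ "f - fps_X ^ e * j"] bexI[of _ j]) auto
next
  assume "\<exists>i \<in> step_ideal n. \<exists>j \<in> filt n. f = i + fps_X ^ e * j"
  then obtain i j where *: "i \<in> step_ideal n" "j \<in> filt n" "f = i + fps_X ^ e * j" by blast
  have "fps_X ^ e * j \<in> filt (Suc n)"
    using filt_mult[OF X_power_filt[OF mult_mem order_refl] *(2)] filt_mono[of "Suc n" "e + n"] mult_pos
    by auto
  then show "f \<in> filt (Suc n)" using * by (auto simp: step_ideal_def intro: filt_add)
qed

text \<open>The ideal \<open>filt (Suc n)\<close> stands at both ends of the sequence, so
  \<open>filt n\<close> is a summand of a self-extension. The map \<open>?f\<close> is injective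
  already in its first component, and exactness in the middle is the colon identity.\<close>

lemma ideal_step_in:
  fixes emb :: "'k fps \<Rightarrow> 'm" and X :: "('k fps, 'm) module set"
  assumes emb: "inj emb" and X: "subcategory R X" "closed_extensions R X" "closed_summands R X"
    and F: "copies_in X (ideal_module (filt (Suc n)))"
  shows "copies_in X (ideal_module (filt n))"
proof (cases "n \<in> H")
  case False
  then show ?thesis using F by (simp add: filt_gap)
next
  case True
  let ?L = "ideal_module (filt (Suc n))" and ?A = "ideal_module (filt n)" and ?B = "ideal_module (step_ideal n)"
  let ?f = "\<lambda>r. (- r, fps_X ^ e * r)" and ?g = "\<lambda>(j, i). i + fps_X ^ e * j"
  have colon: "r \<in> filt n" "fps_X ^ e * r \<in> step_ideal n" if "r \<in> filt (Suc n)" for r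
    using step_ideal_colon[of r n] that by auto
  have ex: "short_exact R ?L ?f (mod_sum ?A ?B) ?g ?L"
    unfolding short_exact_def
  proof (intro conjI)
    show "?f \<in> mod_hom R ?L (mod_sum ?A ?B)"
      using colon is_idealD(5)[OF is_ideal_filt]
      by (auto simp: mod_hom_def mod_sum_def algebra_simps)
    show "?g \<in> mod_hom R (mod_sum ?A ?B) ?L"
      using step_ideal_sum[OF True] by (auto simp: mod_hom_def mod_sum_def algebra_simps)
    show "inj_on ?f (carrier ?L)" by (auto simp: inj_on_def)
    show "?f ` carrier ?L = {x \<in> carrier (mod_sum ?A ?B). ?g x = \<zero>\<^bsub>?L\<^esub>}"
    proof (intro equalityI subsetI)
      fix x assume "x \<in> ?f ` carrier ?L"
      then show "x \<in> {x \<in> carrier (mod_sum ?A ?B). ?g x = \<zero>\<^bsub>?L\<^esub>}"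
        using colon is_idealD(5)[OF is_ideal_filt] by (auto simp: mod_sum_def)
    next
      fix x assume "x \<in> {x \<in> carrier (mod_sum ?A ?B). ?g x = \<zero>\<^bsub>?L\<^esub>}"
      then obtain j i where x: "x = (j, i)" "j \<in> filt n" "i \<in> step_ideal n" "i + fps_X ^ e * j = 0"
        by (auto simp: mod_sum_def)
      have i: "i = fps_X ^ e * (- j)" using x(4) by (simp add: eq_neg_iff_add_eq_0)
      have "- j \<in> filt (Suc n)"
        using step_ideal_colon[of "- j" n] x(2,3) i is_idealD(5)[OF is_ideal_filt x(2)] by auto
      then show "x \<in> ?f ` carrier ?L" using x(1) i by (intro image_eqI[of _ _ "- j"]) auto
    qed
    show "?g ` carrier (mod_sum ?A ?B) = carrier ?L"
    proof (intro equalityI subsetI)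
      fix x assume "x \<in> carrier ?L"
      then obtain i j where "i \<in> step_ideal n" "j \<in> filt n" "x = i + fps_X ^ e * j"
        using step_ideal_sum[OF True, of x] by auto
      then show "x \<in> ?g ` carrier (mod_sum ?A ?B)"
        by (intro image_eqI[of _ _ "(j, i)"]) (auto simp: mod_sum_def)
    qed (use step_ideal_sum[OF True] in \<open>auto simp: mod_sum_def\<close>)
  qed
  show ?thesis
    by (rule summand_copies_in[OF emb X _ _ _ _ F F ex])
       (simp_all add: ideal_mod_cat is_ideal_filt is_ideal_step)
qed

text \<open>Describes \<open>R/I\<close> by a surjection from \<open>R\<close> with kernel
  \<open>I\<close> and not by cosets. This leaves the carrier type free and reduces the construction
  of maps to factoring.\<close>

definition cyclic :: "'k fps set \<Rightarrow> ('k fps, 'm) module \<Rightarrow> bool" where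
  "cyclic I M \<longleftrightarrow> M \<in> mod_cat R \<and> (\<exists>p \<in> mod_hom R (ideal_module (carrier R)) M.
     p ` carrier R = carrier M \<and> (\<forall>r\<in>carrier R. p r = \<zero>\<^bsub>M\<^esub> \<longleftrightarrow> r \<in> I))"

lemma cyclic_iso:
  assumes "cyclic I M" "cyclic I N"
  shows "mod_iso R M N"
proof -
  obtain p where p: "p \<in> mod_hom R (ideal_module (carrier R)) M" "p ` carrier R = carrier M"
    "\<And>r. r \<in> carrier R \<Longrightarrow> p r = \<zero>\<^bsub>M\<^esub> \<longleftrightarrow> r \<in> I" using assms(1) by (auto simp: cyclic_def)
  obtain q where q: "q \<in> mod_hom R (ideal_module (carrier R)) N" "q ` carrier R = carrier N"
    "\<And>r. r \<in> carrier R \<Longrightarrow> q r = \<zero>\<^bsub>N\<^esub> \<longleftrightarrow> r \<in> I" using assms(2) by (auto simp: cyclic_def)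
  have "M \<in> mod_cat R" "N \<in> mod_cat R" using assms by (auto simp: cyclic_def)
  note m = this[THEN mod_catD(1)]
  show ?thesis
    by (rule mod_iso_of_kernel[OF module_regular m p(1) _ q(1)]) (use p q in auto)
qed

lemma cyclic_quot_mod:
  assumes I: "is_ideal I"
  shows "cyclic I (quot_mod R I)"
proof -
  interpret R: cring R by (rule cring_R)
  have "ideal I R"
  proof (rule idealI)
    show "ring R" by (rule R.ring_axioms)
    show "subgroup I (add_monoid R)"
    proof (rule subgroup.intro)
      show "inv\<^bsub>add_monoid R\<^esub> x \<in> I" if x: "x \<in> I" for x
      proof -
        have "\<ominus>\<^bsub>R\<^esub> x = - x"
          using is_idealD(1,5)[OF I] x by (intro R.minus_equality) auto
        then show ?thesis using is_idealD(5)[OF I x] by (simp add: a_inv_def)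
      qed
    qed (use is_idealD[OF I] in auto)
  qed (metis is_idealD(4)[OF I] mult.commute ring_ops(1))+
  then interpret I: ideal I R .
  interpret Q: ring "R Quot I" by (rule I.quotient_is_ring)
  let ?p = "\<lambda>r. I +>\<^bsub>R\<^esub> r"
  have hom: "?p \<in> ring_hom R (R Quot I)" by (rule I.rcos_ring_hom)
  have p: "?p r \<in> carrier (R Quot I)" if "r \<in> carrier R" for r
    using ring_hom_closed[OF hom that] .
  have padd: "?p (r + s) = ?p r \<oplus>\<^bsub>R Quot I\<^esub> ?p s" and pmult: "?p (r * s) = ?p r \<otimes>\<^bsub>R Quot I\<^esub> ?p s"
    if "r \<in> carrier R" "s \<in> carrier R" for r s
    using ring_hom_add[OF hom that] ring_hom_mult[OF hom that] by simp_all
  have pone: "?p 1 = \<one>\<^bsub>R Quot I\<^esub>" using ring_hom_one[OF hom] by simp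
  let ?M = "quot_mod R I"
  have s: "carrier ?M = carrier (R Quot I)" "\<zero>\<^bsub>?M\<^esub> = \<zero>\<^bsub>R Quot I\<^esub>"
    "x \<oplus>\<^bsub>?M\<^esub> y = x \<oplus>\<^bsub>R Quot I\<^esub> y" "r \<odot>\<^bsub>?M\<^esub> x = ?p r \<otimes>\<^bsub>R Quot I\<^esub> x" for x y r
    by (simp_all add: quot_mod_def ring.extend_def)
  have M: "module R ?M"
  proof (intro moduleI abelian_groupI cring_R)
    fix x assume "x \<in> carrier ?M"
    then show "\<exists>y\<in>carrier ?M. y \<oplus>\<^bsub>?M\<^esub> x = \<zero>\<^bsub>?M\<^esub>"
      unfolding s by (intro bexI[of _ "\<ominus>\<^bsub>R Quot I\<^esub> x"]) (auto simp: Q.l_neg)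
  qed (auto simp: s p padd pmult pone Q.a_ac Q.l_distr Q.r_distr Q.m_assoc)
  have ph: "?p \<in> mod_hom R (ideal_module (carrier R)) ?M"
    by (rule mod_homI) (auto simp: s p padd pmult)
  have im: "?p ` carrier R = carrier ?M"
    by (auto simp: s FactRing_def A_RCOSETS_def' image_iff)
  have "?p r = \<zero>\<^bsub>?M\<^esub> \<longleftrightarrow> r \<in> I" if "r \<in> carrier R" for r
  proof -
    have "\<zero>\<^bsub>?M\<^esub> = I" by (simp add: s FactRing_def)
    moreover have "?p r = I \<longleftrightarrow> r \<in> I"
      using that I.a_rcos_const I.a_rcos_self[of r] by auto
    ultimately show ?thesis by simp
  qed
  moreover have "fin_gen R ?M"
    using fin_gen_surj[OF module_regular M ph] im mod_catD(2)[OF regular_mod_cat] by simp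
  ultimately show ?thesis using M ph im by (auto simp: cyclic_def mod_cat_def)
qed

lemma cyclic_exists:
  assumes I: "is_ideal I"
  obtains M :: "('k fps, 'k fps) module" where "cyclic I M"
proof -
  obtain p where p: "p \<in> mod_hom R (ideal_module (carrier R)) (quot_mod R I)"
    "p ` carrier R = carrier (quot_mod R I)" "\<And>r. r \<in> carrier R \<Longrightarrow> p r = \<zero>\<^bsub>quot_mod R I\<^esub> \<longleftrightarrow> r \<in> I"
    and M: "quot_mod R I \<in> mod_cat R"
    using cyclic_quot_mod[OF I] by (auto simp: cyclic_def)
  obtain N :: "('k fps, 'k fps) module" and g where N: "module R N" "mod_iso R (quot_mod R I) N"
    "g \<in> mod_hom R (ideal_module (carrier R)) N" "g ` carrier (ideal_module (carrier R)) = carrier N"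
    "\<And>x. x \<in> carrier (ideal_module (carrier R)) \<Longrightarrow> g x = \<zero>\<^bsub>N\<^esub> \<longleftrightarrow> p x = \<zero>\<^bsub>quot_mod R I\<^esub>"
    using quotient_transport[OF module_regular mod_catD(1)[OF M] p(1)] p(2) by auto
  have "fin_gen R N" using fin_gen_surj[OF module_regular N(1,3,4) mod_catD(2)[OF regular_mod_cat]] .
  then have "cyclic I N" using N p(3) by (auto simp: cyclic_def mod_cat_def)
  then show ?thesis by (rule that)
qed

text \<open>The counterpart of \<open>ideal_step_in\<close> for quotients. The modules are known
  only through their presentations, so the two maps are first written down on \<open>R\<close> and
  on \<open>R \<oplus> R\<close> and then factored; the colon identity and the sum identity say that
  they factor.\<close>

lemma cyclic_step_in:
  fixes emb :: "'k fps \<Rightarrow> 'm" and X :: "('k fps, 'm) module set"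
    and L A :: "('k fps, 'k fps) module"
  assumes emb: "inj emb" and X: "subcategory R X" "closed_extensions R X" "closed_summands R X"
    and L: "cyclic (filt (Suc n)) L" "copies_in X L" and A: "cyclic (filt n) A"
  shows "copies_in X A"
proof (cases "n \<in> H")
  case False
  then have "cyclic (filt n) L" using L(1) by (simp add: filt_gap)
  then show ?thesis
    using copies_in_iso[OF L(2) _ cyclic_iso[OF _ A]] by (auto simp: cyclic_def mod_cat_def)
next
  case True
  obtain B :: "('k fps, 'k fps) module" where B: "cyclic (step_ideal n) B"
    using cyclic_exists[OF is_ideal_step] .
  let ?R = "ideal_module (carrier R)"
  obtain p where p: "p \<in> mod_hom R ?R L" "p ` carrier R = carrier L"
    "\<And>r. r \<in> carrier R \<Longrightarrow> p r = \<zero>\<^bsub>L\<^esub> \<longleftrightarrow> r \<in> filt (Suc n)" using L(1) by (auto simp: cyclic_def)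
  obtain a where a: "a \<in> mod_hom R ?R A" "a ` carrier R = carrier A"
    "\<And>r. r \<in> carrier R \<Longrightarrow> a r = \<zero>\<^bsub>A\<^esub> \<longleftrightarrow> r \<in> filt n" using A by (auto simp: cyclic_def)
  obtain b where b: "b \<in> mod_hom R ?R B" "b ` carrier R = carrier B"
    "\<And>r. r \<in> carrier R \<Longrightarrow> b r = \<zero>\<^bsub>B\<^esub> \<longleftrightarrow> r \<in> step_ideal n" using B by (auto simp: cyclic_def)
  have c: "L \<in> mod_cat R" "A \<in> mod_cat R" "B \<in> mod_cat R" using L A B by (auto simp: cyclic_def)
  note m = c[THEN mod_catD(1)]
  note S = module_mod_sum[OF m(2,3)] and SR = module_mod_sum[OF module_regular module_regular]
  note pD = mod_homD[OF p(1)] and aD = mod_homD[OF a(1)] and bD = mod_homD[OF b(1)]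
  let ?x = "fps_X ^ e :: 'k fps"
  have x: "?x \<in> carrier R" using mult_mem by simp
  let ?h = "\<lambda>r. (a (- r), b (?x * r))"
  have h: "?h \<in> mod_hom R ?R (mod_sum A B)"
  proof (rule mod_homI)
    fix r s assume rs: "r \<in> carrier ?R" "s \<in> carrier ?R"
    then show "?h (r \<oplus>\<^bsub>?R\<^esub> s) = ?h r \<oplus>\<^bsub>mod_sum A B\<^esub> ?h s"
      using aD(2)[of "- r" "- s"] bD(2)[of "?x * r" "?x * s"] x
      by (simp add: mod_sum_def algebra_simps)
  next
    fix t r assume "t \<in> carrier R" "r \<in> carrier ?R"
    then show "?h (t \<odot>\<^bsub>?R\<^esub> r) = t \<odot>\<^bsub>mod_sum A B\<^esub> ?h r"
      using aD(3)[of t "- r"] bD(3)[of t "?x * r"] x by (simp add: mod_sum_def algebra_simps)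
  qed (use aD(1) bD(1) x in \<open>auto simp: mod_sum_def\<close>)
  have hker: "?h r = \<zero>\<^bsub>mod_sum A B\<^esub> \<longleftrightarrow> p r = \<zero>\<^bsub>L\<^esub>" if r: "r \<in> carrier R" for r
  proof -
    have "- r \<in> filt n \<longleftrightarrow> r \<in> filt n" using is_idealD(5)[OF is_ideal_filt] by (metis minus_minus)
    then show ?thesis
      using a(3)[of "- r"] b(3)[of "?x * r"] p(3)[OF r] x r step_ideal_colon[OF r]
      by (simp add: mod_sum_def)
  qed
  obtain f where f: "f \<in> mod_hom R L (mod_sum A B)" "\<And>r. r \<in> carrier R \<Longrightarrow> f (p r) = ?h r"
    using factor_through[OF module_regular m(1) S p(1) _ h] p(2) hker by (metis ideal_module_simps(1))
  let ?q = "map_prod a b" and ?k = "\<lambda>(u, v). p (v + ?x * u)"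
  have q: "?q \<in> mod_hom R (mod_sum ?R ?R) (mod_sum A B)"
    by (rule mod_homI) (use aD bD in \<open>auto simp: mod_sum_def\<close>)
  have qs: "?q ` carrier (mod_sum ?R ?R) = carrier (mod_sum A B)"
    using a(2) b(2) by (simp add: mod_sum_def map_prod_surj_on)
  have k: "?k \<in> mod_hom R (mod_sum ?R ?R) L"
  proof (rule mod_homI)
    fix y z assume "y \<in> carrier (mod_sum ?R ?R)" "z \<in> carrier (mod_sum ?R ?R)"
    then show "?k (y \<oplus>\<^bsub>mod_sum ?R ?R\<^esub> z) = ?k y \<oplus>\<^bsub>L\<^esub> ?k z"
      using pD(2)[of "snd y + ?x * fst y" "snd z + ?x * fst z"] x
      by (auto simp: mod_sum_def algebra_simps)
  next
    fix t y assume "t \<in> carrier R" "y \<in> carrier (mod_sum ?R ?R)"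
    then show "?k (t \<odot>\<^bsub>mod_sum ?R ?R\<^esub> y) = t \<odot>\<^bsub>L\<^esub> ?k y"
      using pD(3)[of t "snd y + ?x * fst y"] x by (auto simp: mod_sum_def algebra_simps)
  qed (use pD(1) x in \<open>auto simp: mod_sum_def\<close>)
  have kker: "?k y = \<zero>\<^bsub>L\<^esub>" if yk: "y \<in> carrier (mod_sum ?R ?R)" "?q y = \<zero>\<^bsub>mod_sum A B\<^esub>" for y
  proof -
    obtain u v where y: "y = (u, v)" "u \<in> carrier R" "v \<in> carrier R" using yk(1) by (auto simp: mod_sum_def)
    then have "u \<in> filt n" "v \<in> step_ideal n" using yk(2) a(3) b(3) by (auto simp: mod_sum_def)
    then show ?thesis using step_ideal_sum[OF True, of "v + ?x * u"] p(3) y x by auto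
  qed
  obtain g where g: "g \<in> mod_hom R (mod_sum A B) L"
    "\<And>y. y \<in> carrier (mod_sum ?R ?R) \<Longrightarrow> g (?q y) = ?k y"
    using factor_through[OF SR S m(1) q qs k kker] by blast
  have gab: "g (a u, b v) = p (v + ?x * u)" if "u \<in> carrier R" "v \<in> carrier R" for u v
    using g(2)[of "(u, v)"] that by (simp add: mod_sum_def)
  have ex: "short_exact R L f (mod_sum A B) g L"
    unfolding short_exact_def
  proof (intro conjI f(1) g(1))
    have "\<forall>y\<in>carrier L. f y = \<zero>\<^bsub>mod_sum A B\<^esub> \<longrightarrow> y = \<zero>\<^bsub>L\<^esub>"
      unfolding p(2)[symmetric] using f(2) hker by simp
    then show "inj_on f (carrier L)" using mod_hom_inj_iff[OF m(1) S f(1)] by simp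
    show "f ` carrier L = {y \<in> carrier (mod_sum A B). g y = \<zero>\<^bsub>L\<^esub>}"
    proof (intro equalityI subsetI)
      fix y assume "y \<in> f ` carrier L"
      then obtain r where r: "r \<in> carrier R" "y = ?h r" unfolding p(2)[symmetric] using f(2) by auto
      have "g y = p (?x * r + ?x * (- r))" using gab[of "- r" "?x * r"] r x by simp
      then have "g y = \<zero>\<^bsub>L\<^esub>" using p(3)[of 0] by simp
      then show "y \<in> {y \<in> carrier (mod_sum A B). g y = \<zero>\<^bsub>L\<^esub>}"
        using r mod_homD(1)[OF h] by simp
    next
      fix y assume y: "y \<in> {y \<in> carrier (mod_sum A B). g y = \<zero>\<^bsub>L\<^esub>}"
      then obtain u v where uv: "u \<in> carrier R" "v \<in> carrier R" "y = (a u, b v)"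
        by (auto simp: mod_sum_def a(2)[symmetric] b(2)[symmetric])
      have "v + ?x * u \<in> filt (Suc n)" using y uv gab p(3) x by auto
      then obtain i j where ij: "i \<in> step_ideal n" "j \<in> filt n" "v + ?x * u = i + ?x * j"
        using step_ideal_sum[OF True] by blast
      have iR: "i \<in> carrier R" using ij(1) by (auto simp: step_ideal_def)
      have jR: "j \<in> carrier R" using ij(2) by simp
      \<comment> \<open>Changing \<open>u\<close> by \<open>j \<in> filt n\<close> and
        \<open>v\<close> by \<open>i \<in> step_ideal n\<close> does not alter their classes, and
        the corrected pair is the one that \<open>?h\<close> assigns to
        \<open>j - u\<close>.\<close>
      have v: "v = ?x * (j - u) + i" using ij(3) by (simp add: algebra_simps)
      have "a u = a (- (j - u) + j)" by simp
      also have "\<dots> = a (- (j - u)) \<oplus>\<^bsub>A\<^esub> a j" using aD(2)[of "- (j - u)" j] jR uv by simp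
      also have "\<dots> = a (- (j - u))"
      proof -
        interpret A: module R A by (rule m(2))
        show ?thesis using a(3)[OF jR] ij(2) aD(1)[of "- (j - u)"] jR uv by simp
      qed
      finally have 1: "a u = a (- (j - u))" .
      have "b v = b (?x * (j - u)) \<oplus>\<^bsub>B\<^esub> b i" using bD(2)[of "?x * (j - u)" i] iR jR uv x v by simp
      also have "\<dots> = b (?x * (j - u))"
      proof -
        interpret B: module R B by (rule m(3))
        show ?thesis using b(3)[OF iR] ij(1) bD(1)[of "?x * (j - u)"] jR uv x by simp
      qed
      finally have "y = ?h (j - u)" using 1 uv by simp
      then have "y = f (p (j - u))" using f(2)[of "j - u"] jR uv by simp
      then show "y \<in> f ` carrier L" using pD(1)[of "j - u"] jR uv by auto
    qed
    show "g ` carrier (mod_sum A B) = carrier L"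
    proof (intro equalityI subsetI)
      fix y assume "y \<in> carrier L"
      then obtain r where r: "r \<in> carrier R" "y = p r" using p(2) by auto
      then have "y = g (a 0, b r)" using gab[of 0 r] by simp
      moreover have "(a 0, b r) \<in> carrier (mod_sum A B)" using r aD(1) bD(1) by (simp add: mod_sum_def)
      ultimately show "y \<in> g ` carrier (mod_sum A B)" by blast
    qed (use mod_homD(1)[OF g(1)] in auto)
  qed
  show ?thesis by (rule summand_copies_in[OF emb X c(2,3,1,1) L(2) L(2) ex])
qed

text \<open>If \<open>f\<close> of order \<open>d\<close> multiplies all series into
  \<open>R\<close>, its products with powers of \<open>t\<close> attain every order from
  \<open>d\<close> on; so \<open>H\<close> has no gap there and \<open>c \<le> d\<close> by
  minimality. Conversely, multiplying an element of \<open>filt c\<close> by any series keeps the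
  order at least \<open>c\<close>.\<close>

lemma conductor_eq:
  assumes "\<And>d. (\<forall>n\<ge>d. n \<in> H) \<Longrightarrow> c \<le> d"
  shows "conductor H = filt c"
proof (intro equalityI subsetI)
  fix f :: "'k fps" assume "f \<in> conductor H"
  then have *: "\<exists>g\<in>carrier R. fps_to_fls f * fps_to_fls s = fps_to_fls g" for s
    by (auto simp: conductor_def R_eq)
  have mem: "f * s \<in> carrier R" for s
  proof -
    obtain g where "g \<in> carrier R" "fps_to_fls (f * s) = fps_to_fls g"
      using *[of s] by (auto simp: fls_times_fps_to_fls)
    then show ?thesis by simp
  qed
  show "f \<in> filt c"
  proof (cases "f = 0")
    case False
    have "n \<in> H" if "subdegree f \<le> n" for n
    proof (rule ccontr)
      assume "n \<notin> H"
      then have "fps_nth (f * fps_X ^ (n - subdegree f)) n = 0" using mem carrier_iff by blast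
      then show False using False that
        by (auto simp: fps_X_power_mult_right_nth diff_diff_cancel split: if_splits)
    qed
    then have "c \<le> subdegree f" using assms by blast
    then show ?thesis using mem[of 1] filt_subdegree by simp
  qed simp
next
  fix f assume f: "f \<in> filt c"
  have "f * s \<in> carrier R" for s
  proof -
    have "fps_nth (f * s) i = 0" if "i < c" for i
      using that filt_nth[OF f] by (auto simp: fps_mult_nth intro!: sum.neutral)
    then show ?thesis using filt_conductor[of c "f * s"] by simp
  qed
  then have "fps_to_fls f * fps_to_fls s \<in> fps_to_fls ` carrier (sg_ring H)" for s
    by (simp add: fls_times_fps_to_fls[symmetric] R_eq)
  moreover have "fps_to_fls f \<in> sg_frac H"
    using f unfolding sg_frac_def R_eq[symmetric]
    by (intro CollectI exI[of _ f] exI[of _ 1]) auto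
  ultimately show "f \<in> conductor H" by (simp add: conductor_def)
qed

lemma cyclic_residue: "cyclic (filt 1) residue_module"
proof -
  have sub: "submodule (range fls_const) R (fls_module residue_map UNIV)"
    unfolding submodule_iff[OF module_fls_UNIV[OF ring_map_residue]]
    by (auto simp: residue_map_def fls_plus_const fls_const_mult_const image_iff
        intro: fls_const_0[symmetric])
  note M = module_fls[OF ring_map_residue sub]
  have hom: "residue_map \<in> mod_hom R (ideal_module (carrier R)) residue_module"
    using ring_mapD[OF ring_map_residue] by (auto simp: mod_hom_def residue_map_def)
  have im: "residue_map ` carrier R = range fls_const"
  proof (intro equalityI subsetI)
    fix x :: "'k fls" assume "x \<in> range fls_const"
    then obtain a where "x = residue_map (fps_const a)" by (auto simp: residue_map_def)
    then show "x \<in> residue_map ` carrier R" using const_closed by blast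
  qed (auto simp: residue_map_def)
  have "residue_map r = 0 \<longleftrightarrow> r \<in> filt 1" if "r \<in> carrier R" for r
    using that filt_1I[of r] filt_nth[of r 1 0] by (auto simp: residue_map_def)
  moreover have "residue_module \<in> mod_cat R"
    using M fin_gen_surj[OF module_regular M hom _ mod_catD(2)[OF regular_mod_cat]] im
    by (simp add: mod_cat_def)
  ultimately show ?thesis using hom im by (auto simp: cyclic_def)
qed

section \<open>Building modules of finite length\<close>

text \<open>A zero module \<open>Z\<close> is a summand of every \<open>M\<close>, as
  \<open>M\<close> is isomorphic to \<open>Z \<oplus> M\<close>.\<close>

lemma summands_zero:
  fixes X :: "('k fps, 'm) module set"
  assumes X: "subcategory R X" "closed_summands R X"
  shows "zero_cat R \<subseteq> X"
proof
  fix Z :: "('k fps, 'm) module" assume "Z \<in> zero_cat R"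
  then have Z: "Z \<in> mod_cat R" "carrier Z = {\<zero>\<^bsub>Z\<^esub>}" by (auto simp: zero_cat_def)
  obtain M where M: "M \<in> X" "M \<in> mod_cat R" using X(1) by (auto simp: subcategory_def)
  interpret Z: module R Z by (rule mod_catD(1)[OF Z(1)])
  have "(\<lambda>x. (\<zero>\<^bsub>Z\<^esub>, x)) \<in> mod_hom R M (mod_sum Z M)"
    by (auto simp: mod_hom_def mod_sum_def)
  moreover have "bij_betw (\<lambda>x. (\<zero>\<^bsub>Z\<^esub>, x)) (carrier M) (carrier (mod_sum Z M))"
    using Z(2) by (auto simp: bij_betw_def inj_on_def mod_sum_def)
  ultimately have "mod_iso R M (mod_sum Z M)" by (auto simp: mod_iso_def)
  then show "Z \<in> X" using X(2) M Z(1) unfolding closed_summands_def by blast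
qed

text \<open>The descent by \<open>cyclic_step_in\<close> starts at the conductor
  \<open>filt c\<close> and has to end at \<open>filt 1\<close>, where the quotient is the residue
  field; this is possible because \<open>1 \<le> c\<close>. Closure under extensions does the
  rest.\<close>

lemma built_from_conductor:
  fixes emb :: "'k fps \<Rightarrow> 'm" and N :: "('k fps, 'm) module"
  assumes emb: "inj emb" and c: "\<And>d. (\<forall>n\<ge>d. n \<in> H) \<Longrightarrow> c \<le> d" "1 \<le> c"
    and N: "module R N" "finite_length R N"
  shows "N \<in> built_from R (quot_mod R (conductor H))"
  unfolding built_from_def
proof (rule InterI)
  fix X :: "('k fps, 'm) module set"
  assume "X \<in> {X. subcategory R X \<and> {N \<in> mod_cat R. mod_iso R (quot_mod R (conductor H)) N} \<subseteq> X \<and>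
     closed_summands R X \<and> closed_extensions R X}"
  then have X: "subcategory R X" "closed_extensions R X" "closed_summands R X"
    and q: "{N \<in> mod_cat R. mod_iso R (quot_mod R (conductor H)) N} \<subseteq> X" by auto
  have Q: "cyclic (filt c) (quot_mod R (conductor H))"
    using cyclic_quot_mod[OF is_ideal_filt, of c] conductor_eq[OF c(1)] by simp
  have "\<forall>A :: ('k fps, 'k fps) module. cyclic (filt 1) A \<longrightarrow> copies_in X A"
    using c(2)
  proof (induction rule: inc_induct)
    case base
    show ?case
    proof (intro allI impI)
      fix A :: "('k fps, 'k fps) module" assume "cyclic (filt c) A"
      from cyclic_iso[OF Q this] show "copies_in X A"
        using q mod_iso_trans unfolding copies_in_def by blast
    qed
  next
    case (step n)
    obtain L :: "('k fps, 'k fps) module" where "cyclic (filt (Suc n)) L"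
      using cyclic_exists[OF is_ideal_filt] .
    then show ?case using cyclic_step_in[OF emb X] step.IH by blast
  qed
  moreover obtain A :: "('k fps, 'k fps) module" where A: "cyclic (filt 1) A"
    using cyclic_exists[OF is_ideal_filt] .
  ultimately have A': "copies_in X A" by blast
  have res: "copies_in X residue_module"
    using copies_in_iso[OF A' _ cyclic_iso[OF A cyclic_residue]] A
    by (auto simp: cyclic_def mod_cat_def)
  show "N \<in> X"
  proof (rule torsion_in[OF X(2) summands_zero[OF X(1,3)]])
    show "N \<in> mod_cat R" "torsion N" using finite_lengthD[OF N] N(1) by (simp_all add: mod_cat_def)
  qed (use res in \<open>simp add: copies_in_def\<close>)
qed

section \<open>IKE-closed subcategories\<close>

lemma IKE_D:
  assumes "IKE_closed R X"
  shows "subcategory R X" "closed_extensions R X" "X \<subseteq> mod_cat R"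
    "\<And>M N f. M \<in> X \<Longrightarrow> N \<in> X \<Longrightarrow> f \<in> mod_hom R M N \<Longrightarrow> mod_image M N f \<in> X"
    "\<And>M N f. M \<in> X \<Longrightarrow> N \<in> X \<Longrightarrow> f \<in> mod_hom R M N \<Longrightarrow> mod_kernel M N f \<in> X"
    "\<And>M N. M \<in> X \<Longrightarrow> N \<in> mod_cat R \<Longrightarrow> mod_iso R M N \<Longrightarrow> N \<in> X"
  using assms unfolding IKE_closed_def subcategory_def closed_images_def closed_kernels_def by blast+

text \<open>A summand is the image of the idempotent endomorphism that projects onto it. This makes
  the descent of ideals, which needs summands, available in \<open>X\<close>.\<close>

lemma IKE_closed_summands:
  fixes X :: "('k fps, 'm) module set"
  assumes X: "IKE_closed R X"
  shows "closed_summands R X"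
  unfolding closed_summands_def
proof (intro ballI impI)
  fix M A B :: "('k fps, 'm) module"
  assume M: "M \<in> X" and AB: "A \<in> mod_cat R" "B \<in> mod_cat R" and iso: "mod_iso R M (mod_sum A B)"
  note D = IKE_D[OF X]
  note m = mod_catD(1)[OF subsetD[OF D(3) M]] mod_catD(1)[OF AB(1)] mod_catD(1)[OF AB(2)]
  interpret A: module R A by (rule m(2))
  interpret B: module R B by (rule m(3))
  obtain h where h: "h \<in> mod_hom R M (mod_sum A B)" "bij_betw h (carrier M) (carrier (mod_sum A B))"
    using iso by (auto simp: mod_iso_def)
  obtain k where k: "k \<in> mod_hom R (mod_sum A B) M" "bij_betw k (carrier (mod_sum A B)) (carrier M)"
    using mod_iso_sym[OF m(1) iso] by (auto simp: mod_iso_def)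
  let ?i = "\<lambda>x. (x, \<zero>\<^bsub>B\<^esub>)"
  let ?e = "\<lambda>y. ?i (fst y)"
  have i: "?i \<in> mod_hom R A (mod_sum A B)" and e: "?e \<in> mod_hom R (mod_sum A B) (mod_sum A B)"
    by (auto simp: mod_hom_def mod_sum_def)
  let ?f = "k \<circ> (?e \<circ> h)"
  have f: "?f \<in> mod_hom R M M" using mod_hom_comp[OF mod_hom_comp[OF h(1) e] k(1)] .
  have "?f ` carrier M = k ` (?e ` (h ` carrier M))" by (simp add: image_comp)
  also have "h ` carrier M = carrier (mod_sum A B)" using h(2) by (simp add: bij_betw_def)
  also have "?e ` carrier (mod_sum A B) = ?i ` carrier A"
    using B.M.zero_closed by (force simp: mod_sum_def image_iff)
  finally have im: "?f ` carrier M = (k \<circ> ?i) ` carrier A" by (simp add: image_comp)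
  have "?i ` carrier A \<subseteq> carrier (mod_sum A B)" by (auto simp: mod_sum_def)
  then have "inj_on k (?i ` carrier A)" using k(2) inj_on_subset unfolding bij_betw_def by blast
  moreover have "inj_on ?i (carrier A)" by (auto simp: inj_on_def)
  ultimately have inj: "inj_on (k \<circ> ?i) (carrier A)" by (intro comp_inj_on)
  have "k \<circ> ?i \<in> mod_hom R A (mod_image M M ?f)"
    using mod_hom_comp[OF i k(1)] im unfolding mod_hom_def mod_image_def by auto
  moreover have "carrier (mod_image M M ?f) = (k \<circ> ?i) ` carrier A"
    unfolding im[symmetric] by (simp add: mod_image_def)
  ultimately have "mod_iso R A (mod_image M M ?f)"
    unfolding mod_iso_def bij_betw_def using inj by blast
  then show "A \<in> X" using D(4)[OF M M f] D(6)[OF _ AB(1)] mod_iso_sym[OF m(2)] by blast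
qed

text \<open>Each further condition is the kernel of multiplication by \<open>fps_X ^ h\<close> on
  the submodule already reached, so only endomorphisms of members of \<open>X\<close> occur.\<close>

lemma IKE_annihilated_part:
  fixes M (structure)
  assumes X: "IKE_closed R X" and M: "M \<in> X" and "finite G" "G \<subseteq> H"
  shows "M\<lparr>carrier := {x \<in> carrier M. \<forall>h\<in>G. fps_X ^ h \<odot> x = \<zero>}\<rparr> \<in> X"
  using assms(3,4)
proof (induction G)
  case empty
  then show ?case using M by simp
next
  case (insert h G)
  let ?K = "M\<lparr>carrier := {x \<in> carrier M. \<forall>h\<in>G. fps_X ^ h \<odot> x = \<zero>}\<rparr>"
  have K: "?K \<in> X" using insert by simp
  note D = IKE_D[OF X]
  have "(\<lambda>x. fps_X ^ h \<odot>\<^bsub>?K\<^esub> x) \<in> mod_hom R ?K ?K"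
    using insert.prems K D(3) by (intro smult_hom mod_catD) auto
  note kernel = D(5)[OF K K this]
  have "{x \<in> carrier ?K. fps_X ^ h \<odot>\<^bsub>?K\<^esub> x = \<zero>\<^bsub>?K\<^esub>} =
      {x \<in> carrier M. \<forall>h\<in>insert h G. fps_X ^ h \<odot> x = \<zero>}" by auto
  from kernel[unfolded mod_kernel_def this] show ?case by simp
qed

text \<open>Take \<open>n\<close> such that \<open>filt n\<close> does not kill \<open>x\<close> but
  \<open>filt (Suc n)\<close> does. Then \<open>n \<in> H\<close>, since the filtration does not
  jump at gaps, and \<open>fps_X ^ n \<odot> x\<close> is nonzero and killed by the maximal
  ideal.\<close>

lemma socle_element:
  fixes M (structure)
  assumes M: "module R M" and x: "x \<in> carrier M" "x \<noteq> \<zero>"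
    and r: "r \<in> carrier R" "r \<noteq> 0" "r \<odot> x = \<zero>"
  obtains y where "y \<in> carrier M" "y \<noteq> \<zero>" "\<And>s. s \<in> filt 1 \<Longrightarrow> s \<odot> y = \<zero>"
proof -
  interpret module R M by (rule M)
  define P where "P n \<longleftrightarrow> (\<forall>s\<in>filt n. s \<odot> x = \<zero>)" for n
  have "P (c + subdegree r)" using filt_annihilates[OF M x(1) r] by (simp add: P_def)
  moreover have "\<not> P 0" using x smult_1[OF M x(1)] by (auto simp: P_def filt_0 intro!: bexI[of _ 1])
  ultimately obtain n where n: "\<not> P n" "P (Suc n)"
    using dec_induct[of 0 "c + subdegree r" "\<lambda>n. \<not> P n"] by blast
  have nH: "n \<in> H" using n filt_gap by (auto simp: P_def)
  let ?y = "fps_X ^ n \<odot> x"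
  note Xn = X_power_closed[OF nH]
  show ?thesis
  proof (rule that)
    show "?y \<in> carrier M" using Xn x by simp
    show "s \<odot> ?y = \<zero>" if s: "s \<in> filt 1" for s
    proof -
      show ?thesis using n(2) filt_1_X_power[OF s nH] smult_mult[OF M filt_closed[OF s] Xn x(1)] by (simp add: P_def)
    qed
    show "?y \<noteq> \<zero>"
    proof
      assume y: "?y = \<zero>"
      have "s \<odot> x = \<zero>" if "s \<in> filt n" for s
        using killed_by_filt[OF M x(1) nH y _ that] n(2) by (simp add: P_def)
      then show False using n(1) by (simp add: P_def)
    qed
  qed
qed

text \<open>The socle is cut out by finitely many kernels, so it lies in \<open>X\<close>. It is a
  nonzero vector space over \<open>k\<close>; a functional on it is composed with the inclusion of a
  line, because the image of an endomorphism stays in \<open>X\<close>.\<close>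

lemma IKE_residue:
  fixes X :: "('k fps, 'm) module set"
    and M (structure)
  assumes X: "IKE_closed R X" and M: "M \<in> X" and x: "x \<in> carrier M" "x \<noteq> \<zero>"
    and r: "r \<in> carrier R" "r \<noteq> 0" "r \<odot> x = \<zero>"
  shows "copies_in X residue_module"
proof -
  note D = IKE_D[OF X]
  note Mm = mod_catD(1)[OF subsetD[OF D(3) M]]
  obtain y where y: "y \<in> carrier M" "y \<noteq> \<zero>" "\<And>s. s \<in> filt 1 \<Longrightarrow> s \<odot> y = \<zero>"
    using socle_element[OF Mm x r] by metis
  \<comment> \<open>Finitely many monomials suffice: every element of \<open>filt (c + e)\<close> is
    \<open>fps_X ^ e\<close> times an element of \<open>filt c\<close>, and the orders below are
    handled one at a time.\<close>
  define G where "G = {h \<in> H. 0 < h \<and> h \<le> c + e}"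
  define V where "V = M\<lparr>carrier := {x \<in> carrier M. \<forall>h\<in>G. fps_X ^ h \<odot> x = \<zero>}\<rparr>"
  have V: "V \<in> X" unfolding V_def
    by (rule IKE_annihilated_part[OF X M]) (auto simp: G_def)
  note Vm = mod_catD[OF subsetD[OF D(3) V]]
  interpret V: module R V by (rule Vm(1))
  have yV: "y \<in> carrier V" "y \<noteq> \<zero>\<^bsub>V\<^esub>" using y by (auto simp: V_def G_def X_power_filt)
  have kill: "s \<odot>\<^bsub>V\<^esub> z = \<zero>\<^bsub>V\<^esub>" if z: "z \<in> carrier V" and "s \<in> filt 1" for s z
  proof -
    have zG: "fps_X ^ h \<odot>\<^bsub>V\<^esub> z = \<zero>\<^bsub>V\<^esub>" if "h \<in> G" for h using z that by (simp add: V_def)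
    have "\<forall>s \<in> filt 1. s \<odot>\<^bsub>V\<^esub> z = \<zero>\<^bsub>V\<^esub>"
    proof (rule inc_induct[of 1 "c + e"])
      show "1 \<le> c + e" using mult_pos by simp
      show "\<forall>s \<in> filt (c + e). s \<odot>\<^bsub>V\<^esub> z = \<zero>\<^bsub>V\<^esub>"
      proof
        fix s assume "s \<in> filt (c + e)"
        then obtain g where g: "g \<in> filt c" "s = fps_X ^ e * g"
          using filt_principal[of "fps_X ^ e" s c] by auto
        have "s \<odot>\<^bsub>V\<^esub> z = g \<odot>\<^bsub>V\<^esub> (fps_X ^ e \<odot>\<^bsub>V\<^esub> z)"
          using smult_mult[OF Vm(1) filt_closed[OF g(1)] X_power_closed[OF mult_mem] z]
          by (simp add: g(2) mult.commute)
        moreover have "e \<in> G" using mult_mem mult_pos by (simp add: G_def)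
        ultimately show "s \<odot>\<^bsub>V\<^esub> z = \<zero>\<^bsub>V\<^esub>" using zG smult_zero[OF Vm(1) filt_closed[OF g(1)]] by simp
      qed
      fix n assume n: "1 \<le> n" "n < c + e" and IH: "\<forall>s \<in> filt (Suc n). s \<odot>\<^bsub>V\<^esub> z = \<zero>\<^bsub>V\<^esub>"
      show "\<forall>s \<in> filt n. s \<odot>\<^bsub>V\<^esub> z = \<zero>\<^bsub>V\<^esub>"
      proof (cases "n \<in> H")
        case False
        then show ?thesis using IH by (simp add: filt_gap)
      next
        case True
        have "fps_X ^ n \<odot>\<^bsub>V\<^esub> z = \<zero>\<^bsub>V\<^esub>" using True n by (intro zG) (simp add: G_def)
        then show ?thesis using killed_by_filt[OF Vm(1) z True] IH by blast
      qed
    qed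
    then show ?thesis using that(2) by blast
  qed
  have ff: "faithful residue_map V" using faithful_residue[OF Vm(1)] kill by blast
  have nz: "carrier V \<noteq> {\<zero>\<^bsub>V\<^esub>}" using yV by auto
  obtain \<phi> a where a: "a \<in> carrier V" and \<phi>: "\<phi> \<in> mod_hom R V (fls_module residue_map UNIV)" "\<phi> a = 1"
    "\<And>x. x \<in> carrier V \<Longrightarrow> \<exists>b\<in>carrier R. \<exists>r\<in>carrier R. residue_map r \<noteq> 0 \<and> \<phi> x = residue_map b / residue_map r"
    using nonzero_functional[OF Vm ring_map_residue ff nz] by metis
  \<comment> \<open>All values of \<open>\<phi>\<close> are quotients of constants, hence constants;
    \<open>v\<close> reads them as elements of \<open>k\<close>.\<close>
  define v where "v z = fls_nth (\<phi> z) 0" for z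
  have v: "\<phi> z = fls_const (v z)" if z: "z \<in> carrier V" for z
  proof -
    obtain b r where "\<phi> z = residue_map b / residue_map r" using \<phi>(3)[OF z] by blast
    then show ?thesis by (simp add: residue_map_def fls_const_divide_const v_def)
  qed
  note \<phi>D = mod_homD[OF \<phi>(1)]
  have a0: "a \<noteq> \<zero>\<^bsub>V\<^esub>"
    using \<phi>(2) mod_hom_zero[OF Vm(1) module_fls_UNIV[OF ring_map_residue] \<phi>(1)] by auto
  have sa: "s \<odot>\<^bsub>V\<^esub> a = fps_const (fps_nth s 0) \<odot>\<^bsub>V\<^esub> a" if s: "s \<in> carrier R" for s
  proof -
    have d: "s - fps_const (fps_nth s 0) \<in> filt 1" using s by (intro filt_1I) auto
    have "s = fps_const (fps_nth s 0) + (s - fps_const (fps_nth s 0))" by simp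
    then have "s \<odot>\<^bsub>V\<^esub> a = (fps_const (fps_nth s 0) + (s - fps_const (fps_nth s 0))) \<odot>\<^bsub>V\<^esub> a" by simp
    also have "\<dots> = fps_const (fps_nth s 0) \<odot>\<^bsub>V\<^esub> a"
      unfolding smult_add[OF Vm(1) const_closed filt_closed[OF d] a] kill[OF a d] using a by simp
    finally show ?thesis .
  qed
  \<comment> \<open>An endomorphism of rank one with the same kernel as \<open>\<phi>\<close>; its
    image is the line through \<open>a\<close>.\<close>
  define p where "p z = fps_const (v z) \<odot>\<^bsub>V\<^esub> a" for z
  have p: "p \<in> mod_hom R V V"
  proof (rule mod_homI)
    show "p z \<in> carrier V" if "z \<in> carrier V" for z using a by (simp add: p_def)
    fix z w assume z: "z \<in> carrier V" and w: "w \<in> carrier V"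
    have "v (z \<oplus>\<^bsub>V\<^esub> w) = v z + v w" using \<phi>D(2)[OF z w] by (simp add: v_def)
    then have "p (z \<oplus>\<^bsub>V\<^esub> w) = (fps_const (v z) + fps_const (v w)) \<odot>\<^bsub>V\<^esub> a" by (simp add: p_def)
    then show "p (z \<oplus>\<^bsub>V\<^esub> w) = p z \<oplus>\<^bsub>V\<^esub> p w"
      unfolding p_def using smult_add[OF Vm(1) const_closed const_closed a] by simp
  next
    fix s z assume s: "s \<in> carrier R" and z: "z \<in> carrier V"
    have "v (s \<odot>\<^bsub>V\<^esub> z) = fps_nth s 0 * v z"
      using \<phi>D(3)[OF s z] v[OF z] by (simp add: v_def[of "s \<odot>\<^bsub>V\<^esub> z"] residue_map_def fls_const_mult_const)
    then have "p (s \<odot>\<^bsub>V\<^esub> z) = (s * fps_const (v z)) \<odot>\<^bsub>V\<^esub> a"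
      using sa[of "s * fps_const (v z)"] s by (simp add: p_def)
    then show "p (s \<odot>\<^bsub>V\<^esub> z) = s \<odot>\<^bsub>V\<^esub> p z"
      unfolding p_def using smult_mult[OF Vm(1) s const_closed a] by simp
  qed
  note pX = D(4)[OF V V p]
  note res = cyclic_residue[unfolded cyclic_def, THEN conjunct1]
  have pker: "p z = \<zero>\<^bsub>V\<^esub> \<longleftrightarrow> \<phi> z = 0" if z: "z \<in> carrier V" for z
    using ff a a0 v[OF z] unfolding p_def faithful_def by (simp add: residue_map_def)
  have h: "\<phi> \<in> mod_hom R V residue_module"
    using \<phi>D v by (intro mod_homI) auto
  have surj: "\<phi> ` carrier V = carrier residue_module"
  proof (intro equalityI subsetI)
    fix q assume "q \<in> carrier residue_module"
    then obtain \<alpha> where "q = fls_const \<alpha>" by auto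
    then have "\<phi> (fps_const \<alpha> \<odot>\<^bsub>V\<^esub> a) = q" using \<phi>D(3)[OF const_closed a] \<phi>(2) by (simp add: residue_map_def)
    moreover have "fps_const \<alpha> \<odot>\<^bsub>V\<^esub> a \<in> carrier V" using a by simp
    ultimately show "q \<in> \<phi> ` carrier V" by blast
  qed (use v in auto)
  have "mod_iso R residue_module (mod_image V V p)"
    by (rule mod_iso_of_kernel[OF Vm(1) mod_catD(1)[OF res] module_image[OF Vm(1) Vm(1) p] h surj mod_hom_to_image[OF p]])
       (auto simp: mod_image_def pker)
  then show ?thesis using copies_inI[OF D(1) mod_catD(1)[OF res] pX] by blast
qed

text \<open>The sum is the image of \<open>I \<oplus> J\<close> under addition. Closure under images
  asks for a target in \<open>X\<close> as well, and the common overideal \<open>K\<close> provides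
  it.\<close>

lemma ideal_sum_in:
  fixes emb :: "'k fps \<Rightarrow> 'm" and X :: "('k fps, 'm) module set"
  assumes emb: "inj emb" and X: "IKE_closed R X"
    and IJ: "is_ideal I" "is_ideal J" "is_ideal K" "I \<subseteq> K" "J \<subseteq> K"
    and c: "copies_in X (ideal_module I)" "copies_in X (ideal_module J)" "copies_in X (ideal_module K)"
  shows "is_ideal {i + j | i j. i \<in> I \<and> j \<in> J}" (is "is_ideal ?S")
    and "copies_in X (ideal_module {i + j | i j. i \<in> I \<and> j \<in> J})"
proof -
  note D = IKE_D[OF X]
  note mc = ideal_mod_cat[OF IJ(1)] ideal_mod_cat[OF IJ(2)] ideal_mod_cat[OF IJ(3)]
  let ?E = "mod_sum (ideal_module I) (ideal_module J)"
  let ?E' = "mod_transport (emb \<circ> interleave) ?E"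
  let ?K' = "mod_transport emb (ideal_module K)"
  note EX = sum_copies_in[OF emb D(1,2) mc(1,2) c(1,2)]
  note KX = copy_in[OF emb mc(3) c(3)]
  have Em: "module R ?E" by (rule mod_catD(1)[OF mod_sum_mod_cat[OF mc(1,2)]])
  have "inj (emb \<circ> interleave)" using emb inj_interleave by (rule inj_compose)
  note E' = copy_mod_cat[OF this mod_sum_mod_cat[OF mc(1,2)]]
  obtain u where u: "u \<in> mod_hom R ?E' ?E" "bij_betw u (carrier ?E') (carrier ?E)"
    using mod_iso_sym[OF Em E'(2)] by (auto simp: mod_iso_def)
  have embK: "inj_on emb K" using emb inj_on_subset by blast
  note t = mod_transport[OF mod_catD(1)[OF mc(3)], of emb, unfolded ideal_module_simps, OF embK]
  let ?s = "\<lambda>y. fst y + snd y"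
  have s: "?s \<in> mod_hom R ?E (ideal_module K)"
    using IJ(4,5)
    by (auto simp: mod_hom_def mod_sum_def algebra_simps intro!: is_idealD(3)[OF IJ(3)])
  let ?f = "emb \<circ> (?s \<circ> u)"
  have f: "?f \<in> mod_hom R ?E' ?K'" using mod_hom_comp[OF mod_hom_comp[OF u(1) s] t(2)] .
  have "?s ` carrier ?E = ?S" by (force simp: mod_sum_def)
  moreover have "submodule (?s ` carrier ?E) R (ideal_module K)"
    by (rule submodule_image[OF Em mod_catD(1)[OF mc(3)] s submodule_carrier[OF Em]])
  ultimately show S: "is_ideal ?S"
    using submoduleD[of ?S R "ideal_module K"] is_idealD(1)[OF IJ(3)] unfolding is_ideal_def
    by (simp add: subset_eq)
  have "?f ` carrier ?E' = emb ` (?s ` (u ` carrier ?E'))" by (simp add: image_comp)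
  also have "u ` carrier ?E' = carrier ?E" using u(2) by (simp add: bij_betw_def)
  also have "?s ` carrier ?E = ?S" by (force simp: mod_sum_def)
  finally have im: "?f ` carrier ?E' = emb ` ?S" .
  have SK: "?S \<subseteq> K" using IJ(4,5) is_idealD(3)[OF IJ(3)] by auto
  have car: "carrier (mod_image ?E' ?K' ?f) = emb ` ?S" unfolding im[symmetric] by (simp add: mod_image_def)
  have "emb \<in> mod_hom R (ideal_module ?S) (mod_image ?E' ?K' ?f)"
  proof (rule mod_homI)
    fix x y assume "x \<in> carrier (ideal_module ?S)" "y \<in> carrier (ideal_module ?S)"
    then have "x \<in> K" "y \<in> K" using SK unfolding ideal_module_simps by blast+
    then show "emb (x \<oplus>\<^bsub>ideal_module ?S\<^esub> y) = emb x \<oplus>\<^bsub>mod_image ?E' ?K' ?f\<^esub> emb y"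
      using mod_homD(2)[OF t(2)] by (simp add: mod_image_def)
  next
    fix r x assume "r \<in> carrier R" "x \<in> carrier (ideal_module ?S)"
    then have "r \<in> carrier R" "x \<in> K" using SK unfolding ideal_module_simps by blast+
    then show "emb (r \<odot>\<^bsub>ideal_module ?S\<^esub> x) = r \<odot>\<^bsub>mod_image ?E' ?K' ?f\<^esub> emb x"
      using mod_homD(3)[OF t(2)] by (simp add: mod_image_def)
  qed (simp add: car)
  moreover have "bij_betw emb ?S (emb ` ?S)" using embK SK by (simp add: bij_betw_def inj_on_subset)
  ultimately have "mod_iso R (ideal_module ?S) (mod_image ?E' ?K' ?f)"
    unfolding mod_iso_def car ideal_module_simps by blast
  then show "copies_in X (ideal_module ?S)"
    using copies_inI[OF D(1) mod_catD(1)[OF ideal_mod_cat[OF S]] D(4)[OF EX KX f]] by blast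
qed

section \<open>From a torsionfree module to the regular module\<close>

lemma ideal_scale_iso:
  assumes "q \<noteq> 0"
  shows "mod_iso R (ideal_module I) (ideal_module ((*) q ` I))"
proof -
  have "(*) q \<in> mod_hom R (ideal_module I) (ideal_module ((*) q ` I))"
    by (auto simp: mod_hom_def algebra_simps)
  moreover have "bij_betw ((*) q) I ((*) q ` I)"
    using assms by (auto simp: bij_betw_def inj_on_def)
  ultimately show ?thesis by (auto simp: mod_iso_def)
qed

text \<open>The shift by \<open>c\<close> puts all factors \<open>fps_X ^ (c + i)\<close> into
  \<open>R\<close>, so the pieces stay inside \<open>J\<close>, which serves as target for the sums.
  As \<open>fps_X ^ c \<in> J\<close>, the pieces with \<open>i \<le> c\<close> contain the
  monomials of all orders from \<open>2 c\<close> to \<open>3 c\<close>, and the piece with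
  \<open>i = 0\<close> contains everything of order at least \<open>3 c\<close>.\<close>

lemma conductor_in:
  fixes emb :: "'k fps \<Rightarrow> 'm" and X :: "('k fps, 'm) module set"
  assumes emb: "inj emb" and X: "IKE_closed R X"
    and J: "is_ideal J" "fps_X ^ c \<in> J" "J \<subseteq> filt c" and JX: "copies_in X (ideal_module J)"
  shows "copies_in X (ideal_module (filt (c + c)))"
proof -
  note JD = is_idealD[OF J(1)]
  have XH: "fps_X ^ (c + i) \<in> carrier R" for i using conductor_mem by simp
  define P where "P i = (*) (fps_X ^ (c + i)) ` J" for i
  have PJ: "P i \<subseteq> J" for i using JD(4)[OF XH] by (auto simp: P_def)
  have Pf: "P i \<subseteq> filt (c + c)" for i
  proof
    fix f assume "f \<in> P i"
    then obtain g where g: "g \<in> J" "f = fps_X ^ (c + i) * g" by (auto simp: P_def)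
    have "fps_X ^ (c + i) \<in> filt c" by (intro X_power_filt conductor_mem) auto
    then show "f \<in> filt (c + c)" using filt_mult g J(3) by blast
  qed
  have Pid: "is_ideal (P i)" for i
    unfolding is_ideal_def
  proof (intro conjI ballI)
    show "P i \<subseteq> carrier R" using PJ JD(1) by blast
    show "0 \<in> P i" using JD(2) by (force simp: P_def)
  next
    fix f g assume "f \<in> P i" "g \<in> P i"
    then obtain u v where "u \<in> J" "v \<in> J" "f = fps_X ^ (c + i) * u" "g = fps_X ^ (c + i) * v"
      by (auto simp: P_def)
    then have "f + g = fps_X ^ (c + i) * (u + v)" "u + v \<in> J" using JD(3) by (auto simp: distrib_left)
    then show "f + g \<in> P i" unfolding P_def by blast
  next
    fix r f assume "r \<in> carrier R" "f \<in> P i"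
    then obtain u where "r \<in> carrier R" "u \<in> J" "f = fps_X ^ (c + i) * u" by (auto simp: P_def)
    then show "r * f \<in> P i" using JD(4)[of r u] by (auto simp: P_def mult.left_commute)
  qed
  have PX: "copies_in X (ideal_module (P i))" for i
    unfolding P_def
    by (rule copies_in_iso[OF JX mod_catD(1)[OF ideal_mod_cat[OF J(1)]] ideal_scale_iso]) simp
  \<comment> \<open>The invariant \<open>S \<subseteq> J\<close> permits the next use of
    \<open>ideal_sum_in\<close>; the invariant \<open>S \<subseteq> filt (c + c)\<close> gives one
    of the two final inclusions.\<close>
  have "\<exists>S. is_ideal S \<and> copies_in X (ideal_module S) \<and> S \<subseteq> J \<and> S \<subseteq> filt (c + c) \<and> (\<forall>i\<le>n. P i \<subseteq> S)" for n
  proof (induction n)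
    case 0
    show ?case using Pid PX PJ Pf by (intro exI[of _ "P 0"]) auto
  next
    case (Suc n)
    then obtain S where S: "is_ideal S" "copies_in X (ideal_module S)" "S \<subseteq> J" "S \<subseteq> filt (c + c)"
      "\<forall>i\<le>n. P i \<subseteq> S" by blast
    let ?T = "{i + j | i j. i \<in> S \<and> j \<in> P (Suc n)}"
    note sum = ideal_sum_in[OF emb X S(1) Pid J(1) S(3) PJ S(2) PX JX, of "Suc n"]
    have "S \<subseteq> ?T"
    proof
      fix f assume "f \<in> S"
      then show "f \<in> ?T" using is_idealD(2)[OF Pid[of "Suc n"]] by (intro CollectI exI[of _ f] exI[of _ 0]) simp
    qed
    moreover have "P (Suc n) \<subseteq> ?T"
    proof
      fix f assume "f \<in> P (Suc n)"
      then show "f \<in> ?T" using is_idealD(2)[OF S(1)] by (intro CollectI exI[of _ 0] exI[of _ f]) simp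
    qed
    moreover have "?T \<subseteq> J" using S(3) PJ JD(3) by blast
    moreover have "?T \<subseteq> filt (c + c)" using S(4) Pf filt_add by blast
    ultimately show ?case using sum S(5)
      by (intro exI[of _ ?T]) (simp add: le_Suc_eq, blast)
  qed
  from this[of c] obtain S where S: "is_ideal S" "copies_in X (ideal_module S)" "S \<subseteq> filt (c + c)"
    "\<And>i. i \<le> c \<Longrightarrow> P i \<subseteq> S" by blast
  have "filt (c + c + k) \<subseteq> S" if "k \<le> c" for k
    using that
  proof (induction rule: inc_induct)
    case base
    show ?case
    proof
      fix f assume "f \<in> filt (c + c + c)"
      then obtain g where g: "g \<in> filt c" "f = fps_X ^ (c + c) * g"
        using filt_principal[of "fps_X ^ (c + c)" f c] by (auto simp: add_ac)
      have "f = fps_X ^ (c + 0) * (g * fps_X ^ c)" by (simp add: g(2) power_add algebra_simps)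
      then have "f \<in> P 0" unfolding P_def using JD(4)[OF filt_closed[OF g(1)] J(2)] by blast
      then show "f \<in> S" using S(4)[of 0] by auto
    qed
  next
    case (step k)
    show ?case
    proof
      fix f assume f: "f \<in> filt (c + c + k)"
      obtain g where g: "g \<in> filt (Suc (c + c + k))"
        "f = fps_const (fps_nth f (c + c + k)) * fps_X ^ (c + c + k) + g"
        using filt_split[OF f] conductor_mem by (metis le_add1 add.assoc)
      have "fps_const (fps_nth f (c + c + k)) * fps_X ^ (c + c + k) =
          fps_X ^ (c + k) * (fps_const (fps_nth f (c + c + k)) * fps_X ^ c)"
        by (simp add: power_add algebra_simps)
      then have "fps_const (fps_nth f (c + c + k)) * fps_X ^ (c + c + k) \<in> P k"
        unfolding P_def using JD(4)[OF const_closed J(2)] by blast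
      then have "fps_const (fps_nth f (c + c + k)) * fps_X ^ (c + c + k) \<in> S"
        using S(4)[of k] step.hyps by auto
      moreover have "g \<in> S" using g(1) step.IH by auto
      ultimately show "f \<in> S" using g(2) is_idealD(3)[OF S(1)] by metis
    qed
  qed
  from this[of 0] have "filt (c + c) = S" using S(3) by simp
  then show ?thesis using S(2) by simp
qed

lemma common_denominator:
  assumes "finite A" "A \<subseteq> {fps_to_fls b / fps_to_fls r | b r. b \<in> carrier R \<and> r \<in> carrier R \<and> fps_to_fls r \<noteq> 0}"
  shows "\<exists>q\<in>carrier R. q \<noteq> 0 \<and> (\<forall>a\<in>A. fps_to_fls q * a \<in> fps_to_fls ` carrier R)"
  using assms
proof (induction A)
  case empty
  show ?case by (intro bexI[of _ 1]) auto
next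
  case (insert a A)
  then obtain q where q: "q \<in> carrier R" "q \<noteq> 0" "\<forall>a\<in>A. fps_to_fls q * a \<in> fps_to_fls ` carrier R" by auto
  obtain b r where br: "b \<in> carrier R" "r \<in> carrier R" "r \<noteq> 0" "a = fps_to_fls b / fps_to_fls r"
    using insert.prems by auto
  have "fps_to_fls (r * q) * x \<in> fps_to_fls ` carrier R" if x: "x \<in> insert a A" for x
  proof (cases "x = a")
    case True
    then have "fps_to_fls (r * q) * x = fps_to_fls (q * b)"
      using br(3,4) by (simp add: fls_times_fps_to_fls)
    then show ?thesis using q(1) br(1) by auto
  next
    case False
    then obtain s where "s \<in> carrier R" "fps_to_fls q * x = fps_to_fls s" using q(3) x by auto
    then have "fps_to_fls (r * q) * x = fps_to_fls (r * s)"
      by (simp add: fls_times_fps_to_fls mult.assoc)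
    then show ?thesis using br(2) \<open>s \<in> carrier R\<close> by auto
  qed
  then show ?case using q(1,2) br(2,3) by (intro bexI[of _ "r * q"]) auto
qed

text \<open>A finitely generated fractional ideal becomes an ideal when multiplied by a common
  denominator \<open>q\<close> of its generators; \<open>\<psi>\<close> is this multiplication with
  values read as power series.\<close>

lemma clear_denominators:
  assumes E: "submodule E R (fls_module fps_to_fls UNIV)" "fin_gen R (fls_module fps_to_fls E)"
    "E \<subseteq> {fps_to_fls b / fps_to_fls r | b r. b \<in> carrier R \<and> r \<in> carrier R \<and> fps_to_fls r \<noteq> 0}"
  obtains \<psi> where "\<psi> \<in> mod_hom R (fls_module fps_to_fls E) (ideal_module (carrier R))" "inj_on \<psi> E"
proof -
  note U = module_fls_UNIV[OF ring_map_fps_to_fls] and Em = module_fls[OF ring_map_fps_to_fls E(1)]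
  obtain A where A: "finite A" "A \<subseteq> E" "mod_span R (fls_module fps_to_fls E) A = E"
    using E(2) unfolding fin_gen_iff_span[OF Em] by auto
  obtain q where q: "q \<in> carrier R" "q \<noteq> 0" "\<forall>x\<in>A. fps_to_fls q * x \<in> fps_to_fls ` carrier R"
    using common_denominator[OF A(1) order_trans[OF A(2) E(3)]] by blast
  have "(*) (fps_to_fls q) \<in> mod_hom R (fls_module fps_to_fls UNIV) (fls_module fps_to_fls UNIV)"
    by (auto simp: mod_hom_def algebra_simps)
  moreover have "submodule (fps_to_fls ` carrier R) R (fls_module fps_to_fls UNIV)"
    by (rule submodule_image[OF module_regular U _ submodule_carrier[OF module_regular], simplified])
       (simp add: mod_hom_def fls_times_fps_to_fls)
  ultimately have "submodule {x. fps_to_fls q * x \<in> fps_to_fls ` carrier R} R (fls_module fps_to_fls UNIV)"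
    using submodule_vimage[OF U U] by fastforce
  moreover have "A \<subseteq> {x. fps_to_fls q * x \<in> fps_to_fls ` carrier R}" using q(3) by auto
  ultimately have "mod_span R (fls_module fps_to_fls UNIV) A \<subseteq> {x. fps_to_fls q * x \<in> fps_to_fls ` carrier R}"
    by (rule span_minimal)
  then have sub: "E \<subseteq> {x. fps_to_fls q * x \<in> fps_to_fls ` carrier R}"
    unfolding span_sub[OF U E(1) A(2), unfolded fls_module_simps A(3), symmetric] .
  have "\<exists>f. f \<in> carrier R \<and> fps_to_fls f = fps_to_fls q * x" if x: "x \<in> E" for x
  proof -
    have "fps_to_fls q * x \<in> fps_to_fls ` carrier R" using sub x by blast
    then show ?thesis by (metis imageE)
  qed
  then obtain \<psi> where \<psi>: "\<And>x. x \<in> E \<Longrightarrow> \<psi> x \<in> carrier R"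
    "\<And>x. x \<in> E \<Longrightarrow> fps_to_fls (\<psi> x) = fps_to_fls q * x" by metis
  note ED = submoduleD[OF E(1)]
  have "\<psi> (x + y) = \<psi> x + \<psi> y" if "x \<in> E" "y \<in> E" for x y
  proof -
    have "fps_to_fls (\<psi> (x + y)) = fps_to_fls (\<psi> x + \<psi> y)"
      using that \<psi>(2) ED(3)[OF that] by (simp add: distrib_left)
    then show ?thesis by (simp only: fps_to_fls_eq_iff)
  qed
  moreover have "\<psi> (fps_to_fls r * x) = r * \<psi> x" if "r \<in> carrier R" "x \<in> E" for r x
  proof -
    have "fps_to_fls (\<psi> (fps_to_fls r * x)) = fps_to_fls (r * \<psi> x)"
      using that \<psi>(2) ED(4)[OF that] by (simp add: fls_times_fps_to_fls mult.left_commute)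
    then show ?thesis by (simp only: fps_to_fls_eq_iff)
  qed
  ultimately have "\<psi> \<in> mod_hom R (fls_module fps_to_fls E) (ideal_module (carrier R))"
    using \<psi>(1) by (intro mod_homI) auto
  moreover have "inj_on \<psi> E"
  proof (rule inj_onI)
    fix x y assume "x \<in> E" "y \<in> E" "\<psi> x = \<psi> y"
    then have "fps_to_fls q * x = fps_to_fls q * y" using \<psi>(2) by metis
    then show "x = y" using q(2) by simp
  qed
  ultimately show ?thesis by (rule that)
qed

lemma faithful_torsionfree:
  "module R M \<Longrightarrow> torsionfree R M \<Longrightarrow> faithful fps_to_fls M"
  unfolding faithful_def torsionfree_def
  using smult_0 smult_zero by (metis fps_to_fls_eq_0_iff ring_ops(4))

text \<open>A nonzero functional gives a nonzero map \<open>\<psi>\<close> from \<open>M\<close> to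
  \<open>R\<close>. Dividing by a value of least order and multiplying by \<open>fps_X ^ c\<close>
  normalises it to a map \<open>h\<close> into \<open>filt c\<close> that attains
  \<open>fps_X ^ c\<close>, as \<open>conductor_in\<close> requires of the image \<open>J\<close>.
  The self-extensions of ideals then lead from \<open>filt (c + c)\<close> down to
  \<open>filt 0\<close>.\<close>

lemma IKE_regular:
  fixes emb :: "'k fps \<Rightarrow> 'm" and X :: "('k fps, 'm) module set"
    and M (structure)
  assumes emb: "inj emb" and X: "IKE_closed R X"
    and M: "M \<in> X" "torsionfree R M" "carrier M \<noteq> {\<zero>}"
  shows "copies_in X (ideal_module (carrier R))"
proof -
  note D = IKE_D[OF X]
  note Mm = mod_catD[OF subsetD[OF D(3) M(1)]]
  interpret module R M by (rule Mm(1))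
  note U = module_fls_UNIV[OF ring_map_fps_to_fls]
  obtain \<phi> a where a: "a \<in> carrier M" and \<phi>: "\<phi> \<in> mod_hom R M (fls_module fps_to_fls UNIV)" "\<phi> a = 1"
    "\<And>x. x \<in> carrier M \<Longrightarrow> \<exists>b\<in>carrier R. \<exists>r\<in>carrier R. fps_to_fls r \<noteq> 0 \<and> \<phi> x = fps_to_fls b / fps_to_fls r"
    using nonzero_functional[OF Mm ring_map_fps_to_fls faithful_torsionfree[OF Mm(1) M(2)] M(3)] by metis
  let ?E = "\<phi> ` carrier M"
  have E: "submodule ?E R (fls_module fps_to_fls UNIV)"
    by (rule submodule_image[OF Mm(1) U \<phi>(1) submodule_carrier[OF Mm(1)]])
  note Em = module_fls[OF ring_map_fps_to_fls E]
  have \<phi>E: "\<phi> \<in> mod_hom R M (fls_module fps_to_fls ?E)" using \<phi>(1) by (auto simp: mod_hom_def)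
  have "fin_gen R (fls_module fps_to_fls ?E)" by (rule fin_gen_surj[OF Mm(1) Em \<phi>E _ Mm(2)]) simp
  then obtain \<eta> where \<eta>: "\<eta> \<in> mod_hom R (fls_module fps_to_fls ?E) (ideal_module (carrier R))" "inj_on \<eta> ?E"
    using clear_denominators[OF E] \<phi>(3) by blast
  define \<psi> where "\<psi> = \<eta> \<circ> \<phi>"
  have \<psi>: "\<psi> \<in> mod_hom R M (ideal_module (carrier R))"
    unfolding \<psi>_def by (rule mod_hom_comp[OF \<phi>E \<eta>(1)])
  note \<psi>D = mod_homD[OF \<psi>, unfolded ideal_module_simps]
  have "\<psi> a \<noteq> 0"
    using mod_hom_inj_iff[OF Em module_regular \<eta>(1)] \<eta>(2) a \<phi>(2) by (auto simp: \<psi>_def)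
  \<comment> \<open>A value of least order: every \<open>\<psi> x / \<psi> b\<close> is then a power
    series, and the factor \<open>fps_X ^ c\<close> moves it into \<open>filt c\<close>.\<close>
  then obtain b where b: "b \<in> carrier M" "\<psi> b \<noteq> 0"
    and minimal: "\<And>x. x \<in> carrier M \<Longrightarrow> \<psi> x \<noteq> 0 \<Longrightarrow> subdegree (\<psi> b) \<le> subdegree (\<psi> x)"
    using ex_has_least_nat[of "\<lambda>x. x \<in> carrier M \<and> \<psi> x \<noteq> 0" a "\<lambda>x. subdegree (\<psi> x)"] a by blast
  have "\<exists>g. g \<in> filt c \<and> fps_X ^ c * \<psi> x = \<psi> b * g" if x: "x \<in> carrier M" for x
  proof -
    have "\<psi> x \<in> filt (subdegree (\<psi> b))"
      using minimal[OF x] \<psi>D(1)[OF x] filt_subdegree by (cases "\<psi> x = 0") auto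
    moreover have "fps_X ^ c \<in> filt c" by (intro X_power_filt conductor_mem) auto
    ultimately have "fps_X ^ c * \<psi> x \<in> filt (c + subdegree (\<psi> b))" by (intro filt_mult)
    from filt_principal[OF b(2) this order_refl] show ?thesis by metis
  qed
  then obtain h where h: "\<And>x. x \<in> carrier M \<Longrightarrow> h x \<in> filt c"
    "\<And>x. x \<in> carrier M \<Longrightarrow> fps_X ^ c * \<psi> x = \<psi> b * h x" by metis
  have h_add: "h (x \<oplus> y) = h x + h y" if "x \<in> carrier M" "y \<in> carrier M" for x y
  proof -
    have "\<psi> b * h (x \<oplus> y) = \<psi> b * (h x + h y)"
      using that h(2)[symmetric] \<psi>D(2) by (simp add: distrib_left)
    then show ?thesis using b(2) by simp
  qed
  have h_smult: "h (r \<odot> x) = r * h x" if "r \<in> carrier R" "x \<in> carrier M" for r x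
  proof -
    have "\<psi> b * h (r \<odot> x) = r * (fps_X ^ c * \<psi> x)"
      using that h(2)[of "r \<odot> x", symmetric] \<psi>D(3) by (simp add: mult.left_commute)
    also have "\<dots> = \<psi> b * (r * h x)" using h(2)[OF that(2)] by (simp add: mult.left_commute)
    finally show ?thesis using b(2) by simp
  qed
  have "\<psi> b * h b = \<psi> b * fps_X ^ c" unfolding h(2)[OF b(1), symmetric] by (rule mult.commute)
  then have hb: "h b = fps_X ^ c" using b(2) by simp
  have hR: "h x \<in> carrier R" if "x \<in> carrier M" for x using filt_closed[OF h(1)[OF that]] .
  define J where "J = h ` carrier M"
  have hh: "h \<in> mod_hom R M (ideal_module (carrier R))"
    using hR h_add h_smult by (intro mod_homI) auto
  have J: "is_ideal J"
    using submodule_image[OF Mm(1) module_regular hh submodule_carrier[OF Mm(1)]]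
    by (simp add: submodule_regular J_def)
  \<comment> \<open>As \<open>M\<close> is torsionfree, the multiples \<open>h x \<odot> b\<close>
    form a copy of \<open>J\<close>, and they are the image of an endomorphism of
    \<open>M\<close>.\<close>
  define p where "p x = h x \<odot> b" for x
  have p: "p \<in> mod_hom R M M"
    unfolding p_def using hR b(1)
    by (intro mod_homI) (auto simp: h_add h_smult smult_add[OF Mm(1)] smult_mult[OF Mm(1)])
  have b0: "b \<noteq> \<zero>"
  proof
    assume "b = \<zero>"
    then have "\<psi> b = 0 * \<psi> b" using \<psi>D(3)[OF closed_0 b(1)] smult_0[OF Mm(1) b(1)] by simp
    then show False using b(2) by simp
  qed
  have ker: "h x = 0 \<longleftrightarrow> p x = \<zero>" if "x \<in> carrier M" for x
    using M(2) b(1) b0 hR[OF that] smult_0[OF Mm(1) b(1)] by (auto simp: torsionfree_def p_def)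
  have hJ: "h \<in> mod_hom R M (ideal_module J)"
    using h_add h_smult by (intro mod_homI) (auto simp: J_def)
  have "mod_iso R (ideal_module J) (mod_image M M p)"
    by (rule mod_iso_of_kernel[OF Mm(1) mod_catD(1)[OF ideal_mod_cat[OF J]] module_image[OF Mm(1) Mm(1) p]
          hJ _ mod_hom_to_image[OF p]]) (auto simp: J_def mod_image_def ker)
  then have JX: "copies_in X (ideal_module J)"
    using copies_inI[OF D(1) mod_catD(1)[OF ideal_mod_cat[OF J]] D(4)[OF M(1) M(1) p]] by blast
  have "fps_X ^ c \<in> J" using hb b(1) unfolding J_def by (metis imageI)
  moreover have "J \<subseteq> filt c" using h(1) by (auto simp: J_def)
  ultimately have C: "copies_in X (ideal_module (filt (c + c)))"
    using conductor_in[OF emb X J _ _ JX] by blast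
  have "copies_in X (ideal_module (filt 0))"
  proof (rule inc_induct[of 0 "c + c"])
    show "copies_in X (ideal_module (filt (c + c)))" by (rule C)
    show "copies_in X (ideal_module (filt n))" if "copies_in X (ideal_module (filt (Suc n)))" for n
      using ideal_step_in[OF emb D(1,2) IKE_closed_summands[OF X] that] .
  qed simp
  then show ?thesis by (simp add: filt_0)
qed

text \<open>An ideal is a finite sum of principal ideals. Each nonzero one is a copy of
  \<open>R\<close>, and \<open>R\<close> serves as the common overideal in which the sums are
  formed.\<close>

lemma IKE_ideals:
  fixes emb :: "'k fps \<Rightarrow> 'm" and X :: "('k fps, 'm) module set"
  assumes emb: "inj emb" and X: "IKE_closed R X"
    and reg: "copies_in X (ideal_module (carrier R))" and I: "is_ideal I"
  shows "copies_in X (ideal_module I)"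
proof -
  note D = IKE_D[OF X]
  let ?R = "ideal_module (carrier R)"
  have princ: "is_ideal ((*) a ` carrier R)" "copies_in X (ideal_module ((*) a ` carrier R))"
    if a: "a \<in> carrier R" "a \<noteq> 0" for a
  proof -
    have "(*) a \<in> mod_hom R ?R ?R" using a by (auto simp: mod_hom_def algebra_simps)
    from submodule_image[OF module_regular module_regular this submodule_carrier[OF module_regular]]
    show "is_ideal ((*) a ` carrier R)" by (simp add: submodule_regular)
    show "copies_in X (ideal_module ((*) a ` carrier R))"
      by (rule copies_in_iso[OF reg module_regular ideal_scale_iso[OF a(2)]])
  qed
  obtain A where A: "finite A" "A \<subseteq> I" "mod_span R (ideal_module I) A = I"
    using mod_catD[OF ideal_mod_cat[OF I]] fin_gen_iff_span[of R "ideal_module I"] by auto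
  have AR: "A \<subseteq> carrier R" using A(2) is_idealD(1)[OF I] by auto
  have span: "mod_span R ?R A = I"
    using span_sub[OF module_regular, of I A] A(2,3) I by (simp add: submodule_regular)
  have "copies_in X (ideal_module (mod_span R ?R A))" using A(1) AR
  proof (induction A)
    case empty
    have "N \<in> X" if N: "N \<in> mod_cat R" "mod_iso R (ideal_module {0}) N" for N
    proof -
      obtain f where f: "f \<in> mod_hom R (ideal_module {0}) N" "f ` {0} = carrier N"
        using N(2) by (auto simp: mod_iso_def bij_betw_def)
      have "is_ideal {0}" by (auto simp: is_ideal_def)
      then have "f 0 = \<zero>\<^bsub>N\<^esub>"
        using mod_hom_zero[OF mod_catD(1)[OF ideal_mod_cat] mod_catD(1)[OF N(1)] f(1)] by simp
      then show ?thesis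
        using f(2) N(1) summands_zero[OF D(1) IKE_closed_summands[OF X]] by (auto simp: zero_cat_def)
    qed
    then show ?case by (simp add: copies_in_def span_empty[OF module_regular])
  next
    case (insert a A)
    have a: "a \<in> carrier R" and A: "A \<subseteq> carrier R" using insert by auto
    have sA: "is_ideal (mod_span R ?R A)"
      using submodule_span[OF module_regular, of A] A by (simp add: submodule_regular)
    have ins: "mod_span R ?R (insert a A) = {x + r * a | x r. x \<in> mod_span R ?R A \<and> r \<in> carrier R}"
      using span_insert[OF module_regular, of A a] a A by simp
    show ?case
    proof (cases "a = 0")
      case True
      then have "mod_span R ?R (insert a A) = mod_span R ?R A"
        unfolding ins by (auto intro!: exI[of _ 0])
      then show ?thesis using insert.IH[OF A] by simp
    next
      case False
      have "mod_span R ?R (insert a A) = {x + y | x y. x \<in> mod_span R ?R A \<and> y \<in> (*) a ` carrier R}"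
        unfolding ins by (auto simp: mult.commute image_iff)
      moreover have "copies_in X (ideal_module {x + y | x y. x \<in> mod_span R ?R A \<and> y \<in> (*) a ` carrier R})"
        using is_idealD(1)[OF sA] a
        by (intro ideal_sum_in(2)[OF emb X sA princ(1)[OF a False] is_ideal_carrier _ _ insert.IH[OF A] princ(2)[OF a False] reg])
           auto
      ultimately show ?thesis by simp
    qed
  qed
  then show ?thesis by (simp add: span)
qed

text \<open>Devissage over the fraction field reduces to finitely generated fractional ideals, and
  clearing denominators turns these into ideals of \<open>R\<close>.\<close>

lemma IKE_torsionfree:
  fixes emb :: "'k fps \<Rightarrow> 'm" and X :: "('k fps, 'm) module set"
  assumes emb: "inj emb" and X: "IKE_closed R X" and reg: "copies_in X (ideal_module (carrier R))"
  shows "tf_cat R \<subseteq> X"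
proof
  fix M :: "('k fps, 'm) module" assume "M \<in> tf_cat R"
  then have M: "M \<in> mod_cat R" "torsionfree R M" by (auto simp: tf_cat_def)
  note D = IKE_D[OF X]
  show "M \<in> X"
  proof (rule devissage[OF D(2) summands_zero[OF D(1) IKE_closed_summands[OF X]] ring_map_fps_to_fls _ M(1)
        faithful_torsionfree[OF mod_catD(1)[OF M(1)] M(2)]])
    fix E and N :: "('k fps, 'm) module"
    assume E: "submodule E R (fls_module fps_to_fls UNIV)"
      "E \<subseteq> {fps_to_fls b / fps_to_fls r | b r. b \<in> carrier R \<and> r \<in> carrier R \<and> fps_to_fls r \<noteq> 0}"
      "fin_gen R (fls_module fps_to_fls E)"
      and N: "N \<in> mod_cat R" "mod_iso R (fls_module fps_to_fls E) N"
    note Em = module_fls[OF ring_map_fps_to_fls E(1)]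
    obtain \<psi> where hom: "\<psi> \<in> mod_hom R (fls_module fps_to_fls E) (ideal_module (carrier R))"
      and inj: "inj_on \<psi> E" using clear_denominators[OF E(1,3,2)] .
    have I: "is_ideal (\<psi> ` E)"
      using submodule_image[OF Em module_regular hom submodule_carrier[OF Em]]
      by (simp add: submodule_regular)
    have "mod_iso R (fls_module fps_to_fls E) (ideal_module (\<psi> ` E))"
      unfolding mod_iso_def using inj hom
      by (intro bexI[of _ \<psi>]) (auto simp: bij_betw_def mod_hom_def)
    from mod_iso_trans[OF mod_iso_sym[OF Em this] N(2)] show "N \<in> X"
      using IKE_ideals[OF emb X reg I] N(1) by (simp add: copies_in_def)
  qed
qed

text \<open>Images and kernels are submodules of members, and an isomorphic copy of a member is an
  extension of a zero module by it. So three conditions on \<open>P\<close> cover all closure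
  properties.\<close>

lemma IKE_closed_Collect:
  fixes emb :: "'k fps \<Rightarrow> 'm" and P :: "('k fps, 'm) module \<Rightarrow> bool"
  assumes emb: "inj emb"
    and zero: "\<And>M. M \<in> mod_cat R \<Longrightarrow> carrier M = {\<zero>\<^bsub>M\<^esub>} \<Longrightarrow> P M"
    and sub: "\<And>M K. M \<in> mod_cat R \<Longrightarrow> P M \<Longrightarrow> submodule K R M \<Longrightarrow> P (M\<lparr>carrier := K\<rparr>)"
    and ext: "\<And>L M N f g. L \<in> mod_cat R \<Longrightarrow> M \<in> mod_cat R \<Longrightarrow> N \<in> mod_cat R \<Longrightarrow> P L \<Longrightarrow> P N \<Longrightarrow>
      short_exact R L f M g N \<Longrightarrow> P M"
  shows "IKE_closed R {M \<in> mod_cat R. P M}"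
proof -
  have z: "is_ideal {0}" by (auto simp: is_ideal_def)
  \<comment> \<open>The injection \<open>emb\<close> provides a zero module on \<open>'m\<close>, so
    that the class is not empty.\<close>
  let ?Z = "mod_transport emb (ideal_module {0})"
  have Z: "?Z \<in> mod_cat R" using copy_mod_cat(1)[OF emb ideal_mod_cat[OF z]] .
  have cZ: "carrier ?Z = {\<zero>\<^bsub>?Z\<^esub>}" by (simp add: mod_transport_def Let_def)
  have PZ: "P ?Z" by (rule zero[OF Z cZ])
  have "P N" if MN: "M \<in> mod_cat R" "N \<in> mod_cat R" "P M" "mod_iso R M N" for M N
  proof -
    interpret N: module R N by (rule mod_catD(1)[OF MN(2)])
    interpret Z: module R ?Z by (rule mod_catD(1)[OF Z])
    obtain f where f: "f \<in> mod_hom R M N" "bij_betw f (carrier M) (carrier N)"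
      using MN(4) by (auto simp: mod_iso_def)
    have "(\<lambda>x. \<zero>\<^bsub>?Z\<^esub>) \<in> mod_hom R N ?Z"
      using Z.M.zero_closed smult_zero[OF mod_catD(1)[OF Z]] by (simp add: mod_hom_def)
    moreover have "(\<lambda>x. \<zero>\<^bsub>?Z\<^esub>) ` carrier N = carrier ?Z"
      unfolding cZ using N.M.zero_closed by blast
    ultimately have "short_exact R M f N (\<lambda>x. \<zero>\<^bsub>?Z\<^esub>) ?Z"
      using f by (simp add: short_exact_def bij_betw_def)
    then show ?thesis using ext[OF MN(1,2) Z MN(3) PZ] by blast
  qed
  then have "subcategory R {M \<in> mod_cat R. P M}"
    unfolding subcategory_def using Z PZ by blast
  moreover have "closed_images R {M \<in> mod_cat R. P M}"
    unfolding closed_images_def mod_image_def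
  proof (intro ballI)
    fix M N :: "('k fps, 'm) module" and f
    assume M: "M \<in> {M \<in> mod_cat R. P M}" and N: "N \<in> {M \<in> mod_cat R. P M}" and f: "f \<in> mod_hom R M N"
    then have m: "module R M" "module R N" by (auto simp: mod_cat_def)
    have "submodule (f ` carrier M) R N" by (rule submodule_image[OF m f submodule_carrier[OF m(1)]])
    then show "N\<lparr>carrier := f ` carrier M\<rparr> \<in> {M \<in> mod_cat R. P M}"
      using N sub mod_cat_sub by blast
  qed
  moreover have "closed_kernels R {M \<in> mod_cat R. P M}"
    unfolding closed_kernels_def mod_kernel_def
  proof (intro ballI)
    fix M N :: "('k fps, 'm) module" and f
    assume M: "M \<in> {M \<in> mod_cat R. P M}" and N: "N \<in> {M \<in> mod_cat R. P M}" and f: "f \<in> mod_hom R M N"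
    then have m: "module R M" "module R N" by (auto simp: mod_cat_def)
    have "submodule {x \<in> carrier M. f x = \<zero>\<^bsub>N\<^esub>} R M" by (rule submodule_kernel[OF m f])
    then show "M\<lparr>carrier := {x \<in> carrier M. f x = \<zero>\<^bsub>N\<^esub>}\<rparr> \<in> {M \<in> mod_cat R. P M}"
      using M sub mod_cat_sub by blast
  qed
  moreover have "closed_extensions R {M \<in> mod_cat R. P M}"
    unfolding closed_extensions_def using ext by blast
  ultimately show ?thesis by (simp add: IKE_closed_def)
qed

section \<open>The four subcategories of the classification\<close>

lemma short_exactD:
  fixes M (structure)
  assumes "module R L" "module R M" "short_exact R L f M g N" "x \<in> carrier M"
  shows "g x \<in> carrier N" "g x = \<zero>\<^bsub>N\<^esub> \<Longrightarrow> \<exists>y\<in>carrier L. x = f y" "f \<zero>\<^bsub>L\<^esub> = \<zero>"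
    "r \<in> carrier R \<Longrightarrow> g (r \<odot> x) = r \<odot>\<^bsub>N\<^esub> g x"
    "r \<in> carrier R \<Longrightarrow> y \<in> carrier L \<Longrightarrow> f (r \<odot>\<^bsub>L\<^esub> y) = r \<odot> f y"
    "inj_on f (carrier L)"
proof -
  have fg: "f \<in> mod_hom R L M" "g \<in> mod_hom R M N" "inj_on f (carrier L)"
    "f ` carrier L = {x \<in> carrier M. g x = \<zero>\<^bsub>N\<^esub>}"
    using assms(3) by (auto simp: short_exact_def)
  show "g x \<in> carrier N" using mod_homD(1)[OF fg(2)] assms(4) .
  show "g x = \<zero>\<^bsub>N\<^esub> \<Longrightarrow> \<exists>y\<in>carrier L. x = f y" using fg(4) assms(4) by blast
  show "f \<zero>\<^bsub>L\<^esub> = \<zero>" using mod_hom_zero[OF assms(1,2) fg(1)] .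
  show "r \<in> carrier R \<Longrightarrow> g (r \<odot> x) = r \<odot>\<^bsub>N\<^esub> g x" using mod_homD(3)[OF fg(2)] assms(4) by blast
  show "r \<in> carrier R \<Longrightarrow> y \<in> carrier L \<Longrightarrow> f (r \<odot>\<^bsub>L\<^esub> y) = r \<odot> f y" using mod_homD(3)[OF fg(1)] by blast
  show "inj_on f (carrier L)" by (rule fg(3))
qed

lemma IKE_closed_mod_cat:
  fixes emb :: "'k fps \<Rightarrow> 'm"
  assumes "inj emb"
  shows "IKE_closed R (mod_cat R :: ('k fps, 'm) module set)"
  using IKE_closed_Collect[OF assms, of "\<lambda>_. True"] by simp

lemma IKE_closed_zero_cat:
  fixes emb :: "'k fps \<Rightarrow> 'm"
  assumes "inj emb"
  shows "IKE_closed R (zero_cat R :: ('k fps, 'm) module set)"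
  unfolding zero_cat_def
proof (rule IKE_closed_Collect[OF assms])
  fix M :: "('k fps, 'm) module" and K
  assume "M \<in> mod_cat R" "carrier M = {\<zero>\<^bsub>M\<^esub>}" "submodule K R M"
  then show "carrier (M\<lparr>carrier := K\<rparr>) = {\<zero>\<^bsub>M\<lparr>carrier := K\<rparr>\<^esub>}"
    using submoduleD(1,2)[of K R M] by auto
next
  fix L M N :: "('k fps, 'm) module" and f g
  assume *: "L \<in> mod_cat R" "M \<in> mod_cat R" "carrier L = {\<zero>\<^bsub>L\<^esub>}" "carrier N = {\<zero>\<^bsub>N\<^esub>}"
    and ex: "short_exact R L f M g N"
  note m = mod_catD(1)[OF *(1)] mod_catD(1)[OF *(2)]
  interpret M: module R M by (rule m(2))
  have "x = \<zero>\<^bsub>M\<^esub>" if "x \<in> carrier M" for x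
    using short_exactD(1,2,3)[OF m ex that] *(3,4) by auto
  then show "carrier M = {\<zero>\<^bsub>M\<^esub>}" using M.M.zero_closed by blast
qed

text \<open>Torsion is a condition on single elements, so the closure properties can be checked
  without composition series.\<close>

lemma fl_cat_eq: "fl_cat R = {M \<in> mod_cat R. torsion M}"
  using finite_length_iff_torsion by (auto simp: fl_cat_def mod_cat_def)

lemma IKE_closed_fl_cat:
  fixes emb :: "'k fps \<Rightarrow> 'm"
  assumes "inj emb"
  shows "IKE_closed R (fl_cat R :: ('k fps, 'm) module set)"
  unfolding fl_cat_eq
proof (rule IKE_closed_Collect[OF assms])
  fix M :: "('k fps, 'm) module" assume "M \<in> mod_cat R" "carrier M = {\<zero>\<^bsub>M\<^esub>}"
  then show "torsion M"
    using smult_1[of M] unfolding torsion_def mod_cat_def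
    by (intro ballI bexI[of _ 1]) auto
next
  fix M :: "('k fps, 'm) module" and K
  assume "M \<in> mod_cat R" "torsion M" "submodule K R M"
  then show "torsion (M\<lparr>carrier := K\<rparr>)" using submoduleD(1)[of K R M] by (auto simp: torsion_def)
next
  fix L M N :: "('k fps, 'm) module" and f g
  assume *: "L \<in> mod_cat R" "M \<in> mod_cat R" "torsion L" "torsion N" and ex: "short_exact R L f M g N"
  note m = mod_catD(1)[OF *(1)] mod_catD(1)[OF *(2)]
  interpret M: module R M by (rule m(2))
  show "torsion M" unfolding torsion_def
  proof
    fix x assume x: "x \<in> carrier M"
    note E = short_exactD[OF m ex]
    obtain r where r: "r \<in> carrier R" "r \<noteq> 0" "r \<odot>\<^bsub>N\<^esub> g x = \<zero>\<^bsub>N\<^esub>"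
      using *(4) E(1)[OF x] by (auto simp: torsion_def)
    have rx: "r \<odot>\<^bsub>M\<^esub> x \<in> carrier M" using r x by simp
    obtain y where y: "y \<in> carrier L" "r \<odot>\<^bsub>M\<^esub> x = f y" using E(2)[OF rx] E(4)[OF x r(1)] r(3) by auto
    obtain s where s: "s \<in> carrier R" "s \<noteq> 0" "s \<odot>\<^bsub>L\<^esub> y = \<zero>\<^bsub>L\<^esub>" using *(3) y(1) by (auto simp: torsion_def)
    have "(s * r) \<odot>\<^bsub>M\<^esub> x = \<zero>\<^bsub>M\<^esub>"
      using smult_mult[OF m(2) s(1) r(1) x] y(2) E(5)[OF x s(1) y(1)] s(3) E(3)[OF x] by simp
    then show "\<exists>r\<in>carrier R. r \<noteq> 0 \<and> r \<odot>\<^bsub>M\<^esub> x = \<zero>\<^bsub>M\<^esub>"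
      using r s by (intro bexI[of _ "s * r"]) auto
  qed
qed

lemma IKE_closed_tf_cat:
  fixes emb :: "'k fps \<Rightarrow> 'm"
  assumes "inj emb"
  shows "IKE_closed R (tf_cat R :: ('k fps, 'm) module set)"
  unfolding tf_cat_def
proof (rule IKE_closed_Collect[OF assms])
  fix M :: "('k fps, 'm) module" assume "carrier M = {\<zero>\<^bsub>M\<^esub>}"
  then show "torsionfree R M" by (auto simp: torsionfree_def)
next
  fix M :: "('k fps, 'm) module" and K
  assume "M \<in> mod_cat R" "torsionfree R M" "submodule K R M"
  then show "torsionfree R (M\<lparr>carrier := K\<rparr>)" using submoduleD(1)[of K R M] by (auto simp: torsionfree_def)
next
  fix L M N :: "('k fps, 'm) module" and f g
  assume *: "L \<in> mod_cat R" "M \<in> mod_cat R" "N \<in> mod_cat R" "torsionfree R L" "torsionfree R N"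
    and ex: "short_exact R L f M g N"
  note m = mod_catD(1)[OF *(1)] mod_catD(1)[OF *(2)] mod_catD(1)[OF *(3)]
  interpret L: module R L by (rule m(1))
  note E = short_exactD[OF m(1,2) ex]
  show "torsionfree R M" unfolding torsionfree_def
  proof (intro ballI impI)
    fix r x assume r: "r \<in> carrier R" and x: "x \<in> carrier M" and rx: "r \<odot>\<^bsub>M\<^esub> x = \<zero>\<^bsub>M\<^esub>"
    have gM: "g \<in> mod_hom R M N" using ex by (simp add: short_exact_def)
    show "r = \<zero>\<^bsub>R\<^esub> \<or> x = \<zero>\<^bsub>M\<^esub>"
    proof (cases "r = 0")
      case False
      have "r \<odot>\<^bsub>N\<^esub> g x = \<zero>\<^bsub>N\<^esub>" using E(4)[OF x r] rx mod_hom_zero[OF m(2,3) gM] by simp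
      then have "g x = \<zero>\<^bsub>N\<^esub>" using *(5) r E(1)[OF x] False by (auto simp: torsionfree_def)
      then obtain y where y: "y \<in> carrier L" "x = f y" using E(2)[OF x] by blast
      have "f (r \<odot>\<^bsub>L\<^esub> y) = f \<zero>\<^bsub>L\<^esub>" using E(5)[OF x r y(1)] rx y(2) E(3)[OF x] by simp
      then have "r \<odot>\<^bsub>L\<^esub> y = \<zero>\<^bsub>L\<^esub>" using E(6)[OF x] y(1) r by (auto dest: inj_onD)
      then have "y = \<zero>\<^bsub>L\<^esub>" using *(4) r y(1) False by (auto simp: torsionfree_def)
      then show ?thesis using y(2) E(3)[OF x] by simp
    qed simp
  qed
qed

text \<open>The torsion submodule \<open>T\<close> is finitely generated, hence killed by some
  \<open>filt n\<close>. A nonzero \<open>r\<close> in \<open>filt n\<close> has kernel exactly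
  \<open>T\<close>, so multiplication by \<open>r\<close> realises \<open>M/T\<close> inside
  \<open>M\<close> and no quotient has to be formed.\<close>

lemma torsion_part:
  fixes M (structure)
  assumes M: "M \<in> mod_cat R"
  obtains r where "r \<in> carrier R" "r \<noteq> 0"
    "torsion (M\<lparr>carrier := {x \<in> carrier M. r \<odot> x = \<zero>}\<rparr>)"
    "torsionfree R (mod_image M M (\<lambda>x. r \<odot> x))"
proof -
  note Mm = mod_catD(1)[OF M]
  interpret module R M by (rule Mm)
  define T where "T = {x \<in> carrier M. \<exists>r\<in>carrier R. r \<noteq> 0 \<and> r \<odot> x = \<zero>}"
  have "T = pure_span fps_to_fls M {}" by (simp add: T_def pure_span_def span_empty[OF Mm])
  then have "submodule T R M" using submodule_pure_span[OF Mm ring_map_fps_to_fls, of "{}"] by simp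
  then have "M\<lparr>carrier := T\<rparr> \<in> mod_cat R" by (rule mod_cat_sub[OF M])
  moreover have "torsion (M\<lparr>carrier := T\<rparr>)" by (auto simp: torsion_def T_def)
  ultimately obtain n where n: "\<And>r x. r \<in> filt n \<Longrightarrow> x \<in> T \<Longrightarrow> r \<odot> x = \<zero>"
    using torsion_killed[of "M\<lparr>carrier := T\<rparr>"] by auto
  \<comment> \<open>The exponent \<open>c + n\<close> places \<open>r\<close> both in
    \<open>R\<close> and in \<open>filt n\<close>.\<close>
  define r :: "'k fps" where "r = fps_X ^ (c + n)"
  have r: "r \<in> carrier R" "r \<noteq> 0" "r \<in> filt n"
    using conductor_mem[of "c + n"] X_power_filt[of "c + n" n] by (auto simp: r_def)
  have ker: "r \<odot> x = \<zero> \<longleftrightarrow> x \<in> T" if "x \<in> carrier M" for x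
    using n[OF r(3)] r that by (auto simp: T_def)
  show ?thesis
  proof (rule that[OF r(1,2)])
    show "torsion (M\<lparr>carrier := {x \<in> carrier M. r \<odot> x = \<zero>}\<rparr>)"
      using r(1,2) by (auto simp: torsion_def)
    show "torsionfree R (mod_image M M (\<lambda>x. r \<odot> x))"
      unfolding torsionfree_def
    proof (intro ballI impI)
      fix s y assume s: "s \<in> carrier R" and "y \<in> carrier (mod_image M M (\<lambda>x. r \<odot> x))"
        and sy: "s \<odot>\<^bsub>mod_image M M (\<lambda>x. r \<odot> x)\<^esub> y = \<zero>\<^bsub>mod_image M M (\<lambda>x. r \<odot> x)\<^esub>"
      then obtain x where x: "x \<in> carrier M" "y = r \<odot> x" by (auto simp: mod_image_def)
      have "(s * r) \<odot> x = \<zero>"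
        using sy x smult_mult[OF Mm s r(1) x(1)] by (simp add: mod_image_def)
      then have "x \<in> T" if "s \<noteq> 0"
        using that s r x(1) unfolding T_def by (intro CollectI conjI bexI[of _ "s * r"]) auto
      then show "s = \<zero>\<^bsub>R\<^esub> \<or> y = \<zero>\<^bsub>mod_image M M (\<lambda>x. r \<odot> x)\<^esub>"
        using ker[OF x(1)] x(2) by (auto simp: mod_image_def)
    qed
  qed
qed

text \<open>One member that is not torsionfree brings in all modules of finite length, and one that
  is not torsion brings in all torsionfree modules. Whether such members exist leaves four
  combinations, one for each subcategory.\<close>

lemma IKE_closed_cases:
  fixes emb :: "'k fps \<Rightarrow> 'm" and X :: "('k fps, 'm) module set"
  assumes emb: "inj emb" and X: "IKE_closed R X"
  shows "X \<in> {zero_cat R, fl_cat R, tf_cat R, mod_cat R}"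
proof -
  note D = IKE_D[OF X]
  note zero = summands_zero[OF D(1) IKE_closed_summands[OF X]]
  have fl: "fl_cat R \<subseteq> X" if M: "M \<in> X" "\<not> torsionfree R M" for M
  proof -
    obtain r x where "r \<in> carrier R" "r \<noteq> 0" "x \<in> carrier M" "x \<noteq> \<zero>\<^bsub>M\<^esub>" "r \<odot>\<^bsub>M\<^esub> x = \<zero>\<^bsub>M\<^esub>"
      using M(2) by (auto simp: torsionfree_def)
    then have "copies_in X residue_module" using IKE_residue[OF X M(1)] by blast
    then show ?thesis
      unfolding fl_cat_eq using torsion_in[OF D(2) zero] by (auto simp: copies_in_def)
  qed
  have tf: "tf_cat R \<subseteq> X" if M: "M \<in> X" "\<not> torsion M" for M
  proof -
    have Mc: "M \<in> mod_cat R" using M(1) D(3) by auto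
    note Mm = mod_catD(1)[OF Mc]
    obtain r where r: "r \<in> carrier R" "r \<noteq> 0"
      "torsionfree R (mod_image M M (\<lambda>x. r \<odot>\<^bsub>M\<^esub> x))" using torsion_part[OF Mc] by metis
    let ?N = "mod_image M M (\<lambda>x. r \<odot>\<^bsub>M\<^esub> x)"
    have N: "?N \<in> X" by (rule D(4)[OF M(1) M(1) smult_hom[OF Mm r(1)]])
    have "carrier ?N \<noteq> {\<zero>\<^bsub>?N\<^esub>}"
    proof
      assume "carrier ?N = {\<zero>\<^bsub>?N\<^esub>}"
      then have "r \<odot>\<^bsub>M\<^esub> x = \<zero>\<^bsub>M\<^esub>" if "x \<in> carrier M" for x using that by (auto simp: mod_image_def)
      then show False using M(2) r(1,2) by (auto simp: torsion_def)
    qed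
    then show ?thesis using IKE_torsionfree[OF emb X IKE_regular[OF emb X N r(3)]] by blast
  qed
  consider (1) "\<forall>M\<in>X. torsionfree R M" "\<forall>M\<in>X. torsion M"
    | (2) M where "\<forall>M\<in>X. torsion M" "M \<in> X" "\<not> torsionfree R M"
    | (3) M where "\<forall>M\<in>X. torsionfree R M" "M \<in> X" "\<not> torsion M"
    | (4) M N where "M \<in> X" "\<not> torsionfree R M" "N \<in> X" "\<not> torsion N" by blast
  then show ?thesis
  proof cases
    case 1
    have "X \<subseteq> zero_cat R"
    proof
      fix M assume M: "M \<in> X"
      then have Mc: "M \<in> mod_cat R" using D(3) by auto
      interpret module R M by (rule mod_catD(1)[OF Mc])
      have "x = \<zero>\<^bsub>M\<^esub>" if x: "x \<in> carrier M" for x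
        using 1 M x unfolding torsion_def torsionfree_def ring_ops by blast
      then have "carrier M = {\<zero>\<^bsub>M\<^esub>}" using M.zero_closed by blast
      then show "M \<in> zero_cat R" using Mc by (simp add: zero_cat_def)
    qed
    then show ?thesis using zero by blast
  next
    case 2
    then have "X \<subseteq> fl_cat R" using D(3) by (auto simp: fl_cat_eq)
    then show ?thesis using fl[OF 2(2,3)] by blast
  next
    case 3
    then have "X \<subseteq> tf_cat R" using D(3) by (auto simp: tf_cat_def)
    then show ?thesis using tf[OF 3(2,3)] by blast
  next
    case 4
    \<comment> \<open>Every module is an extension of a torsionfree module, the image of
      multiplication by \<open>r\<close>, by a torsion module, its kernel.\<close>
    have "mod_cat R \<subseteq> X"
    proof
      fix M :: "('k fps, 'm) module" assume M: "M \<in> mod_cat R"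
      note Mm = mod_catD(1)[OF M]
      obtain r where r: "r \<in> carrier R" "r \<noteq> 0"
        "torsion (M\<lparr>carrier := {x \<in> carrier M. r \<odot>\<^bsub>M\<^esub> x = \<zero>\<^bsub>M\<^esub>}\<rparr>)"
        "torsionfree R (mod_image M M (\<lambda>x. r \<odot>\<^bsub>M\<^esub> x))" by (rule torsion_part[OF M])
      note h = smult_hom[OF Mm r(1)]
      have "mod_image M M (\<lambda>x. r \<odot>\<^bsub>M\<^esub> x) \<in> mod_cat R"
        using module_image[OF Mm Mm h] fin_gen_image[OF Mm Mm h mod_catD(2)[OF M]] by (simp add: mod_cat_def)
      then have N: "mod_image M M (\<lambda>x. r \<odot>\<^bsub>M\<^esub> x) \<in> X"
        using tf[OF 4(3,4)] r(4) by (auto simp: tf_cat_def)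
      have "M\<lparr>carrier := {x \<in> carrier M. r \<odot>\<^bsub>M\<^esub> x = \<zero>\<^bsub>M\<^esub>}\<rparr> \<in> X"
        using fl[OF 4(1,2)] r(3) mod_cat_sub[OF M submodule_kernel[OF Mm Mm h]] by (auto simp: fl_cat_eq)
      then show "M \<in> X"
        using closed_extensions_surj[OF D(2) M mod_hom_to_image[OF h] _ N] by (simp add: mod_image_def)
    qed
    then show ?thesis using D(3) by blast
  qed
qed

lemma IKE_classification:
  fixes emb :: "'k fps \<Rightarrow> 'm"
  assumes "inj emb"
  shows "{X :: ('k fps, 'm) module set. IKE_closed R X} = {zero_cat R, fl_cat R, tf_cat R, mod_cat R}"
  using IKE_closed_cases[OF assms] IKE_closed_zero_cat[OF assms] IKE_closed_fl_cat[OF assms]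
    IKE_closed_tf_cat[OF assms] IKE_closed_mod_cat[OF assms] by blast

end

section \<open>Numerical semigroups\<close>

text \<open>A solution \<open>y < p\<close> of the congruence between \<open>y q\<close> and
  \<open>n\<close> modulo \<open>p\<close> satisfies \<open>y q \<le> p q \<le> n\<close>, so the
  rest \<open>n - y q\<close> is a nonnegative multiple of \<open>p\<close>.\<close>

lemma coprime_combination:
  fixes p q n :: nat
  assumes "coprime p q" "0 < p" "p * q \<le> n"
  obtains x y where "n = x * p + y * q"
proof -
  obtain y where y: "y < p" "(y * q) mod p = n mod p"
  \<comment> \<open>The Bezout identity used in the other case excludes the modulus
    \<open>1\<close>, for which \<open>y = 0\<close> works.\<close>
  proof (cases "p = 1")
    case True
    then show thesis using that[of 0] by simp
  next
    case False
    then obtain z u where "q * z = p * u + 1"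
      using coprime_bezout_strong[of q p] assms(1) by (auto simp: coprime_commute)
    then have "z * n * q = n + p * (u * n)" by (simp add: algebra_simps)
    then have "((z * n mod p) * q) mod p = n mod p" by (simp add: mod_mult_left_eq)
    then show thesis using that[of "z * n mod p"] assms(2) by simp
  qed
  have "y * q \<le> n" using y(1) assms(3) by (meson less_imp_le mult_le_mono1 order_trans)
  then have "p dvd n - y * q" using y(2) mod_eq_dvd_iff_nat[of "y * q" n p] by simp
  then obtain x where "n - y * q = p * x" ..
  then have "n = x * p + y * q" using \<open>y * q \<le> n\<close> by (simp add: mult.commute)
  then show ?thesis by (rule that)
qed

lemma sg_gen_zero: "0 \<in> sg_gen A"
  unfolding sg_gen_def by (auto intro: exI[of _ "\<lambda>_. 0"])

lemma sg_gen_add: "m \<in> sg_gen A \<Longrightarrow> n \<in> sg_gen A \<Longrightarrow> m + n \<in> sg_gen A"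
proof -
  assume "m \<in> sg_gen A" "n \<in> sg_gen A"
  then obtain u v where "m = (\<Sum>a\<in>A. u a * a)" "n = (\<Sum>a\<in>A. v a * a)" by (auto simp: sg_gen_def)
  then have "m + n = (\<Sum>a\<in>A. (u a + v a) * a)" by (simp add: sum.distrib algebra_simps)
  then show ?thesis unfolding sg_gen_def by (intro CollectI exI[of _ "\<lambda>a. u a + v a"]) simp
qed

lemma sg_gen_multiple: "finite A \<Longrightarrow> a \<in> A \<Longrightarrow> x * a \<in> sg_gen A"
  unfolding sg_gen_def
  by (intro CollectI exI[of _ "\<lambda>b. if b = a then x else 0"])
     (simp add: if_distrib[of "\<lambda>y. y * _"] sum.If_cases cong: if_cong)

text \<open>Two coprime generators reach every number from \<open>p q\<close> on, so a bound for the
  gaps exists. The least one is chosen because it determines the conductor ideal.\<close>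

lemma semigroup_ring_sg_gen:
  assumes "finite A" "p \<in> A" "q \<in> A" "coprime p q" "0 < p"
  obtains c e where "semigroup_ring (sg_gen A) c e (sg_ring (sg_gen A) :: 'k::field fps ring)"
    "\<And>d. (\<forall>n\<ge>d. n \<in> sg_gen A) \<Longrightarrow> c \<le> d"
proof -
  let ?H = "sg_gen A"
  define c where "c = (LEAST c. \<forall>n\<ge>c. n \<in> ?H)"
  define e where "e = (LEAST h. h \<in> ?H \<and> 0 < h)"
  have "n \<in> ?H" if pq: "p * q \<le> n" for n
  proof -
    obtain x y where "n = x * p + y * q" using coprime_combination[OF assms(4,5) pq] .
    then show ?thesis using sg_gen_add sg_gen_multiple[OF assms(1)] assms(2,3) by simp
  qed
  then have "\<forall>n\<ge>p * q. n \<in> ?H" by simp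
  then have c: "\<forall>n\<ge>c. n \<in> ?H" unfolding c_def by (rule LeastI[where P = "\<lambda>d. \<forall>n\<ge>d. n \<in> ?H"])
  have "p \<in> ?H \<and> 0 < p" using sg_gen_multiple[OF assms(1,2), of 1] assms(5) by simp
  then have e: "e \<in> ?H \<and> 0 < e" unfolding e_def by (rule LeastI[where P = "\<lambda>h. h \<in> ?H \<and> 0 < h"])
  show ?thesis
  proof (rule that)
    show "semigroup_ring ?H c e (sg_ring ?H)"
      by unfold_locales (use c e sg_gen_zero sg_gen_add in \<open>auto simp: e_def intro: Least_le\<close>)
    show "\<And>d. (\<forall>n\<ge>d. n \<in> ?H) \<Longrightarrow> c \<le> d" unfolding c_def by (rule Least_le)
  qed
qed

theorem theorem1p3:
  fixes H :: "nat set" and emb :: "'k::field fps \<Rightarrow> 'm"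
  assumes universe: "inj emb"
    and H: "(\<exists>a b :: nat. a > b \<and> b > 0 \<and> gcd a b = 1 \<and> H = sg_gen {a, b}) \<or>
            (\<exists>a r :: nat. a \<ge> 2 \<and> r \<ge> 1 \<and> H = sg_gen {a..a + r} \<and> infinite (UNIV :: 'k set))"
  shows "(H \<noteq> UNIV \<longrightarrow>
           (\<forall>N :: ('k fps, 'm) module.
              module (sg_ring H) N \<and> finite_length (sg_ring H) N \<longrightarrow>
              N \<in> built_from (sg_ring H) (quot_mod (sg_ring H) (conductor H)))) \<and>
         {X :: ('k fps, 'm) module set. IKE_closed (sg_ring H) X} =
           {zero_cat (sg_ring H), fl_cat (sg_ring H), tf_cat (sg_ring H), mod_cat (sg_ring H)}"
proof -
  \<comment> \<open>Both families contain two coprime generators: \<open>a\<close> and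
    \<open>b\<close> in the first, \<open>a\<close> and \<open>a + 1\<close> in the second because
    \<open>r \<ge> 1\<close>.\<close>
  obtain A p q where A: "finite A" "p \<in> A" "q \<in> A" "coprime p q" "0 < p" "H = sg_gen A"
    using H
  proof (elim disjE exE conjE)
    fix a b :: nat assume "a > b" "b > 0" "gcd a b = 1" "H = sg_gen {a, b}"
    then show thesis using that[of "{a, b}" a b] by (auto simp: coprime_iff_gcd_eq_1)
  next
    fix a r :: nat assume "a \<ge> 2" "r \<ge> 1" "H = sg_gen {a..a + r}"
    then show thesis using that[of "{a..a + r}" a "Suc a"] by (auto simp: coprime_Suc_right_nat)
  qed
  obtain c e where loc: "semigroup_ring H c e (sg_ring H :: 'k fps ring)"
    and c: "\<And>d. (\<forall>n\<ge>d. n \<in> H) \<Longrightarrow> c \<le> d"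
    using semigroup_ring_sg_gen[OF A(1-5)] unfolding A(6) by metis
  interpret semigroup_ring H c e "sg_ring H :: 'k fps ring" by (rule loc)
  \<comment> \<open>With \<open>c = 0\<close> every number would lie in \<open>H\<close>.\<close>
  have "1 \<le> c" if "H \<noteq> UNIV"
    using conductor_mem that by (cases c) auto
  then show ?thesis
    using built_from_conductor[OF universe c] IKE_classification[OF universe] by blast
qed

end
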